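(* Let $1\le p,q\le\infty$ and let $\alpha,\beta\in\mathbb{R}$ satisfy $\alpha-\frac1{p'}>0$ and $\beta-\frac1{q'}>0$. Consider locally integrable functions $f:\mathbb{R}\to\mathbb{C}$ such that $$\big\| f\,|x|^{\alpha}\big\|_{L^p(\mathbb{R})}+\big\|\widehat f\,|\xi|^{\beta}\big\|_{L^q(\mathbb{R})}<\infty. \qquad ( * )$$ Then: (1) If $(\alpha-\frac1{p'})(\beta-\frac1{q'})>\frac1{pq}$, then for every $f$ satisfying $( * )$ the limits $\lim_N P_N(f)$ and $\lim_N P_N(\widehat f)$ exist and are equal. (2) If $(\alpha-\frac1{p'})(\beta-\frac1{q'})=\frac1{pq}$ and $(p,q)=(1,1)$, then for every $f$ satisfying $( * )$ the limits $\lim_N P_N(f)$ and $\lim_N P_N(\widehat f)$ exist and are equal. (3) If $(\alpha-\frac1{p'})(\beta-\frac1{q'})=\frac1{pq}$ and $(p,q)\neq(1,1)$, then there exists $f$ satisfying $( * )$ for which neither $\lim_N P_N(f)$ nor $\lim_N P_N(\widehat f)$ exists; but for every $f$ satisfying $( * )$, if one of the limits $\lim_N P_N(f)$, $\lim_N P_N(\widehat f)$ exists, then so does the other and $\lim_N P_N(f)=\lim_N P_N(\widehat f)$. (In this item, existence of a limit is understood as convergence to a finite or infinite value, i.e. to a complex number or, for real-valued sequences, possibly to $+\infty$ or $-\infty$.) (4) If $(\alpha-\frac1{p'})(\beta-\frac1{q'})<\frac1{pq}$, then there exists $f$ satisfying $( * )$ for which $P_N(f)$ and $P_N(\widehat f)$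 converge, as $N\to\infty$, to different values.
   Context: $p'$ denotes the conjugate exponent, $\frac1p+\frac1{p'}=1$, with $1/\infty=0$ (similarly $q'$). The Fourier transform of an integrable function is $\widehat f(\xi)=\int_{\mathbb{R}}f(x)e^{-2\pi i x\xi}\,dx$. For a function $g$ on $\mathbb{R}$ and a positive integer $N$, $P_N(g)=\sum_{|k|\le N}g(k)$, the sum being over integers $k$. A locally integrable $f$ with $f|x|^\alpha\in L^p$ and $\alpha>1/p'$ is integrable, so $\widehat f$ is well defined and continuous; moreover $( * )$ implies $\widehat f\in L^1(\mathbb{R})$, so $f$ agrees a.e. with a continuous function, and the values $f(k)$ are those of the continuous representative.
   Formalization: In item (3), convergence to +∞ or −∞ means that the real parts tend to ±∞ and the imaginary parts tend to 0, not that the sequence is real-valued; literally, P_N(f) can be real and tend to +∞ while P_N of the Fourier transform is never real. For real f nothing changes. *)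

theory Defs
  imports "HOL-Analysis.Analysis" "HOL-Probability.Essential_Supremum"
begin

definition locally_integrable :: "(real \<Rightarrow> complex) \<Rightarrow> bool" where
  "locally_integrable f \<longleftrightarrow> (\<forall>K. compact K \<longrightarrow> set_integrable lebesgue K f)"

text \<open>The norm of \<open>L\<^sup>p(\<real>)\<close> as an extended number, \<open>1 \<le> p \<le> \<infinity>\<close>; the value is \<open>\<infinity>\<close> when \<open>g\<close>
  is not in \<open>L\<^sup>p\<close>.  It is meant for Lebesgue measurable \<open>g\<close>.\<close>
definition Lp_norm :: "ennreal \<Rightarrow> (real \<Rightarrow> complex) \<Rightarrow> ennreal" where
  "Lp_norm p g =
    (if p = \<infinity> then esssup lebesgue (\<lambda>x. ennreal (norm (g x)))
     else (let I = (\<integral>\<^sup>+x. ennreal (norm (g x) powr enn2real p) \<partial>lebesgue)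
           in if I = \<infinity> then \<infinity> else ennreal (enn2real I powr (1 / enn2real p))))"

definition fourier :: "(real \<Rightarrow> complex) \<Rightarrow> real \<Rightarrow> complex" where
  "fourier f \<xi> =
    (LINT x|lebesgue. f x * exp (- 2 * of_real pi * \<i> * of_real x * of_real \<xi>))"

text \<open>The continuous function that agrees a.e.\ with \<open>f\<close>.  It is unique when it exists, and
  unspecified when no such function exists.\<close>
definition cont_rep :: "(real \<Rightarrow> complex) \<Rightarrow> real \<Rightarrow> complex" where
  "cont_rep f = (THE g. continuous_on UNIV g \<and> (AE x in lebesgue. g x = f x))"

definition P :: "nat \<Rightarrow> (real \<Rightarrow> complex) \<Rightarrow> complex" where
  "P N g = (\<Sum>k\<in>{- int N..int N}. g (of_int k))"

definition weighted_condition ::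
  "ennreal \<Rightarrow> ennreal \<Rightarrow> real \<Rightarrow> real \<Rightarrow> (real \<Rightarrow> complex) \<Rightarrow> bool" where
  "weighted_condition p q \<alpha> \<beta> f \<longleftrightarrow>
     locally_integrable f \<and>
     Lp_norm p (\<lambda>x. f x * of_real (\<bar>x\<bar> powr \<alpha>)) +
     Lp_norm q (\<lambda>\<xi>. fourier f \<xi> * of_real (\<bar>\<xi>\<bar> powr \<beta>)) < \<infinity>"

text \<open>Limits that are complex numbers or \<open>\<plusminus>\<infinity>\<close>.  For real-valued sequences the infinite limits are
  the usual ones.  The imaginary part is only required to tend to \<open>0\<close>, not to vanish: for
  functions with complex values the partial sums of \<open>f\<close> may be real while those of its Fourier
  transform are not, even though the imaginary parts of the latter tend to \<open>0\<close>.\<close>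
datatype xlimit = Finite complex | Plus_Infinity | Minus_Infinity

fun tends_to_xlimit :: "(nat \<Rightarrow> complex) \<Rightarrow> xlimit \<Rightarrow> bool" where
  "tends_to_xlimit s (Finite z) \<longleftrightarrow> s \<longlonglongrightarrow> z"
| "tends_to_xlimit s Plus_Infinity \<longleftrightarrow>
     filterlim (\<lambda>n. Re (s n)) at_top sequentially \<and> (\<lambda>n. Im (s n)) \<longlonglongrightarrow> 0"
| "tends_to_xlimit s Minus_Infinity \<longleftrightarrow>
     filterlim (\<lambda>n. Re (s n)) at_bot sequentially \<and> (\<lambda>n. Im (s n)) \<longlonglongrightarrow> 0"

definition has_xlimit :: "(nat \<Rightarrow> complex) \<Rightarrow> bool" where
  "has_xlimit s \<longleftrightarrow> (\<exists>L. tends_to_xlimit s L)"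

end

theory Submission
  imports Defs "HOL-Probability.Characteristic_Functions" "HOL-Probability.Sinc_Integral" "HOL-Real_Asymp.Real_Asymp"
begin

text \<open>
  Replace \<open>f\<close> by its continuous representative (Fourier inversion), and put \<open>A = \<alpha> - 1/p'\<close>,
  \<open>B = \<beta> - 1/q'\<close>.  With the Dirichlet kernel \<open>D\<close>, \<open>P\<^sub>M(f)\<close> is the integral of \<open>f\<^sup>^ D\<^sub>M\<close> and \<open>P\<^sub>L(f\<^sup>^)\<close>
  that of \<open>f D\<^sub>L\<close>.  Multiplying \<open>D\<^sub>L\<close> by the partition of unity \<open>\<tau>\<^sub>M\<close> made of the triangles at the
  integers \<open>|k| \<le> M\<close>, and \<open>D\<^sub>M\<close> by the sum \<open>\<sigma>\<^sub>L\<close> of their transforms \<open>sinc\<^sup>2(\<xi> - n)\<close>, \<open>|n| \<le> L\<close>, turns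
  one integral into the other.  Hence \<open>P\<^sub>M(f) - P\<^sub>L(f\<^sup>^)\<close> is controlled by the tails of \<open>f D\<^sub>L\<close> beyond
  \<open>M\<close> and of \<open>f\<^sup>^ D\<^sub>M\<close> beyond \<open>L/2\<close>, which are \<open>o(1)\<close> times \<open>L\<^bsup>1/p\<^esup> M\<^bsup>-A\<^esup>\<close> and \<open>M\<^bsup>1/q\<^esup> L\<^bsup>-B\<^esup>\<close>.  If
  \<open>A B \<ge> 1/(p q)\<close>, both are \<open>o(1)\<close> for \<open>L\<close> of order \<open>M\<^bsup>A p\<^esup>\<close>, so the two sequences have the same
  limits, although at different scales.  The errors are summable along \<open>M = 2\<^sup>j\<close> if the inequality is
  strict or if \<open>p = q = 1\<close>, and then the limits exist.

  The counterexamples are series of combs: bumps of width \<open>1/W\<close> at the integers near \<open>2 N\<close>, with the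
  Fejer coefficients of order \<open>N\<close>.  The norms of such a comb are of order \<open>N\<^sup>A W\<^bsup>-1/p\<^esup>\<close> and
  \<open>W\<^sup>B N\<^bsup>-1/q\<^esup>\<close>; both can be made small precisely when \<open>A B < 1/(p q)\<close>.
\<close>

section \<open>Fourier inversion\<close>

text \<open>In the critical case the partial sums may diverge, so no absolutely convergent Poisson
  formula is available, and a partial sum of \<open>f\<close> has to be compared with one of the
  transform of a different order. The two cut-offs are not alike. \<open>\<tau>\<^sub>M\<close>
  equals 1 exactly on [-M, M], so the error on the side of \<open>f\<close> is a pure tail.
  \<open>\<sigma>\<^sub>L\<close> is only close to 1 for |\<xi>| \<le> L/2; its defect is at most
  sin^2(pi \<xi>) / L, and this sine cancels the peaks of the Dirichlet kernel at the integers,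
  which leaves an error of order 1/L whatever M is.

  With L = M^\<gamma> both tails stay controlled when 1/(q B) \<le> \<gamma> \<le> A p. This window
  is an interval, a point or empty according to the sign of A B - 1/(p q). Inside it a power of M is
  gained, hence geometric errors on dyadic blocks. At a single point only o(1) remains, which
  carries a limit over but does not create one; for p = q = 1 the o(1) terms are tails of convergent
  integrals and can be summed over the blocks. If the window is empty, the reversed inequalities A p
  < \<gamma> < 1/(q B) give the widths W = N^\<gamma> of the combs.\<close>

lemma cis_measurable [measurable]: "cis \<in> borel_measurable borel"
  by (intro borel_measurable_continuous_onI continuous_intros)

lemma fourier_cis: "fourier f \<xi> = (LINT x|lebesgue. f x * cis (- (2 * pi * x * \<xi>)))"
  unfolding fourier_def by (simp add: cis_conv_exp algebra_simps)

lemma fourier_cong_AE: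
  assumes "AE x in lebesgue. f x = g x" and "f \<in> borel_measurable lebesgue" "g \<in> borel_measurable lebesgue"
  shows "fourier f = fourier g"
proof
  fix \<xi>
  show "fourier f \<xi> = fourier g \<xi>"
    unfolding fourier_cis
  proof (rule integral_cong_AE)
    have [measurable]: "(\<lambda>x. cis (- (2 * pi * x * \<xi>))) \<in> borel_measurable lebesgue"
      by (intro measurable_completion measurable_compose[OF _ cis_measurable]) simp
    show "(\<lambda>x. f x * cis (- (2 * pi * x * \<xi>))) \<in> borel_measurable lebesgue"
         "(\<lambda>x. g x * cis (- (2 * pi * x * \<xi>))) \<in> borel_measurable lebesgue"
      using assms by measurable
  qed (use assms(1) in auto)
qed

lemma fourier_lborel:
  assumes [measurable]: "f \<in> borel_measurable borel"
  shows "fourier f \<xi> = (LINT x|lborel. f x * cis (- (2 * pi * x * \<xi>)))"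
  unfolding fourier_cis by (rule integral_completion) measurable

lemma integrable_mult_cis:
  assumes "integrable lborel f" and [measurable]: "g \<in> borel_measurable borel"
  shows "integrable lborel (\<lambda>x::real. f x * cis (g x))"
proof -
  have [measurable]: "f \<in> borel_measurable borel" using assms(1) by auto
  show ?thesis by (rule Bochner_Integration.integrable_bound[OF assms(1)]) (auto simp: norm_mult)
qed

lemma norm_fourier_le:
  assumes "integrable lborel f"
  shows "norm (fourier f \<xi>) \<le> (LINT x|lborel. norm (f x))"
proof -
  have [measurable]: "f \<in> borel_measurable borel" using assms(1) by auto
  have "norm (fourier f \<xi>) \<le> (LINT x|lborel. norm (f x * cis (- (2 * pi * x * \<xi>))))"
    unfolding fourier_lborel[OF \<open>f \<in> _\<close>] by (rule integral_norm_bound)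
  then show ?thesis by (simp add: norm_mult)
qed

lemma continuous_on_fourier:
  assumes "integrable lborel f"
  shows "continuous_on UNIV (fourier f)"
proof -
  have [measurable]: "f \<in> borel_measurable borel" using assms(1) by auto
  have "(\<lambda>n. fourier f (X n)) \<longlonglongrightarrow> fourier f y" if X: "X \<longlonglongrightarrow> y" for X y
    unfolding fourier_lborel[OF \<open>f \<in> _\<close>]
  proof (rule integral_dominated_convergence[where w="\<lambda>x. norm (f x)"])
    show "AE x in lborel. (\<lambda>n. f x * cis (- (2 * pi * x * X n))) \<longlonglongrightarrow> f x * cis (- (2 * pi * x * y))"
      by (intro AE_I2 tendsto_intros X)
  qed (use assms in \<open>auto simp: norm_mult\<close>)
  then show ?thesis
    by (simp add: continuous_on_sequentially comp_def)
qed

lemma fourier_measurable [measurable]: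
  assumes "integrable lborel f" shows "fourier f \<in> borel_measurable borel"
  by (intro borel_measurable_continuous_onI continuous_on_fourier assms)

text \<open>A bounded kernel against two integrable functions makes the double integral absolutely
  convergent. It serves twice: with exponentials for the multiplication formula, and with Gaussian
  kernels in the inversion theorem.\<close>

lemma fubini_cis:
  fixes f g :: "real \<Rightarrow> complex" and h :: "real \<Rightarrow> real \<Rightarrow> complex"
  assumes f: "integrable lborel f" and g: "integrable lborel g"
    and h [measurable]: "case_prod h \<in> borel_measurable (borel \<Otimes>\<^sub>M borel)"
    and hb: "\<And>x y. norm (h x y) \<le> C"
  shows "(LINT x|lborel. f x * (LINT y|lborel. g y * h x y)) = (LINT y|lborel. g y * (LINT x|lborel. f x * h x y))"
proof -
  have [measurable]: "f \<in> borel_measurable borel" "g \<in> borel_measurable borel" using assms by auto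
  have C: "C \<ge> 0" using hb[of 0 0] norm_ge_zero order_trans by blast
  have int: "integrable (lborel \<Otimes>\<^sub>M lborel) (\<lambda>(x, y). f x * (g y * h x y))"
  proof (rule lborel_pair.Fubini_integrable)
    show "(\<lambda>(x, y). f x * (g y * h x y)) \<in> borel_measurable (lborel \<Otimes>\<^sub>M lborel)" by measurable
    have gh: "integrable lborel (\<lambda>y. g y * h x y)" for x
      by (rule Bochner_Integration.integrable_bound[where f="\<lambda>y. C * norm (g y)"])
         (use g hb C in \<open>auto simp: norm_mult mult.commute[of C] intro!: AE_I2 mult_left_mono\<close>)
    show "AE x in lborel. integrable lborel (\<lambda>y. case (x, y) of (x, y) \<Rightarrow> f x * (g y * h x y))"
      using gh by auto
    have "integrable lborel (\<lambda>x. norm (f x) * (LINT y|lborel. norm (g y * h x y)))"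
    proof (rule Bochner_Integration.integrable_bound[where f="\<lambda>x. (LINT y|lborel. C * norm (g y)) * norm (f x)"])
      have "norm (LINT y|lborel. norm (g y * h x y)) \<le> (LINT y|lborel. C * norm (g y))" for x
      proof -
        have "(LINT y|lborel. norm (g y * h x y)) \<le> (LINT y|lborel. C * norm (g y))"
        proof (rule integral_mono)
          show "integrable lborel (\<lambda>y. norm (g y * h x y))" by (rule integrable_norm[OF gh])
          show "norm (g y * h x y) \<le> C * norm (g y)" for y
            using mult_left_mono[OF hb, of "norm (g y)"] by (simp add: norm_mult mult.commute)
        qed (use g in auto)
        then show ?thesis by simp
      qed
      then show "AE x in lborel. norm (norm (f x) * (LINT y|lborel. norm (g y * h x y)))
          \<le> norm ((LINT y|lborel. C * norm (g y)) * norm (f x))"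
        using C by (auto simp: mult.commute abs_mult intro!: mult_left_mono)
    qed (use f in auto)
    then show "integrable lborel (\<lambda>x. LINT y|lborel. norm (case (x, y) of (x, y) \<Rightarrow> f x * (g y * h x y)))"
      by (simp add: norm_mult)
  qed
  have "(LINT x|lborel. f x * (LINT y|lborel. g y * h x y)) = (LINT x|lborel. (LINT y|lborel. f x * (g y * h x y)))"
    by simp
  also have "\<dots> = (LINT y|lborel. (LINT x|lborel. f x * (g y * h x y)))"
    using lborel_pair.Fubini_integral[OF int] by simp
  also have "\<dots> = (LINT y|lborel. g y * (LINT x|lborel. f x * h x y))"
    by (subst integral_mult_right_zero[symmetric]) (simp add: mult_ac)
  finally show ?thesis .
qed

lemma fourier_multiplication:
  assumes f: "integrable lborel f" and g: "integrable lborel g"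
  shows "(LINT x|lborel. fourier f x * g x) = (LINT x|lborel. f x * fourier g x)"
proof -
  have [measurable]: "f \<in> borel_measurable borel" "g \<in> borel_measurable borel" using assms by auto
  show ?thesis
    using fubini_cis[OF g f, of "\<lambda>x y. cis (- (2 * pi * y * x))" 1]
    by (simp add: fourier_lborel mult_ac)
qed

text \<open>Closed intervals are stable under intersection and generate the Borel sets, so vanishing
  integrals spread from them to all Borel sets.\<close>

lemma AE_zero_if_interval_integrals_zero:
  fixes u :: "real \<Rightarrow> complex"
  assumes u: "integrable lborel u" and z: "\<And>a b. (LINT x:{a..b}|lborel. u x) = 0"
  shows "AE x in lborel. u x = 0"
proof (rule sigma_finite_measure.density_zero[OF lborel.sigma_finite_measure_axioms u])
  have [measurable]: "u \<in> borel_measurable borel" using u by auto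
  have su: "set_integrable lborel A u" if "A \<in> sets borel" for A
    unfolding set_integrable_def by (rule integrable_mult_indicator) (use u that in auto)
  \<comment> \<open>The complement step of the induction needs the integral over the whole line,
    which is the limit of those over [-n, n].\<close>
  have tot: "(LINT x|lborel. u x) = 0"
  proof -
    have "(\<lambda>n::nat. (LINT x|lborel. indicator {- real n..real n} x *\<^sub>R u x)) \<longlonglongrightarrow> (LINT x|lborel. u x)"
    proof (rule integral_dominated_convergence[where w="\<lambda>x. norm (u x)"])
      have "eventually (\<lambda>n::nat. indicator {- real n..real n} x *\<^sub>R u x = u x) sequentially" for x
      proof (rule eventually_sequentiallyI[of "nat \<lceil>\<bar>x\<bar>\<rceil>"])
        fix n assume "nat \<lceil>\<bar>x\<bar>\<rceil> \<le> n" then have "- real n \<le> x" "x \<le> real n" by linarith+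
        then show "indicator {- real n..real n} x *\<^sub>R u x = u x" by simp
      qed
      then show "AE x in lborel. (\<lambda>n::nat. indicator {- real n..real n} x *\<^sub>R u x) \<longlonglongrightarrow> u x"
        by (auto intro!: tendsto_eventually)
    qed (use u in \<open>auto split: split_indicator\<close>)
    then have "(\<lambda>n::nat. 0) \<longlonglongrightarrow> (LINT x|lborel. u x)"
      using z by (simp add: set_lebesgue_integral_def)
    then show ?thesis by (rule LIMSEQ_unique[OF _ tendsto_const])
  qed
  fix A :: "real set" assume "A \<in> sets lborel"
  then have A: "A \<in> sigma_sets UNIV (range (\<lambda>(a, b). {a..b::real}))"
    by (simp add: borel_eq_atLeastAtMost)
  have "Int_stable (range (\<lambda>(a, b). {a..b::real}))" "range (\<lambda>(a, b). {a..b::real}) \<subseteq> Pow UNIV"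
    by (auto simp: Int_stable_def)
  then show "(LINT x:A|lborel. u x) = 0"
    using A
  proof (induction rule: sigma_sets_induct_disjoint)
    case (compl A)
    then have [measurable]: "A \<in> sets borel" by (simp add: borel_eq_atLeastAtMost)
    have "(LINT x:UNIV - A|lborel. u x) + (LINT x:A|lborel. u x) = (LINT x:(UNIV - A) \<union> A|lborel. u x)"
      by (rule set_integral_Un[symmetric]) (auto intro!: su)
    then show ?case using compl tot by (simp add: set_lebesgue_integral_def)
  next
    case (union A)
    then have [measurable]: "A i \<in> sets borel" for i by (auto simp: borel_eq_atLeastAtMost)
    have "(LINT x:(\<Union>i. A i)|lborel. u x) = (\<Sum>i. (LINT x:(A i)|lborel. u x))"
      by (rule lebesgue_integral_countable_add) (use union in \<open>auto simp: disjoint_family_on_def intro!: su\<close>)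
    then show ?case using union by simp
  qed (use z in \<open>auto simp: set_lebesgue_integral_def\<close>)
qed

text \<open>This is the characteristic function of the standard normal law after the substitution
  \<open>s * x\<close>.\<close>

lemma gaussian_transform:
  fixes s t :: real
  assumes "s > 0"
  shows "integrable lborel (\<lambda>x. exp (- (s * x)\<^sup>2 / 2))"
    and "(LINT x|lborel. of_real (exp (- (s * x)\<^sup>2 / 2)) * cis (t * x))
      = of_real (sqrt (2 * pi) / s * exp (- (t / s)\<^sup>2 / 2))"
proof -
  have i: "integrable lborel (\<lambda>x. std_normal_density (0 + s * x))"
    by (rule lborel_integrable_real_affine) (use assms in \<open>auto simp: integrable_normal_density\<close>)
  have e: "exp (- (s * x)\<^sup>2 / 2) = sqrt (2 * pi) * std_normal_density (0 + s * x)" for x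
    by (simp add: std_normal_density_def)
  show "integrable lborel (\<lambda>x. exp (- (s * x)\<^sup>2 / 2))"
    unfolding e using i by (intro integrable_mult_right)
  have "complex_of_real (exp (- (t / s)\<^sup>2 / 2)) = char std_normal_distribution (t / s)"
    by (simp add: char_std_normal_distribution)
  also have "\<dots> = (LINT x|lborel. of_real (std_normal_density x) * cis (t / s * x))"
    unfolding char_def by (subst integral_density) (auto simp: cis_conv_exp scaleR_conv_of_real)
  also have "\<dots> = of_real s * (LINT x|lborel. of_real (std_normal_density (0 + s * x)) * cis (t / s * (0 + s * x)))"
    using lborel_integral_real_affine[of s "\<lambda>x. of_real (std_normal_density x) * cis (t / s * x)" 0] assms
    by (simp add: scaleR_conv_of_real)
  finally have "(LINT x|lborel. of_real (std_normal_density (0 + s * x)) * cis (t * x)) = of_real (exp (- (t / s)\<^sup>2 / 2)) / of_real s"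
    using assms by (simp add: field_simps)
  then show "(LINT x|lborel. of_real (exp (- (s * x)\<^sup>2 / 2)) * cis (t * x))
      = of_real (sqrt (2 * pi) / s * exp (- (t / s)\<^sup>2 / 2))"
    unfolding e of_real_mult by (subst mult.assoc, subst integral_mult_right_zero) simp
qed

text \<open>Gaussian summation: damping the inversion integral by exp(-(s \<xi>)^2/2) turns it, by
  the multiplication formula, into a Gaussian average of \<open>f\<close>. Both sides are integrated
  over [a, b] before s tends to 0. Then dominated convergence applies to each of them, and no
  pointwise convergence of averages of a merely integrable function has to be established.\<close>

lemma fourier_inversion_AE:
  assumes f: "integrable lborel f" and g: "integrable lborel (fourier f)"
  shows "AE x in lborel. f x = fourier (fourier f) (- x)"
proof -
  define h where "h x = fourier (fourier f) (- x)" for x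
  have fm [measurable]: "f \<in> borel_measurable borel" using f by auto
  have gm [measurable]: "fourier f \<in> borel_measurable borel" using g by auto
  have hc: "continuous_on UNIV h"
    unfolding h_def by (intro continuous_on_compose2[OF continuous_on_fourier[OF g]] continuous_intros) auto
  then have hm [measurable]: "h \<in> borel_measurable borel" by (rule borel_measurable_continuous_onI)
  have heq: "h x = (LINT \<xi>|lborel. fourier f \<xi> * cis (2 * pi * x * \<xi>))" for x
    unfolding h_def fourier_lborel[OF gm] by (simp add: mult_ac)
  define k where "k s u = sqrt (2 * pi) / s * exp (- (2 * pi * u / s)\<^sup>2 / 2)" for s u :: real
  have km [measurable]: "(\<lambda>(x, y). k s (x - y)) \<in> borel_measurable (borel \<Otimes>\<^sub>M borel)" for s
    unfolding k_def by measurable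
  have km' [measurable]: "(\<lambda>x. k s x) \<in> borel_measurable borel" for s
    unfolding k_def by measurable
  have knn: "k s u \<ge> 0" if "s > 0" for s u using that by (simp add: k_def)
  have kb: "k s u \<le> sqrt (2 * pi) / s" if "s > 0" for s u
    unfolding k_def using that by (intro mult_left_le) auto
  define I where "I s x = (LINT \<xi>|lborel. fourier f \<xi> * (of_real (exp (- (s * \<xi>)\<^sup>2 / 2)) * cis (2 * pi * x * \<xi>)))" for s x :: real
  have step1: "I s x = (LINT y|lborel. f y * of_real (k s (x - y)))" if s: "s > 0" for s x
  proof -
    have i: "integrable lborel (\<lambda>\<xi>. complex_of_real (exp (- (s * \<xi>)\<^sup>2 / 2)) * cis (2 * pi * x * \<xi>))"
      by (rule integrable_mult_cis) (use gaussian_transform(1)[OF s] in \<open>auto intro: integrable_of_real\<close>)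
    have "fourier (\<lambda>\<xi>. complex_of_real (exp (- (s * \<xi>)\<^sup>2 / 2)) * cis (2 * pi * x * \<xi>)) y = of_real (k s (x - y))" for y
    proof -
      have "fourier (\<lambda>\<xi>. complex_of_real (exp (- (s * \<xi>)\<^sup>2 / 2)) * cis (2 * pi * x * \<xi>)) y
          = (LINT \<xi>|lborel. of_real (exp (- (s * \<xi>)\<^sup>2 / 2)) * cis ((2 * pi * (x - y)) * \<xi>))"
      proof -
        have "cis (2 * pi * x * \<xi>) * cis (- (2 * pi * \<xi> * y)) = cis ((2 * pi * (x - y)) * \<xi>)" for \<xi>
          by (simp add: cis_mult algebra_simps)
        then show ?thesis
          using i by (subst fourier_lborel) (auto simp: mult.assoc)
      qed
      also have "\<dots> = of_real (k s (x - y))"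
        unfolding gaussian_transform(2)[OF s] by (simp add: k_def)
      finally show ?thesis .
    qed
    then show ?thesis
      unfolding I_def fourier_multiplication[OF f i] by simp
  qed
  \<comment> \<open>The mass that the Gaussian centred at y puts on [a, b]. As s tends to 0 it tends
    to the indicator of [a, b], except possibly at the two endpoints, which form a null set.\<close>
  define m where "m a b s y = (LINT x|lborel. indicator {a..b} x * k s (x - y))" for a b s y :: real
  have meq: "m a b s y = (LINT z|lborel. std_normal_density z * indicator {a..b} (y + s / (2 * pi) * z))"
    if s: "s > 0" for a b s y
  proof -
    have "m a b s y = s / (2 * pi) * (LINT z|lborel. indicator {a..b} (y + s / (2 * pi) * z) * k s (s / (2 * pi) * z))"
      unfolding m_def
      using lborel_integral_real_affine[of "s / (2 * pi)" "\<lambda>x. indicator {a..b} x * k s (x - y)" y] s by simp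
    also have "\<dots> = (LINT z|lborel. s / (2 * pi) * (indicator {a..b} (y + s / (2 * pi) * z) * k s (s / (2 * pi) * z)))"
      by simp
    also have "\<dots> = (LINT z|lborel. std_normal_density z * indicator {a..b} (y + s / (2 * pi) * z))"
    proof (intro Bochner_Integration.integral_cong refl)
      fix z
      have "s / (2 * pi) * k s (s / (2 * pi) * z) = std_normal_density z"
        using s by (simp add: k_def std_normal_density_def field_simps)
      then show "s / (2 * pi) * (indicator {a..b} (y + s / (2 * pi) * z) * k s (s / (2 * pi) * z))
         = std_normal_density z * indicator {a..b} (y + s / (2 * pi) * z)"
        by (metis mult.commute mult.left_commute)
    qed
    finally show ?thesis .
  qed
  have nint: "integrable lborel std_normal_density" "(LINT z|lborel. std_normal_density z) = 1"
    by (auto simp: integrable_normal_density integral_normal_density)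
  have mlim: "(\<lambda>n. m a b (1 / real (Suc n)) y) \<longlonglongrightarrow> indicator {a..b} y" if "y \<noteq> a" "y \<noteq> b" for a b y
  proof -
    have "(\<lambda>n. LINT z|lborel. std_normal_density z * indicator {a..b} (y + 1 / real (Suc n) / (2 * pi) * z))
        \<longlonglongrightarrow> (LINT z|lborel. std_normal_density z * indicator {a..b} y)"
    proof (rule integral_dominated_convergence[where w=std_normal_density])
      have "(\<lambda>n. y + 1 / real (Suc n) / (2 * pi) * z) \<longlonglongrightarrow> y" for z by real_asymp
      moreover have "isCont (indicator {a..b} :: real \<Rightarrow> real) y"
      proof -
        have "y \<in> interior {a..b} \<or> y \<in> interior (- {a..b})" 
          using that interior_open[OF open_Compl[OF closed_atLeastAtMost, of a b]]
          by (auto simp: interior_atLeastAtMost_real)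
        then have "y \<notin> frontier {a..b}" by (auto simp: frontier_def closure_interior)
        then show ?thesis using isCont_indicator by blast
      qed
      ultimately show "AE z in lborel. (\<lambda>n. std_normal_density z * indicator {a..b} (y + 1 / real (Suc n) / (2 * pi) * z))
        \<longlonglongrightarrow> std_normal_density z * indicator {a..b} y"
        by (intro AE_I2 tendsto_mult tendsto_const isCont_tendsto_compose[of _ "indicator {a..b}"])
    qed (use nint in \<open>auto split: split_indicator\<close>)
    then show ?thesis using nint by (simp add: meq)
  qed
  have mb: "\<bar>m a b s y\<bar> \<le> 1" if s: "s > 0" for a b s y
  proof -
    have "\<bar>m a b s y\<bar> \<le> (LINT z|lborel. \<bar>std_normal_density z * indicator {a..b} (y + s / (2 * pi) * z)\<bar>)"
      unfolding meq[OF s]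
      using integral_norm_bound[of lborel "\<lambda>z. std_normal_density z * indicator {a..b} (y + s / (2 * pi) * z)"]
      unfolding real_norm_def .
    also have "\<dots> \<le> (LINT z|lborel. std_normal_density z)"
      by (rule integral_mono') (use nint in \<open>auto split: split_indicator\<close>)
    finally show ?thesis using nint by simp
  qed
  have mm [measurable]: "(\<lambda>y. m a b s y) \<in> borel_measurable borel" if s: "s > 0" for a b s
    unfolding m_def by measurable
  have key: "(LINT x:{a..b}|lborel. h x) = (LINT x:{a..b}|lborel. f x)" for a b
  proof -
    define s where "s n = 1 / real (Suc n)" for n
    have sp: "s n > 0" for n by (simp add: s_def)
    have ind': "integrable lborel (\<lambda>x. indicator {a..b} x :: real)"
      by (intro integrable_real_indicator) (auto simp: emeasure_lborel_Icc_eq)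
    have "(\<lambda>x. indicator {a..b} x :: complex) = (\<lambda>x. of_real (indicator {a..b} x))"
      by (auto simp: fun_eq_iff split: split_indicator)
    then have ind: "integrable lborel (\<lambda>x. indicator {a..b} x :: complex)"
      using integrable_of_real[OF ind'] by simp
    have Im [measurable]: "I (s n) \<in> borel_measurable borel" for n unfolding I_def by measurable
    have e1: "(LINT x|lborel. indicator {a..b} x * I (s n) x) = (LINT y|lborel. f y * of_real (m a b (s n) y))" for n
    proof -
      have "(LINT x|lborel. indicator {a..b} x * I (s n) x) = (LINT x|lborel. indicator {a..b} x * (LINT y|lborel. f y * of_real (k (s n) (x - y))))"
        by (simp add: step1 sp)
      also have "\<dots> = (LINT y|lborel. f y * (LINT x|lborel. indicator {a..b} x * of_real (k (s n) (x - y))))"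
        by (rule fubini_cis[OF ind f, where C="sqrt (2 * pi) / s n"]) (use kb[OF sp] knn[OF sp] in \<open>auto\<close>)
      also have "\<dots> = (LINT y|lborel. f y * of_real (m a b (s n) y))"
      proof (intro Bochner_Integration.integral_cong refl arg_cong2[where f="(*)"])
        fix y
        have "complex_of_real (m a b (s n) y) = (LINT x|lborel. of_real (indicator {a..b} x * k (s n) (x - y)))"
          unfolding m_def by (rule integral_complex_of_real[symmetric])
        also have "\<dots> = (LINT x|lborel. indicator {a..b} x * of_real (k (s n) (x - y)))"
          by (intro Bochner_Integration.integral_cong refl) (auto split: split_indicator)
        finally show "(LINT x|lborel. indicator {a..b} x * complex_of_real (k (s n) (x - y))) = of_real (m a b (s n) y)" ..
      qed
      finally show ?thesis .
    qed
    have l1: "(\<lambda>n. LINT y|lborel. f y * of_real (m a b (s n) y)) \<longlonglongrightarrow> (LINT y|lborel. f y * of_real (indicator {a..b} y))"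
    proof (rule integral_dominated_convergence[where w="\<lambda>y. norm (f y)"])
      have "AE y in lborel. y \<noteq> a \<and> y \<noteq> b"
        using AE_lborel_singleton[of a] AE_lborel_singleton[of b] by eventually_elim auto
      then show "AE y in lborel. (\<lambda>n. f y * complex_of_real (m a b (s n) y)) \<longlonglongrightarrow> f y * of_real (indicator {a..b} y)"
        unfolding s_def by eventually_elim (intro tendsto_intros mlim, auto)
      show "\<And>n. AE x in lborel. cmod (f x * complex_of_real (m a b (s n) x)) \<le> cmod (f x)"
        by (intro AE_I2) (auto simp: norm_mult intro!: mult_left_le mb sp)
    qed (use f mm[OF sp] in auto)
    have l2: "(\<lambda>n. LINT x|lborel. indicator {a..b} x * I (s n) x) \<longlonglongrightarrow> (LINT x|lborel. indicator {a..b} x * h x)"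
    proof (rule integral_dominated_convergence[where w="\<lambda>x. indicator {a..b} x * (LINT \<xi>|lborel. norm (fourier f \<xi>))"])
      have "(\<lambda>n. I (s n) x) \<longlonglongrightarrow> h x" for x
        unfolding I_def heq
      proof (rule integral_dominated_convergence[where w="\<lambda>\<xi>. norm (fourier f \<xi>)"])
        have "s \<longlonglongrightarrow> 0"
          unfolding s_def by real_asymp
        then have "(\<lambda>n. exp (- (s n * \<xi>)\<^sup>2 / 2)) \<longlonglongrightarrow> exp (- (0 * \<xi>)\<^sup>2 / 2)" for \<xi>
          by (intro tendsto_intros) auto
        then have "(\<lambda>n. exp (- (s n * \<xi>)\<^sup>2 / 2)) \<longlonglongrightarrow> 1" for \<xi> by simp
        then have "(\<lambda>n. fourier f \<xi> * (of_real (exp (- (s n * \<xi>)\<^sup>2 / 2)) * cis (2 * pi * x * \<xi>)))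
          \<longlonglongrightarrow> fourier f \<xi> * (of_real 1 * cis (2 * pi * x * \<xi>))" for \<xi>
          by (intro tendsto_mult tendsto_const tendsto_of_real)
        then show "AE \<xi> in lborel. (\<lambda>n. fourier f \<xi> * (of_real (exp (- (s n * \<xi>)\<^sup>2 / 2)) * cis (2 * pi * x * \<xi>)))
          \<longlonglongrightarrow> fourier f \<xi> * cis (2 * pi * x * \<xi>)" by simp
        show "\<And>n. AE \<xi> in lborel. norm (fourier f \<xi> * (of_real (exp (- (s n * \<xi>)\<^sup>2 / 2)) * cis (2 * pi * x * \<xi>))) \<le> norm (fourier f \<xi>)"
          by (intro AE_I2) (auto simp: norm_mult intro!: mult_left_le)
      qed (use g in auto)
      then show "AE x in lborel. (\<lambda>n. indicator {a..b} x * I (s n) x) \<longlonglongrightarrow> indicator {a..b} x * h x"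
        by (intro AE_I2 tendsto_intros)
      show "AE x in lborel. norm (indicator {a..b} x * I (s n) x) \<le> indicator {a..b} x * (LINT \<xi>|lborel. norm (fourier f \<xi>))" for n
      proof (intro AE_I2)
        fix x
        have "norm (I (s n) x) \<le> (LINT \<xi>|lborel. norm (fourier f \<xi> * (of_real (exp (- (s n * \<xi>)\<^sup>2 / 2)) * cis (2 * pi * x * \<xi>))))"
          unfolding I_def by (rule integral_norm_bound)
        also have "\<dots> \<le> (LINT \<xi>|lborel. norm (fourier f \<xi>))"
          by (rule integral_mono') (use g in \<open>auto simp: norm_mult intro!: mult_left_le\<close>)
        finally show "norm (indicator {a..b} x * I (s n) x) \<le> indicator {a..b} x * (LINT \<xi>|lborel. norm (fourier f \<xi>))"
          by (auto split: split_indicator)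
      qed
    qed (use ind' in auto)
    have "(LINT x|lborel. indicator {a..b} x * h x) = (LINT y|lborel. f y * of_real (indicator {a..b} y))"
      by (rule LIMSEQ_unique[OF l2[unfolded e1] l1])
    moreover have "indicator {a..b} x * h x = indicator {a..b} x *\<^sub>R h x" "f x * of_real (indicator {a..b} x) = indicator {a..b} x *\<^sub>R f x" for x
      by (auto split: split_indicator)
    ultimately show ?thesis
      unfolding set_lebesgue_integral_def by simp
  qed
  \<comment> \<open>The inverse transform \<open>h\<close> is known to be continuous but not yet to
    be integrable, so the difference is cut off to bounded intervals first.\<close>
  have "AE x in lborel. indicator {- real n..real n} x *\<^sub>R (f x - h x) = 0" for n
  proof (rule AE_zero_if_interval_integrals_zero)
    have fi: "set_integrable lborel A f" if "A \<in> sets borel" for A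
      unfolding set_integrable_def by (rule integrable_mult_indicator) (use f that in auto)
    have hi: "set_integrable lborel {a..b} h" for a b
      by (rule borel_integrable_atLeastAtMost') (use hc continuous_on_subset in blast)
    have di: "set_integrable lborel {a..b} (\<lambda>x. f x - h x)" for a b
      by (intro set_integral_diff fi hi) auto
    show "integrable lborel (\<lambda>x. indicator {- real n..real n} x *\<^sub>R (f x - h x))"
      using di unfolding set_integrable_def by blast
    fix a b
    have "(LINT x:{a..b}|lborel. indicator {- real n..real n} x *\<^sub>R (f x - h x))
        = (LINT x:{max a (- real n)..min b (real n)}|lborel. f x - h x)"
      unfolding set_lebesgue_integral_def
      by (intro Bochner_Integration.integral_cong refl) (auto split: split_indicator)
    also have "\<dots> = 0"
      by (subst set_integral_diff) (auto intro!: fi hi simp: key)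
    finally show "(LINT x:{a..b}|lborel. indicator {- real n..real n} x *\<^sub>R (f x - h x)) = 0" .
  qed
  then have "AE x in lborel. \<forall>n::nat. indicator {- real n..real n} x *\<^sub>R (f x - h x) = 0"
    unfolding AE_all_countable by blast
  then show ?thesis
  proof eventually_elim
    case (elim x)
    obtain n where "\<bar>x\<bar> \<le> real n" using real_arch_simple by blast
    then have "x \<in> {- real n..real n}" by auto
    with elim[rule_format, of n] show ?case by (simp add: h_def)
  qed
qed

lemma continuous_AE_eq:
  fixes f g :: "real \<Rightarrow> 'a::t2_space"
  assumes "AE x in lborel. f x = g x" "continuous_on UNIV f" "continuous_on UNIV g"
  shows "f = g"
proof (rule ccontr)
  assume "f \<noteq> g"
  define S where "S = {x. f x \<noteq> g x}"
  have "open S" unfolding S_def by (intro open_Collect_neq assms)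
  moreover have "S \<noteq> {}" using \<open>f \<noteq> g\<close> by (auto simp: S_def)
  moreover have "S \<in> null_sets lborel"
  proof -
    obtain N where N: "N \<in> null_sets lborel" "S \<subseteq> N"
      using assms(1) by (auto simp: S_def eventually_ae_filter)
    have "S \<in> sets lborel" using \<open>open S\<close> by simp
    then show ?thesis using N null_sets_subset by blast
  qed
  ultimately show False
    using open_not_negligible negligible_iff_null_sets null_sets_completionI by blast
qed

lemma fourier_inversion:
  assumes "integrable lborel f" "integrable lborel (fourier f)" "continuous_on UNIV f"
  shows "f = (\<lambda>x. fourier (fourier f) (- x))"
proof (rule continuous_AE_eq)
  show "continuous_on UNIV (\<lambda>x. fourier (fourier f) (- x))"
    by (intro continuous_on_compose2[OF continuous_on_fourier[OF assms(2)]] continuous_intros) auto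
qed (use assms fourier_inversion_AE in auto)

section \<open>The Dirichlet kernel and the triangle function\<close>

definition P_real :: "nat \<Rightarrow> (real \<Rightarrow> real) \<Rightarrow> real" where
  "P_real N g = (\<Sum>k\<in>{- int N..int N}. g (of_int k))"

lemma sym_interval_Suc:
  "{- int (Suc N)..int (Suc N)} = insert (int (Suc N)) (insert (- int (Suc N)) {- int N..int N})"
  by auto

lemma P_real_Suc: "P_real (Suc N) g = P_real N g + g (real (Suc N)) + g (- real (Suc N))"
  unfolding P_real_def sym_interval_Suc by (subst sum.insert, simp, simp)+ simp

lemma P_Suc: "P (Suc N) g = P N g + g (real (Suc N)) + g (- real (Suc N))"
  unfolding P_def sym_interval_Suc by (subst sum.insert, simp, simp)+ simp

lemma P_0 [simp]: "P 0 g = g 0" by (simp add: P_def)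
lemma P_real_0 [simp]: "P_real 0 g = g 0" by (simp add: P_real_def)

lemma P_uminus: "P N (\<lambda>x. g (- x)) = P N g"
  by (induction N) (simp_all add: P_Suc add.assoc add.commute[of "g (- _)"] del: of_nat_Suc)

definition dirichlet_kernel :: "nat \<Rightarrow> real \<Rightarrow> real" where
  "dirichlet_kernel N x = P_real N (\<lambda>k. cos (2 * pi * k * x))"

lemma P_cis: "P N (\<lambda>k. cis (2 * pi * k * x)) = of_real (dirichlet_kernel N x)"
proof (induction N)
  case (Suc N)
  show ?case
    unfolding P_Suc Suc dirichlet_kernel_def P_real_Suc by (simp add: complex_eq_iff del: of_nat_Suc)
qed (simp add: dirichlet_kernel_def)

lemma P_cis_uminus: "P N (\<lambda>k. cis (- (2 * pi * k * x))) = of_real (dirichlet_kernel N x)"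
  using P_uminus[of N "\<lambda>k. cis (2 * pi * k * x)"] by (simp add: P_cis)

lemma dirichlet_kernel_plus_int: "dirichlet_kernel N (x + of_int n) = dirichlet_kernel N x"
proof -
  have "cos (2 * pi * of_int k * (x + of_int n)) = cos (2 * pi * of_int k * x)" for k
  proof -
    have "2 * pi * of_int k * (x + of_int n) = 2 * pi * of_int k * x + 2 * pi * of_int (k * n)"
      by (simp add: algebra_simps)
    then show ?thesis
      using cos_int_2pin[of "k * n"] sin_int_2pin[of "k * n"] by (simp add: cos_add)
  qed
  then show ?thesis by (simp add: dirichlet_kernel_def P_real_def)
qed

lemma dirichlet_kernel_measurable [measurable]: "dirichlet_kernel N \<in> borel_measurable borel"
  unfolding dirichlet_kernel_def P_real_def by measurable

lemma abs_dirichlet_kernel_le: "\<bar>dirichlet_kernel N x\<bar> \<le> 2 * real N + 1"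
proof -
  have "\<bar>dirichlet_kernel N x\<bar> \<le> (\<Sum>k\<in>{- int N..int N}. \<bar>cos (2 * pi * of_int k * x)\<bar>)"
    unfolding dirichlet_kernel_def P_real_def by (rule sum_abs)
  also have "\<dots> \<le> (\<Sum>k\<in>{- int N..int N}. 1)"
    by (rule sum_mono) auto
  finally show ?thesis by simp
qed

text \<open>Kept as a product, so that it remains valid at the integers, where the sine
  vanishes.\<close>

lemma sin_mult_dirichlet_kernel: "sin (pi * x) * dirichlet_kernel N x = sin ((2 * real N + 1) * (pi * x))"
proof (induction N)
  case (Suc N)
  define a where "a = 2 * pi * real (Suc N) * x"
  have "sin (pi * x) * dirichlet_kernel (Suc N) x = sin ((2 * real N + 1) * (pi * x)) + 2 * sin (pi * x) * cos a"
    using Suc unfolding dirichlet_kernel_def P_real_Suc a_def by (simp add: distrib_left del: of_nat_Suc)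
  also have "(2 * real N + 1) * (pi * x) = a - pi * x" by (simp add: a_def algebra_simps)
  also have "sin (a - pi * x) + 2 * sin (pi * x) * cos a = sin (a + pi * x)"
    by (simp add: sin_add sin_diff)
  also have "a + pi * x = (2 * real (Suc N) + 1) * (pi * x)" by (simp add: a_def algebra_simps)
  finally show ?case .
qed (simp add: dirichlet_kernel_def)

text \<open>The defect of \<open>sincsq_sum\<close> carries the factor sin^2; this bound absorbs the
  Dirichlet kernel there, uniformly in its order.\<close>

lemma sin_squared_mult_dirichlet_kernel_le: "(sin (pi * x))\<^sup>2 * \<bar>dirichlet_kernel N x\<bar> \<le> 1"
proof -
  have "(sin (pi * x))\<^sup>2 * \<bar>dirichlet_kernel N x\<bar> = \<bar>sin (pi * x)\<bar> * \<bar>sin (pi * x) * dirichlet_kernel N x\<bar>"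
    by (simp add: abs_mult power2_eq_square mult_ac)
  also have "\<dots> \<le> 1 * 1"
    unfolding sin_mult_dirichlet_kernel by (intro mult_mono) auto
  finally show ?thesis by simp
qed

section \<open>The triangle function and its transform sinc^2\<close>

definition tri :: "real \<Rightarrow> real" where "tri x = max 0 (1 - \<bar>x\<bar>)"

definition sincsq :: "real \<Rightarrow> real" where "sincsq y = (if y = 0 then 1 else (sin (pi * y) / (pi * y))\<^sup>2)"

lemma sincsq_nonneg: "sincsq y \<ge> 0" by (simp add: sincsq_def)

lemma continuous_on_tri [continuous_intros]: "continuous_on S g \<Longrightarrow> continuous_on S (\<lambda>x. tri (g x))"
  unfolding tri_def by (intro continuous_intros)

lemma sincsq_measurable [measurable]: "sincsq \<in> borel_measurable borel"
  unfolding sincsq_def by measurable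

lemma tri_measurable [measurable]: "tri \<in> borel_measurable borel"
  unfolding tri_def by measurable

text \<open>Neighbouring triangles add up to 1, so the sum is a trapezoid that is exactly 1 for |x|
  \<le> N and vanishes beyond N + 1.\<close>

lemma P_real_tri: "P_real N (\<lambda>k. tri (x - k)) = max 0 (min 1 (real N + 1 - \<bar>x\<bar>))"
proof (induction N)
  case (Suc N)
  define m where "m = real N"
  have m: "m \<ge> 0" by (simp add: m_def)
  have "max 0 (min 1 (m + 1 - \<bar>x\<bar>)) + tri (x - (m + 1)) + tri (x - (- (m + 1))) = max 0 (min 1 (m + 1 + 1 - \<bar>x\<bar>))"
    using m unfolding tri_def by (auto simp: max_def min_def abs_if)
  then show ?case unfolding P_real_Suc Suc by (simp add: m_def add_ac)
qed (simp add: tri_def)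

lemma tri_integrable: "integrable lborel tri"
proof -
  have "integrable lborel (\<lambda>x. indicator {-1..1} x *\<^sub>R tri x)"
    using borel_integrable_atLeastAtMost'[of "-1" 1 tri] continuous_on_tri[OF continuous_on_id, of "{-1..1}"]
    by (simp add: set_integrable_def)
  moreover have "(\<lambda>x. indicator {-1..1} x *\<^sub>R tri x) = tri"
    by (auto simp: tri_def fun_eq_iff split: split_indicator)
  ultimately show ?thesis by metis
qed

lemma fourier_tri: "fourier (\<lambda>x. of_real (tri x)) \<xi> = of_real (sincsq \<xi>)"
proof -
  define c where "c = 2 * of_real pi * \<i> * complex_of_real \<xi>"
  define f1 where "f1 x = (1 - of_real x) * exp (- c * of_real x)" for x :: real
  define f2 where "f2 x = (1 + of_real x) * exp (- c * of_real x)" for x :: real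
  have cis: "cis (- (2 * pi * x * \<xi>)) = exp (- c * of_real x)" for x
    by (simp add: cis_conv_exp c_def mult_ac)
  have c1: "continuous_on S f1" "continuous_on S f2" for S
    unfolding f1_def f2_def by (intro continuous_intros)+
  have i: "integrable lborel (\<lambda>x. indicator {0..1} x *\<^sub>R f1 x)" "integrable lborel (\<lambda>x. indicator {-1..0} x *\<^sub>R f2 x)"
    using borel_integrable_atLeastAtMost'[OF c1(1)] borel_integrable_atLeastAtMost'[OF c1(2)]
    by (simp_all add: set_integrable_def)
  have "fourier (\<lambda>x. of_real (tri x)) \<xi> = (LINT x|lborel. of_real (tri x) * exp (- c * of_real x))"
    by (subst fourier_lborel) (simp_all only: cis, measurable)
  also have "\<dots> = (LINT x|lborel. indicator {0..1} x *\<^sub>R f1 x + indicator {-1..0} x *\<^sub>R f2 x)"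
  proof (rule integral_cong_AE)
    \<comment> \<open>At 0 both half-interval indicators are 1, so the splitting holds only almost
      everywhere.\<close>
    have "AE x in lborel. x \<noteq> (0::real)" using AE_lborel_singleton[of 0] .
    then show "AE x in lborel. of_real (tri x) * exp (- c * of_real x) = indicator {0..1} x *\<^sub>R f1 x + indicator {-1..0} x *\<^sub>R f2 x"
      by eventually_elim (auto simp: tri_def f1_def f2_def max_def split: split_indicator)
    show "(\<lambda>x. of_real (tri x) * exp (- c * of_real x)) \<in> borel_measurable lborel" by measurable
    show "(\<lambda>x. indicator {0..1} x *\<^sub>R f1 x + indicator {-1..0} x *\<^sub>R f2 x) \<in> borel_measurable lborel"
      unfolding f1_def f2_def by measurable
  qed
  also have "\<dots> = (LINT x|lborel. indicator {0..1} x *\<^sub>R f1 x) + (LINT x|lborel. indicator {-1..0} x *\<^sub>R f2 x)"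
    by (rule Bochner_Integration.integral_add[OF i])
  also have "\<dots> = of_real (sincsq \<xi>)"
  proof (cases "\<xi> = 0")
    case True
    then have f12: "f1 = (\<lambda>x. of_real (1 - x))" "f2 = (\<lambda>x. of_real (1 + x))" by (simp_all add: f1_def f2_def c_def fun_eq_iff)
    have I1: "(LINT x|lborel. indicator {0..1} x *\<^sub>R complex_of_real (1 - x)) = of_real (1 - 1\<^sup>2 / 2) - of_real (0 - 0\<^sup>2 / 2)"
      by (rule integral_FTC_Icc)
         (auto intro!: continuous_intros has_vector_derivative_of_real derivative_eq_intros simp del: of_real_diff)
    have I2: "(LINT x|lborel. indicator {-1..0} x *\<^sub>R complex_of_real (1 + x)) = of_real (0 + 0\<^sup>2 / 2) - of_real (- 1 + (-1)\<^sup>2 / 2)"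
      by (rule integral_FTC_Icc)
         (auto intro!: continuous_intros has_vector_derivative_of_real derivative_eq_intros simp del: of_real_add)
    show ?thesis
      unfolding f12 I1 I2 using True by (simp add: sincsq_def field_simps)
  next
    case False
    then have c0: "c \<noteq> 0" by (simp add: c_def)
    \<comment> \<open>Antiderivatives of the two halves, found by one integration by parts. They
      contain 1/c, which is why \<xi> = 0 is treated separately.\<close>
    define F1 where "F1 z = - (1 - z) * exp (- c * z) / c + exp (- c * z) / c\<^sup>2" for z
    define F2 where "F2 z = - (1 + z) * exp (- c * z) / c - exp (- c * z) / c\<^sup>2" for z
    have "(F1 has_field_derivative (1 - z) * exp (- c * z)) (at z)" for z
      unfolding F1_def using c0 by (auto intro!: derivative_eq_intros simp: field_simps power2_eq_square)
    then have "((\<lambda>x. F1 (of_real x)) has_vector_derivative f1 x) (at x within {0..1})" for x :: real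
      unfolding f1_def by (intro has_vector_derivative_real_field)
    then have I1: "(LINT x|lborel. indicator {0..1} x *\<^sub>R f1 x) = F1 (of_real 1) - F1 (of_real 0)"
      by (intro integral_FTC_Icc c1) auto
    have "(F2 has_field_derivative (1 + z) * exp (- c * z)) (at z)" for z
      unfolding F2_def using c0 by (auto intro!: derivative_eq_intros simp: field_simps power2_eq_square)
    then have "((\<lambda>x. F2 (of_real x)) has_vector_derivative f2 x) (at x within {-1..0})" for x :: real
      unfolding f2_def by (intro has_vector_derivative_real_field)
    then have I2: "(LINT x|lborel. indicator {-1..0} x *\<^sub>R f2 x) = F2 (of_real 0) - F2 (of_real (-1))"
      by (intro integral_FTC_Icc c1) auto
    have cc: "c\<^sup>2 = - of_real ((2 * pi * \<xi>)\<^sup>2)" by (simp add: c_def power_mult_distrib)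
    have ee: "exp c + exp (- c) = of_real (2 * cos (2 * pi * \<xi>))"
    proof -
      have "exp c = cis (2 * pi * \<xi>)" "exp (- c) = cis (- (2 * pi * \<xi>))" by (simp_all add: c_def cis_conv_exp mult_ac)
      then show ?thesis by (simp add: complex_eq_iff)
    qed
    have Fe: "F1 (of_real 1) - F1 (of_real 0) + (F2 (of_real 0) - F2 (of_real (-1))) = (exp c + exp (- c) - 2) / c\<^sup>2"
      unfolding F1_def F2_def using c0 by (simp add: field_simps)
    have "(LINT x|lborel. indicator {0..1} x *\<^sub>R f1 x) + (LINT x|lborel. indicator {-1..0} x *\<^sub>R f2 x)
        = of_real ((2 - 2 * cos (2 * pi * \<xi>)) / (2 * pi * \<xi>)\<^sup>2)"
    proof -
      have "(of_real a - 2) / (- of_real X) = complex_of_real ((2 - a) / X)" for a X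
        by (simp add: minus_divide_left)
      then show ?thesis
        unfolding I1 I2 Fe ee cc .
    qed
    also have "cos (2 * pi * \<xi>) = 1 - 2 * (sin (pi * \<xi>))\<^sup>2"
      using cos_double_sin[of "pi * \<xi>"] by (simp add: mult_ac)
    also have "(2 - 2 * (1 - 2 * (sin (pi * \<xi>))\<^sup>2)) / (2 * pi * \<xi>)\<^sup>2 = sincsq \<xi>"
      using False by (simp add: sincsq_def power_divide power_mult_distrib field_simps)
    finally show ?thesis .
  qed
  finally show ?thesis .
qed

lemma integrable_inverse_1_plus_square': "integrable lborel (\<lambda>x::real. inverse (1 + x\<^sup>2))"
  using integrable_inverse_1_plus_square by (simp add: set_integrable_def einterval_def)

lemma sincsq_le: "sincsq y \<le> 2 * inverse (1 + y\<^sup>2)"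
proof (cases "y = 0")
  case False
  have a: "sincsq y \<le> 1"
  proof -
    have "\<bar>sin (pi * y)\<bar> \<le> \<bar>pi * y\<bar>" by (rule abs_sin_x_le_abs_x)
    then have "\<bar>sin (pi * y) / (pi * y)\<bar> \<le> 1" using False by (simp add: divide_simps abs_mult)
    then show ?thesis using False by (simp add: sincsq_def abs_square_le_1)
  qed
  have "sincsq y * y\<^sup>2 = (sin (pi * y))\<^sup>2 / pi\<^sup>2"
    using False by (simp add: sincsq_def power_divide power_mult_distrib)
  also have "\<dots> \<le> 1 / 1"
    by (intro frac_le) (use pi_ge_two in \<open>auto simp: abs_square_le_1 intro!: one_le_power\<close>)
  finally have "sincsq y * (1 + y\<^sup>2) \<le> 2" using a by (simp add: distrib_left)
  moreover have "1 + y\<^sup>2 > 0" by (simp add: add_pos_nonneg)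
  ultimately show ?thesis by (simp add: field_simps)
qed (simp add: sincsq_def)

lemma sincsq_integrable: "integrable lborel sincsq"
  by (rule Bochner_Integration.integrable_bound[OF integrable_mult_right[OF integrable_inverse_1_plus_square', of 2]])
     (auto intro!: AE_I2 simp: sincsq_nonneg intro: order_trans[OF sincsq_le])

text \<open>Inversion of \<open>fourier_tri\<close>: the oscillating integral of sinc^2 never has to
  be evaluated directly.\<close>

lemma tri_inversion: "(LINT \<xi>|lborel. of_real (sincsq \<xi>) * cis (2 * pi * x * \<xi>)) = complex_of_real (tri x)"
proof -
  have ft: "fourier (\<lambda>x. of_real (tri x)) = (\<lambda>\<xi>. of_real (sincsq \<xi>))"
    using fourier_tri by (simp add: fun_eq_iff)
  have "(\<lambda>x. complex_of_real (tri x)) = (\<lambda>x. fourier (fourier (\<lambda>x. of_real (tri x))) (- x))"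
    by (rule fourier_inversion) (auto simp: ft tri_integrable sincsq_integrable intro!: continuous_intros integrable_of_real)
  then have "complex_of_real (tri x) = fourier (\<lambda>\<xi>. of_real (sincsq \<xi>)) (- x)"
    unfolding ft by (rule fun_cong)
  then show ?thesis by (simp add: fourier_lborel mult_ac)
qed

section \<open>Partial fractions of (pi / sin (pi x))^2, by way of the Gamma function\<close>

lemma Polygamma_1_reflection:
  fixes x :: real
  assumes x: "0 < x" "x < 1"
  shows "Polygamma 1 x + Polygamma 1 (1 - x) = (pi / sin (pi * x))\<^sup>2"
proof -
  have s: "sin (pi * y) > 0" if "y \<in> {0<..<1}" for y
    using that by (intro sin_gt_zero) auto
  have refl: "Gamma y * Gamma (1 - y) = pi / sin (pi * y)" for y :: real
  proof -
    have 1: "1 - complex_of_real y = of_real (1 - y)" "of_real pi * complex_of_real y = of_real (pi * y)"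
      by simp_all
    have "of_real (Gamma y) * of_real (Gamma (1 - y)) = of_real pi / complex_of_real (sin (pi * y))"
      using Gamma_reflection_complex[of "of_real y"]
      unfolding 1 Gamma_complex_of_real sin_of_real .
    then have "complex_of_real (Gamma y * Gamma (1 - y)) = of_real (pi / sin (pi * y))"
      unfolding of_real_mult of_real_divide .
    then show ?thesis by (simp only: of_real_eq_iff)
  qed
  \<comment> \<open>The logarithm of the reflection formula, real because all factors are positive
    on (0,1). Its first derivative relates Digamma values to the cotangent, its second one is the
    claim.\<close>
  have lg: "ln_Gamma y + ln_Gamma (1 - y) = ln pi - ln (sin (pi * y))" if "y \<in> {0<..<1}" for y
  proof -
    have G: "Gamma y > 0" "Gamma (1 - y) > 0" using that by (auto intro: Gamma_real_pos)
    have "ln_Gamma y + ln_Gamma (1 - y) = ln (Gamma y) + ln (Gamma (1 - y))"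
      using that by (simp add: ln_Gamma_real_pos)
    also have "\<dots> = ln (pi / sin (pi * y))"
      unfolding refl[symmetric] using G by (simp add: ln_mult_pos)
    also have "\<dots> = ln pi - ln (sin (pi * y))"
      using s[OF that] by (simp add: ln_div)
    finally show ?thesis .
  qed
  have dg: "Digamma y - Digamma (1 - y) = - (pi * cos (pi * y) / sin (pi * y))" if y: "y \<in> {0<..<1}" for y
  proof (rule DERIV_unique)
    show "((\<lambda>y. ln_Gamma y + ln_Gamma (1 - y)) has_field_derivative Digamma y - Digamma (1 - y)) (at y)"
      by (rule derivative_eq_intros refl | use y in simp)+
    have "((\<lambda>y. ln pi - ln (sin (pi * y))) has_field_derivative - (pi * cos (pi * y) / sin (pi * y))) (at y)"
      by (rule derivative_eq_intros refl | use s[OF y] in simp)+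
    then show "((\<lambda>y. ln_Gamma y + ln_Gamma (1 - y)) has_field_derivative - (pi * cos (pi * y) / sin (pi * y))) (at y)"
      by (rule has_field_derivative_transform_within_open[of _ _ _ "{0<..<1}"]) (use y lg in simp_all)
  qed
  have sx: "sin (pi * x) \<noteq> 0" using s[of x] x by simp
  show ?thesis
  proof (rule DERIV_unique)
    have np: "x \<notin> \<int>\<^sub>\<le>\<^sub>0" "1 - x \<notin> \<int>\<^sub>\<le>\<^sub>0" using x by (auto elim!: nonpos_Ints_cases)
    show "((\<lambda>y. Digamma y - Digamma (1 - y)) has_field_derivative Polygamma 1 x + Polygamma 1 (1 - x)) (at x)"
      by (rule derivative_eq_intros refl | use np in simp)+
    have "((\<lambda>y. - (pi * cos (pi * y) / sin (pi * y))) has_field_derivative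
        - (((pi * (- sin (pi * x) * pi)) * sin (pi * x) - (pi * cos (pi * x)) * (cos (pi * x) * pi)) / (sin (pi * x) * sin (pi * x)))) (at x)"
      by (rule derivative_eq_intros refl sx | simp)+
    also have "(pi * (- sin (pi * x) * pi)) * sin (pi * x) - (pi * cos (pi * x)) * (cos (pi * x) * pi)
        = - (pi\<^sup>2 * ((sin (pi * x))\<^sup>2 + (cos (pi * x))\<^sup>2))"
    proof -
      have "(pi * (- a * pi)) * a - (pi * b) * (b * pi) = - (pi\<^sup>2 * (a\<^sup>2 + b\<^sup>2))" for a b :: real
        by (simp add: power2_eq_square algebra_simps)
      then show ?thesis .
    qed
    also have "- (- (pi\<^sup>2 * ((sin (pi * x))\<^sup>2 + (cos (pi * x))\<^sup>2)) / (sin (pi * x) * sin (pi * x))) = (pi / sin (pi * x))\<^sup>2"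
      unfolding sin_cos_squared_add by (simp add: power_divide power2_eq_square)
    finally show "((\<lambda>y. Digamma y - Digamma (1 - y)) has_field_derivative (pi / sin (pi * x))\<^sup>2) (at x)"
      by (rule has_field_derivative_transform_within_open[of _ _ _ "{0<..<1}"]) (use x dg in simp_all)
  qed
qed

lemma P_real_inverse_square_shift:
  "P_real K (\<lambda>n. 1 / (x + 1 - n)\<^sup>2) = P_real K (\<lambda>n. 1 / (x - n)\<^sup>2) + 1 / (x + 1 + real K)\<^sup>2 - 1 / (x - real K)\<^sup>2"
  by (induction K) (simp_all add: P_real_Suc algebra_simps)

text \<open>For x in (0,1) the terms with n \<le> 0 form the series of \<open>Polygamma 1 x\<close>
  and those with n \<ge> 1 the series of \<open>Polygamma 1 (1 - x)\<close>. Every other non-integer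
  is reached by integer shifts, each of which changes a partial sum only by two boundary terms that
  tend to 0.\<close>

lemma inverse_square_sum:
  fixes x :: real
  assumes "x \<notin> \<int>"
  shows "(\<lambda>K. P_real K (\<lambda>n. 1 / (x - n)\<^sup>2)) \<longlonglongrightarrow> (pi / sin (pi * x))\<^sup>2"
proof -
  have base: "(\<lambda>K. P_real K (\<lambda>n. 1 / (y - n)\<^sup>2)) \<longlonglongrightarrow> (pi / sin (pi * y))\<^sup>2" if y: "0 < y" "y < 1" for y :: real
  proof -
    have e: "P_real K (\<lambda>n. 1 / (y - n)\<^sup>2) = (\<Sum>k<Suc K. inverse ((y + of_nat k) ^ Suc 1)) + (\<Sum>k<K. inverse ((1 - y + of_nat k) ^ Suc 1))" for K
    proof (induction K)
      case (Suc K)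
      have "(1 - y + real K)\<^sup>2 = (y - real (Suc K))\<^sup>2" by (simp add: power2_eq_square algebra_simps)
      with Suc show ?case by (simp add: P_real_Suc power2_eq_square inverse_eq_divide algebra_simps)
    qed (simp add: inverse_eq_divide power2_eq_square)
    have "(\<lambda>k. inverse ((y + of_nat k) ^ Suc 1)) sums Polygamma 1 y"
      using Polygamma_LIMSEQ[of y 1] y by simp
    then have 1: "(\<lambda>K. \<Sum>k<Suc K. inverse ((y + of_nat k) ^ Suc 1)) \<longlonglongrightarrow> Polygamma 1 y"
      unfolding sums_def by (rule LIMSEQ_Suc)
    have "(\<lambda>k. inverse ((1 - y + of_nat k) ^ Suc 1)) sums Polygamma 1 (1 - y)"
      using Polygamma_LIMSEQ[of "1 - y" 1] y by simp
    then have 2: "(\<lambda>K. \<Sum>k<K. inverse ((1 - y + of_nat k) ^ Suc 1)) \<longlonglongrightarrow> Polygamma 1 (1 - y)"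
      unfolding sums_def .
    show ?thesis
      unfolding e Polygamma_1_reflection[OF y, symmetric] by (rule tendsto_add[OF 1 2])
  qed
  have per: "(sin (pi * (y + 1)))\<^sup>2 = (sin (pi * y))\<^sup>2" for y :: real
    by (simp add: distrib_left)
  have d: "(\<lambda>K. 1 / (y + 1 + real K)\<^sup>2 - 1 / (y - real K)\<^sup>2) \<longlonglongrightarrow> 0" for y :: real
    by real_asymp
  define Q where "Q y \<longleftrightarrow> (\<lambda>K. P_real K (\<lambda>n. 1 / (y - n)\<^sup>2)) \<longlonglongrightarrow> (pi / sin (pi * y))\<^sup>2" for y :: real
  have step: "Q (y + 1) \<longleftrightarrow> Q y" for y
  proof
    assume "Q y"
    from tendsto_add[OF this[unfolded Q_def] d[of y]] show "Q (y + 1)"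
      unfolding Q_def P_real_inverse_square_shift power_divide per by (simp add: add_diff_eq)
  next
    assume "Q (y + 1)"
    from tendsto_diff[OF this[unfolded Q_def] d[of y]] show "Q y"
      unfolding Q_def P_real_inverse_square_shift power_divide per by simp
  qed
  have nat_up: "Q (y + real n) \<longleftrightarrow> Q y" for y n
  proof (induction n)
    case (Suc n)
    then show ?case using step[of "y + real n"] by (simp add: add_ac)
  qed simp
  have "Q (frac x)"
    unfolding Q_def by (rule base) (use assms in \<open>auto simp: frac_lt_1 frac_gt_0_iff\<close>)
  moreover have "x = frac x + of_int \<lfloor>x\<rfloor>" by (simp add: frac_def)
  ultimately have "Q x"
  proof (cases "\<lfloor>x\<rfloor> \<ge> 0")
    case True
    then have "x = frac x + real (nat \<lfloor>x\<rfloor>)" by (simp add: frac_def)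
    with \<open>Q (frac x)\<close> nat_up show ?thesis by metis
  next
    case False
    then have "frac x = x + real (nat (- \<lfloor>x\<rfloor>))" by (simp add: frac_def)
    with \<open>Q (frac x)\<close> nat_up show ?thesis by metis
  qed
  then show ?thesis unfolding Q_def .
qed

text \<open>The \<open>\<sigma>\<^sub>L\<close> of the overview; equivalently, the Fourier transform
  of \<open>tri\<close> times the Dirichlet kernel of order L.\<close>

definition sincsq_sum :: "nat \<Rightarrow> real \<Rightarrow> real" where
  "sincsq_sum L x = P_real L (\<lambda>n. sincsq (x - n))"

lemma sincsq_sum_measurable [measurable]: "sincsq_sum L \<in> borel_measurable borel"
  unfolding sincsq_sum_def P_real_def by measurable

lemma sincsq_sum_nonneg: "0 \<le> sincsq_sum L x"
  unfolding sincsq_sum_def P_real_def by (intro sum_nonneg sincsq_nonneg)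

lemma sincsq_sum_eq:
  assumes x: "x \<notin> \<int>"
  shows "sincsq_sum K x = (sin (pi * x))\<^sup>2 / pi\<^sup>2 * P_real K (\<lambda>n. 1 / (x - n)\<^sup>2)"
proof -
  have e: "sincsq (x - of_int n) = (sin (pi * x))\<^sup>2 / pi\<^sup>2 * (1 / (x - of_int n)\<^sup>2)" for n
  proof -
    have "x - of_int n \<noteq> 0" using x by auto
    moreover have "(sin (pi * (x - of_int n)))\<^sup>2 = (sin (pi * x))\<^sup>2"
    proof -
      have "(sin (pi * of_int n))\<^sup>2 = 0"
        using sin_zero_iff_int2[of "pi * of_int n"] by (auto simp: mult.commute)
      then have "sin (pi * of_int n) = 0" "(cos (pi * of_int n))\<^sup>2 = 1"
        using sin_cos_squared_add[of "pi * of_int n"] by auto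
      then show ?thesis by (simp add: right_diff_distrib sin_diff power_mult_distrib)
    qed
    ultimately show ?thesis by (simp add: sincsq_def power_divide power_mult_distrib)
  qed
  show ?thesis unfolding sincsq_sum_def P_real_def e by (simp add: sum_distrib_left)
qed

text \<open>By partial fractions the sums increase to 1, so the defect is sin^2(pi x) / pi^2 times
  the sum of 1/(x - n)^2 over |n| > L. For |x| \<le> L/2 that sum is at most 4/L, and 4 \<le> pi^2
  absorbs the constant. The factor sin^2 is kept on purpose: it is needed against the Dirichlet
  kernel.\<close>

lemma sincsq_sum_le_1_and_tail:
  assumes x: "x \<notin> \<int>"
  shows "sincsq_sum L x \<le> 1"
    and "1 \<le> L \<Longrightarrow> \<bar>x\<bar> \<le> real L / 2 \<Longrightarrow> 1 - sincsq_sum L x \<le> (sin (pi * x))\<^sup>2 / real L"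
proof -
  have "sin (pi * x) \<noteq> 0"
    using x sin_zero_iff_int2[of "pi * x"] by (auto simp: mult.commute)
  then have s0: "(sin (pi * x))\<^sup>2 > 0" by simp
  have "(\<lambda>K. (sin (pi * x))\<^sup>2 / pi\<^sup>2 * P_real K (\<lambda>n. 1 / (x - n)\<^sup>2)) \<longlonglongrightarrow> (sin (pi * x))\<^sup>2 / pi\<^sup>2 * (pi / sin (pi * x))\<^sup>2"
    by (intro tendsto_mult tendsto_const inverse_square_sum x)
  also have "(sin (pi * x))\<^sup>2 / pi\<^sup>2 * (pi / sin (pi * x))\<^sup>2 = 1"
    using s0 by (simp add: power_divide)
  finally have lim: "(\<lambda>K. sincsq_sum K x) \<longlonglongrightarrow> 1" by (simp add: sincsq_sum_eq[OF x])
  have inc: "incseq (\<lambda>K. sincsq_sum K x)"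
    by (rule incseq_SucI) (simp add: sincsq_sum_def P_real_Suc sincsq_nonneg)
  show "sincsq_sum L x \<le> 1" by (rule incseq_le[OF inc lim])
  assume L: "1 \<le> L" and xL: "\<bar>x\<bar> \<le> real L / 2"
  \<comment> \<open>The bound telescopes: with u = K - L/2, each of the two new terms is at most
    1/(u+1)^2 \<le> 1/u - 1/(u+1). The constant 2/L is the value of 1/u at K = L, so that the
    induction starts from 0.\<close>
  have tail: "P_real K (\<lambda>n. 1 / (x - n)\<^sup>2) - P_real L (\<lambda>n. 1 / (x - n)\<^sup>2) \<le> 2 * (2 / real L - 1 / (real K - real L / 2))"
    if "L \<le> K" for K
    using that
  proof (induction K rule: dec_induct)
    case base
    then show ?case using L by (simp add: field_simps)
  next
    case (step K)
    define u where "u = real K - real L / 2"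
    have u: "u > 0" using step L by (simp add: u_def)
    have one: "1 / (x - y)\<^sup>2 \<le> 1 / u - 1 / (u + 1)" if "\<bar>y\<bar> = real (Suc K)" for y
    proof -
      have "u + 1 \<le> \<bar>x - y\<bar>" using that xL by (auto simp: u_def abs_if split: if_splits)
      then have "(u + 1)\<^sup>2 \<le> (x - y)\<^sup>2" using u by (simp add: abs_le_square_iff[symmetric])
      then have "1 / (x - y)\<^sup>2 \<le> 1 / (u + 1)\<^sup>2" using u by (intro divide_left_mono) (auto intro!: mult_pos_pos zero_less_power2[THEN iffD2])
      also have "\<dots> \<le> 1 / (u * (u + 1))"
        using u by (intro divide_left_mono) (auto simp: power2_eq_square)
      also have "\<dots> = 1 / u - 1 / (u + 1)" using u by (simp add: field_simps)
      finally show ?thesis .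
    qed
    have "P_real (Suc K) (\<lambda>n. 1 / (x - n)\<^sup>2) - P_real L (\<lambda>n. 1 / (x - n)\<^sup>2)
        \<le> 2 * (2 / real L - 1 / u) + (1 / u - 1 / (u + 1)) + (1 / u - 1 / (u + 1))"
      using step.IH one[of "real (Suc K)"] one[of "- real (Suc K)"] unfolding P_real_Suc u_def[symmetric] by simp
    also have "\<dots> = 2 * (2 / real L - 1 / (u + 1))" by simp
    also have "u + 1 = real (Suc K) - real L / 2" by (simp add: u_def)
    finally show ?case .
  qed
  have "sincsq_sum K x \<le> sincsq_sum L x + (sin (pi * x))\<^sup>2 / real L" if K: "K \<ge> L" for K
  proof -
    have pi4: "4 \<le> pi\<^sup>2" using power_mono[OF pi_ge_two, of 2] by simp
    have "1 / (real K - real L / 2) \<ge> 0" using K L by simp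
    then have "P_real K (\<lambda>n. 1 / (x - n)\<^sup>2) - P_real L (\<lambda>n. 1 / (x - n)\<^sup>2) \<le> 4 / real L"
      using tail[OF K] by argo
    then have "(sin (pi * x))\<^sup>2 / pi\<^sup>2 * (P_real K (\<lambda>n. 1 / (x - n)\<^sup>2) - P_real L (\<lambda>n. 1 / (x - n)\<^sup>2)) \<le> (sin (pi * x))\<^sup>2 / pi\<^sup>2 * (4 / real L)"
      by (intro mult_left_mono) auto
    also have "\<dots> = (sin (pi * x))\<^sup>2 / real L * (4 / pi\<^sup>2)" by simp
    also have "\<dots> \<le> (sin (pi * x))\<^sup>2 / real L * 1"
      by (intro mult_left_mono) (use pi4 in auto)
    finally show ?thesis unfolding sincsq_sum_eq[OF x] by (simp add: right_diff_distrib)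
  qed
  then have "1 \<le> sincsq_sum L x + (sin (pi * x))\<^sup>2 / real L"
    by (intro LIMSEQ_le_const2[OF lim]) auto
  then show "1 - sincsq_sum L x \<le> (sin (pi * x))\<^sup>2 / real L" by simp
qed

section \<open>Comparison of the two partial sums\<close>

definition tail_int :: "real \<Rightarrow> nat \<Rightarrow> (real \<Rightarrow> complex) \<Rightarrow> real" where
  "tail_int R N g = (LINT x|lborel. indicator {x. R \<le> \<bar>x\<bar>} x * (norm (g x) * \<bar>dirichlet_kernel N x\<bar>))"

lemma integrable_mult_bounded:
  fixes f :: "real \<Rightarrow> complex" and b :: "real \<Rightarrow> real"
  assumes f: "integrable lborel f" and [measurable]: "b \<in> borel_measurable borel" and b: "\<And>x. \<bar>b x\<bar> \<le> C"
  shows "integrable lborel (\<lambda>x. f x * of_real (b x))" "integrable lborel (\<lambda>x. norm (f x) * b x)"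
proof -
  have [measurable]: "f \<in> borel_measurable borel" using f by auto
  have le: "norm (f x) * \<bar>b x\<bar> \<le> \<bar>C\<bar> * norm (f x)" for x
    using mult_left_mono[OF order_trans[OF b abs_ge_self], of "norm (f x)" x] by (simp add: mult.commute)
  have i: "integrable lborel (\<lambda>x. \<bar>C\<bar> * norm (f x))" using f by auto
  show "integrable lborel (\<lambda>x. f x * of_real (b x))"
    by (rule Bochner_Integration.integrable_bound[OF i]) (use le in \<open>auto simp: norm_mult abs_mult intro!: AE_I2\<close>)
  show "integrable lborel (\<lambda>x. norm (f x) * b x)"
    by (rule Bochner_Integration.integrable_bound[OF i]) (use le in \<open>auto simp: norm_mult abs_mult intro!: AE_I2\<close>)
qed

lemma tail_int_integrable:
  fixes f :: "real \<Rightarrow> complex"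
  assumes f: "integrable lborel f"
  shows "integrable lborel (\<lambda>x. indicator {x. R \<le> \<bar>x\<bar>} x * (norm (f x) * \<bar>dirichlet_kernel N x\<bar>))"
proof -
  have "integrable lborel (\<lambda>x. norm (f x) * (indicator {x. R \<le> \<bar>x\<bar>} x * \<bar>dirichlet_kernel N x\<bar>))"
    by (rule integrable_mult_bounded[OF f, where C="2 * real N + 1"])
       (auto simp: abs_dirichlet_kernel_le abs_mult split: split_indicator)
  then show ?thesis by (simp add: mult_ac)
qed

lemma tail_int_antimono:
  assumes f: "integrable lborel f" and "R \<le> S"
  shows "tail_int S N f \<le> tail_int R N f"
  unfolding tail_int_def
  by (intro integral_mono tail_int_integrable f) (use \<open>R \<le> S\<close> in \<open>auto split: split_indicator\<close>)

lemma P_integral: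
  assumes "\<And>k. integrable lborel (\<lambda>x::real. F (of_int k) x)"
  shows "P N (\<lambda>k. LINT x|lborel. F k x) = (LINT x|lborel. P N (\<lambda>k. F k x))"
  unfolding P_def by (rule Bochner_Integration.integral_sum[symmetric]) (use assms in auto)

lemma P_mult_left: "P N (\<lambda>k. c * F k) = c * P N F"
  unfolding P_def by (simp add: sum_distrib_left)

lemma P_fourier:
  assumes f: "integrable lborel f"
  shows "P N (fourier f) = (LINT x|lborel. f x * of_real (dirichlet_kernel N x))"
proof -
  have [measurable]: "f \<in> borel_measurable borel" using f by auto
  have "P N (fourier f) = P N (\<lambda>k. LINT x|lborel. f x * cis (- (2 * pi * k * x)))"
    by (intro arg_cong[where f="P N"]) (simp add: fun_eq_iff fourier_lborel mult_ac)
  also have "\<dots> = (LINT x|lborel. P N (\<lambda>k. f x * cis (- (2 * pi * k * x))))"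
    by (rule P_integral) (rule integrable_mult_cis[OF f], measurable)
  finally show ?thesis by (simp add: P_mult_left P_cis_uminus)
qed

text \<open>Translation by n and modulation by k commute up to \<open>cis (2 * pi * k * n)\<close>,
  which is 1 for integers. Hence the dependence on n and the one on k separate, and a double sum
  over both factors.\<close>

lemma fourier_sincsq_shift:
  fixes n k :: int
  shows "fourier (\<lambda>\<xi>. of_real (sincsq (\<xi> - of_int n)) * cis (2 * pi * of_int k * \<xi>)) x
    = cis (- (2 * pi * of_int n * x)) * of_real (tri (x - of_int k))"
proof -
  have "fourier (\<lambda>\<xi>. of_real (sincsq (\<xi> - of_int n)) * cis (2 * pi * of_int k * \<xi>)) x
      = (LINT \<xi>|lborel. of_real (sincsq (\<xi> - of_int n)) * cis (2 * pi * (of_int k - x) * \<xi>))"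
  proof -
    have "cis (2 * pi * of_int k * \<xi>) * cis (- (2 * pi * \<xi> * x)) = cis (2 * pi * (of_int k - x) * \<xi>)" for \<xi>
      by (simp add: cis_mult algebra_simps)
    then show ?thesis by (subst fourier_lborel) (simp_all add: mult.assoc)
  qed
  also have "\<dots> = (LINT \<eta>|lborel. of_real (sincsq ((of_int n + 1 * \<eta>) - of_int n)) * cis (2 * pi * (of_int k - x) * (of_int n + 1 * \<eta>)))"
    using lborel_integral_real_affine[of 1 "\<lambda>\<xi>. of_real (sincsq (\<xi> - of_int n)) * cis (2 * pi * (of_int k - x) * \<xi>)" "of_int n"]
    by simp
  also have "\<dots> = (LINT \<eta>|lborel. cis (- (2 * pi * of_int n * x)) * (of_real (sincsq \<eta>) * cis (2 * pi * (of_int k - x) * \<eta>)))"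
  proof (intro Bochner_Integration.integral_cong refl)
    fix \<eta> :: real
    have "cis (2 * pi * (of_int k - x) * (of_int n + 1 * \<eta>))
        = cis (2 * pi * of_int (k * n)) * cis (- (2 * pi * of_int n * x)) * cis (2 * pi * (of_int k - x) * \<eta>)"
      by (simp add: cis_mult algebra_simps)
    moreover have "cis (2 * pi * of_int (k * n)) = 1"
      by (rule cis_multiple_2pi) auto
    ultimately show "complex_of_real (sincsq (of_int n + 1 * \<eta> - of_int n)) * cis (2 * pi * (of_int k - x) * (of_int n + 1 * \<eta>))
       = cis (- (2 * pi * of_int n * x)) * (of_real (sincsq \<eta>) * cis (2 * pi * (of_int k - x) * \<eta>))"
      by (simp add: mult_ac)
  qed
  also have "\<dots> = cis (- (2 * pi * of_int n * x)) * of_real (tri (of_int k - x))"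
    unfolding integral_mult_right_zero tri_inversion ..
  also have "tri (of_int k - x) = tri (x - of_int k)" by (simp add: tri_def abs_minus_commute)
  finally show ?thesis .
qed

text \<open>The exact identity behind the comparison. The multiplication formula is applied to each
  pair (n, k); summing over the pairs gives \<open>\<sigma>\<^sub>L\<close> times a Dirichlet kernel
  on one side and \<open>\<tau>\<^sub>M\<close> times a Dirichlet kernel on the other.\<close>

lemma integral_fourier_sincsq_sum_dirichlet:
  assumes f: "integrable lborel f"
  shows "(LINT \<xi>|lborel. fourier f \<xi> * of_real (sincsq_sum L \<xi> * dirichlet_kernel M \<xi>))
    = (LINT x|lborel. f x * of_real (dirichlet_kernel L x * P_real M (\<lambda>k. tri (x - k))))"
proof -
  have [measurable]: "f \<in> borel_measurable borel" using f by auto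
  note [measurable] = fourier_measurable[OF f]
  define G where "G n k \<xi> = of_real (sincsq (\<xi> - n)) * cis (2 * pi * k * \<xi>)" for n k \<xi> :: real
  define H where "H n k x = cis (- (2 * pi * n * x)) * of_real (tri (x - k))" for n k x :: real
  have Gi: "integrable lborel (G n k)" for n k
  proof -
    have "integrable lborel (\<lambda>\<xi>. sincsq (- n + 1 * \<xi>))"
      by (rule lborel_integrable_real_affine) (auto simp: sincsq_integrable)
    then have "integrable lborel (\<lambda>\<xi>. complex_of_real (sincsq (\<xi> - n)))"
      by (intro integrable_of_real) (simp add: algebra_simps)
    then show ?thesis unfolding G_def by (rule integrable_mult_cis) measurable
  qed
  have Gn: "norm (G n k \<xi>) \<le> 2" for n k \<xi>
  proof -
    have "sincsq y \<le> 2 * 1" for y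
      by (rule order_trans[OF sincsq_le], rule mult_left_mono) (auto simp: inverse_eq_divide add_pos_nonneg)
    then show ?thesis by (simp add: G_def norm_mult sincsq_nonneg)
  qed
  have Hn: "norm (H n k x) \<le> 1" for n k x by (simp add: H_def norm_mult tri_def)
  have [measurable]: "H n k \<in> borel_measurable borel" "G n k \<in> borel_measurable borel" for n k
    unfolding H_def G_def by measurable
  have e: "(LINT \<xi>|lborel. fourier f \<xi> * G (of_int n) (of_int k) \<xi>) = (LINT x|lborel. f x * H (of_int n) (of_int k) x)" for n k
    using fourier_multiplication[OF f Gi, of "of_int n" "of_int k"]
    unfolding G_def fourier_sincsq_shift H_def .
  have i1: "integrable lborel (\<lambda>\<xi>. fourier f \<xi> * G n k \<xi>)" for n k
  proof (rule Bochner_Integration.integrable_bound[where f="\<lambda>\<xi>. (LINT x|lborel. norm (f x)) * norm (G n k \<xi>)"])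
    show "AE \<xi> in lborel. norm (fourier f \<xi> * G n k \<xi>) \<le> norm ((LINT x|lborel. norm (f x)) * norm (G n k \<xi>))"
      by (intro AE_I2) (auto simp: norm_mult abs_mult intro!: mult_right_mono order_trans[OF norm_fourier_le[OF f]])
  qed (use Gi in auto)
  have i2: "integrable lborel (\<lambda>x. f x * H n k x)" for n k
    by (rule Bochner_Integration.integrable_bound[OF f]) (auto intro!: AE_I2 mult_left_le Hn simp: norm_mult)
  have s1: "of_real (sincsq_sum L \<xi> * dirichlet_kernel M \<xi>) = (\<Sum>n\<in>{- int L..int L}. \<Sum>k\<in>{- int M..int M}. G (of_int n) (of_int k) \<xi>)" for \<xi>
    unfolding of_real_mult P_cis[symmetric] sincsq_sum_def P_real_def P_def G_def
    by (simp add: sum_product)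
  have s2: "of_real (dirichlet_kernel L x * P_real M (\<lambda>k. tri (x - k))) = (\<Sum>n\<in>{- int L..int L}. \<Sum>k\<in>{- int M..int M}. H (of_int n) (of_int k) x)" for x
    unfolding of_real_mult P_cis_uminus[symmetric] P_real_def P_def H_def
    by (simp add: sum_product)
  show ?thesis
    unfolding s1 s2 sum_distrib_left
    using i1 i2 by (simp add: Bochner_Integration.integral_sum Bochner_Integration.integrable_sum e)
qed

lemma Ints_null_AE: "AE x in lborel. x \<notin> (\<int> :: real set)"
proof -
  have "countable (\<int> :: real set)" by (simp add: Ints_def)
  then have "\<int> \<in> null_sets (lborel :: real measure)" by (rule countable_imp_null_set_lborel)
  then show ?thesis by (rule AE_not_in)
qed

text \<open>After the common integral is subtracted, only the factors 1 -
  \<open>\<tau>\<^sub>M\<close> and 1 - \<open>\<sigma>\<^sub>L\<close> remain. The first vanishes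
  on [-M, M]. The second is at most 1 beyond L/2, and inside it is at most sin^2 / L, so that its
  product with the Dirichlet kernel is at most 1/L.\<close>

lemma poisson_estimate:
  assumes f: "integrable lborel f" and g: "integrable lborel (fourier f)" and c: "continuous_on UNIV f" and L: "1 \<le> L"
  shows "norm (P M f - P L (fourier f)) \<le> tail_int (real M) L f + tail_int (real L / 2) M (fourier f)
     + (LINT x|lborel. norm (fourier f x)) / real L"
proof -
  have [measurable]: "f \<in> borel_measurable borel" using f by auto
  note [measurable] = fourier_measurable[OF f]
  define \<tau> where "\<tau> x = P_real M (\<lambda>k. tri (x - k))" for x
  have \<tau>: "0 \<le> 1 - \<tau> x" "1 - \<tau> x \<le> 1" "\<bar>x\<bar> \<le> real M \<Longrightarrow> \<tau> x = 1" "\<bar>\<tau> x\<bar> \<le> 1" for x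
    by (auto simp: \<tau>_def P_real_tri)
  have [measurable]: "\<tau> \<in> borel_measurable borel" unfolding \<tau>_def P_real_def by measurable
  have fi: "integrable lborel (\<lambda>x. f x * of_real (dirichlet_kernel L x))"
      "integrable lborel (\<lambda>x. f x * of_real (dirichlet_kernel L x * \<tau> x))"
    by (rule integrable_mult_bounded[OF f, where C="2 * real L + 1"];
        use \<tau> in \<open>auto simp: abs_mult abs_dirichlet_kernel_le intro!: order_trans[OF mult_left_le]\<close>)+
  \<comment> \<open>Inversion reflects the argument, which is harmless because the summation range
    is symmetric.\<close>
  have P1: "P M f = (LINT \<xi>|lborel. fourier f \<xi> * of_real (dirichlet_kernel M \<xi>))"
  proof -
    have "P M f = P M (\<lambda>x. fourier (fourier f) (- x))"
      using fourier_inversion[OF f g c] by simp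
    then show ?thesis by (simp add: P_uminus P_fourier[OF g])
  qed
  have "\<exists>C. \<forall>x. \<bar>sincsq_sum L x\<bar> \<le> C"
  proof -
    have "\<bar>sincsq_sum L x\<bar> \<le> (\<Sum>k\<in>{- int L..int L}. \<bar>sincsq (x - of_int k)\<bar>)" for x
      unfolding sincsq_sum_def P_real_def by (rule sum_abs)
    moreover have "(\<Sum>k\<in>{- int L..int L}. \<bar>sincsq (x - of_int k)\<bar>) \<le> (\<Sum>k\<in>{- int L..int L}. 2)" for x
    proof (rule sum_mono)
      have "sincsq y \<le> 2 * 1" for y
        by (rule order_trans[OF sincsq_le], rule mult_left_mono) (auto simp: inverse_eq_divide add_pos_nonneg)
      then show "\<And>k. \<bar>sincsq (x - of_int k)\<bar> \<le> 2" by (simp add: sincsq_nonneg)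
    qed
    ultimately show ?thesis by (meson order_trans)
  qed
  then obtain C where C: "\<bar>sincsq_sum L x\<bar> \<le> C" for x by blast
  have gi: "integrable lborel (\<lambda>x. fourier f x * of_real (dirichlet_kernel M x))"
      "integrable lborel (\<lambda>x. fourier f x * of_real (sincsq_sum L x * dirichlet_kernel M x))"
  proof -
    show "integrable lborel (\<lambda>x. fourier f x * of_real (dirichlet_kernel M x))"
      by (rule integrable_mult_bounded[OF g, where C="2 * real M + 1"]) (auto simp: abs_dirichlet_kernel_le)
    show "integrable lborel (\<lambda>x. fourier f x * of_real (sincsq_sum L x * dirichlet_kernel M x))"
    proof (rule integrable_mult_bounded[OF g])
      show "\<bar>sincsq_sum L x * dirichlet_kernel M x\<bar> \<le> C * (2 * real M + 1)" for x
        unfolding abs_mult by (intro mult_mono' C abs_dirichlet_kernel_le) auto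
    qed measurable
  qed
  have "P M f - P L (fourier f) =
      ((LINT \<xi>|lborel. fourier f \<xi> * of_real (dirichlet_kernel M \<xi>)) - (LINT \<xi>|lborel. fourier f \<xi> * of_real (sincsq_sum L \<xi> * dirichlet_kernel M \<xi>)))
     - ((LINT x|lborel. f x * of_real (dirichlet_kernel L x)) - (LINT x|lborel. f x * of_real (dirichlet_kernel L x * \<tau> x)))"
    unfolding P1 P_fourier[OF f] integral_fourier_sincsq_sum_dirichlet[OF f] \<tau>_def by simp
  also have "\<dots> = (LINT \<xi>|lborel. fourier f \<xi> * of_real (dirichlet_kernel M \<xi>) - fourier f \<xi> * of_real (sincsq_sum L \<xi> * dirichlet_kernel M \<xi>))
     - (LINT x|lborel. f x * of_real (dirichlet_kernel L x) - f x * of_real (dirichlet_kernel L x * \<tau> x))"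
    using fi gi by (simp add: Bochner_Integration.integral_diff)
  finally have eq: "P M f - P L (fourier f) = \<dots>" .
  have b1: "norm (LINT x|lborel. f x * of_real (dirichlet_kernel L x) - f x * of_real (dirichlet_kernel L x * \<tau> x)) \<le> tail_int (real M) L f"
  proof -
    have "norm (LINT x|lborel. f x * of_real (dirichlet_kernel L x) - f x * of_real (dirichlet_kernel L x * \<tau> x))
       \<le> (LINT x|lborel. norm (f x * of_real (dirichlet_kernel L x) - f x * of_real (dirichlet_kernel L x * \<tau> x)))"
      by (rule integral_norm_bound)
    also have "\<dots> \<le> tail_int (real M) L f"
      unfolding tail_int_def
    proof (rule integral_mono)
      fix x
      have "norm (f x * of_real (dirichlet_kernel L x) - f x * of_real (dirichlet_kernel L x * \<tau> x))
          = norm (f x * of_real (dirichlet_kernel L x * (1 - \<tau> x)))"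
        by (simp add: algebra_simps)
      also have "\<dots> = norm (f x) * \<bar>dirichlet_kernel L x\<bar> * (1 - \<tau> x)"
        unfolding norm_mult norm_of_real abs_mult using \<tau>[of x] by simp
      also have "\<dots> \<le> indicator {x. real M \<le> \<bar>x\<bar>} x * (norm (f x) * \<bar>dirichlet_kernel L x\<bar>)"
        using \<tau>[of x] by (auto split: split_indicator intro!: mult_left_le)
      finally show "norm (f x * of_real (dirichlet_kernel L x) - f x * of_real (dirichlet_kernel L x * \<tau> x))
          \<le> indicator {x. real M \<le> \<bar>x\<bar>} x * (norm (f x) * \<bar>dirichlet_kernel L x\<bar>)" .
    qed (use fi tail_int_integrable[OF f] in auto)
    finally show ?thesis .
  qed
  have b2: "norm (LINT \<xi>|lborel. fourier f \<xi> * of_real (dirichlet_kernel M \<xi>) - fourier f \<xi> * of_real (sincsq_sum L \<xi> * dirichlet_kernel M \<xi>))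
       \<le> tail_int (real L / 2) M (fourier f) + (LINT x|lborel. norm (fourier f x)) / real L"
  proof -
    have "norm (LINT \<xi>|lborel. fourier f \<xi> * of_real (dirichlet_kernel M \<xi>) - fourier f \<xi> * of_real (sincsq_sum L \<xi> * dirichlet_kernel M \<xi>))
       \<le> (LINT \<xi>|lborel. norm (fourier f \<xi> * of_real (dirichlet_kernel M \<xi>) - fourier f \<xi> * of_real (sincsq_sum L \<xi> * dirichlet_kernel M \<xi>)))"
      by (rule integral_norm_bound)
    also have "\<dots> \<le> (LINT x|lborel. indicator {x. real L / 2 \<le> \<bar>x\<bar>} x * (norm (fourier f x) * \<bar>dirichlet_kernel M x\<bar>) + norm (fourier f x) / real L)"
    proof (rule integral_mono_AE)
      show "AE x in lborel. norm (fourier f x * of_real (dirichlet_kernel M x) - fourier f x * of_real (sincsq_sum L x * dirichlet_kernel M x))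
         \<le> indicator {x. real L / 2 \<le> \<bar>x\<bar>} x * (norm (fourier f x) * \<bar>dirichlet_kernel M x\<bar>) + norm (fourier f x) / real L"
        using Ints_null_AE
      proof eventually_elim
        fix x :: real assume x: "x \<notin> \<int>"
        note s = sincsq_sum_le_1_and_tail[OF x, of L] sincsq_sum_nonneg[of L x]
        have "norm (fourier f x * of_real (dirichlet_kernel M x) - fourier f x * of_real (sincsq_sum L x * dirichlet_kernel M x))
            = norm (fourier f x * of_real (dirichlet_kernel M x * (1 - sincsq_sum L x)))"
          by (simp add: algebra_simps)
        also have "\<dots> = norm (fourier f x) * (\<bar>dirichlet_kernel M x\<bar> * (1 - sincsq_sum L x))"
          unfolding norm_mult norm_of_real abs_mult using s by simp
        also have "\<dots> \<le> indicator {x. real L / 2 \<le> \<bar>x\<bar>} x * (norm (fourier f x) * \<bar>dirichlet_kernel M x\<bar>) + norm (fourier f x) / real L"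
        proof (cases "real L / 2 \<le> \<bar>x\<bar>")
          case True
          have "\<bar>dirichlet_kernel M x\<bar> * (1 - sincsq_sum L x) \<le> \<bar>dirichlet_kernel M x\<bar>"
            using s by (intro mult_left_le) auto
          then have "norm (fourier f x) * (\<bar>dirichlet_kernel M x\<bar> * (1 - sincsq_sum L x)) \<le> norm (fourier f x) * \<bar>dirichlet_kernel M x\<bar>"
            by (rule mult_left_mono) simp
          moreover have "0 \<le> norm (fourier f x) / real L" by simp
          ultimately show ?thesis using True by (simp add: add_increasing2)
        next
          case False
          then have "1 - sincsq_sum L x \<le> (sin (pi * x))\<^sup>2 / real L"
            using s(2) L by simp
          then have "\<bar>dirichlet_kernel M x\<bar> * (1 - sincsq_sum L x) \<le> \<bar>dirichlet_kernel M x\<bar> * ((sin (pi * x))\<^sup>2 / real L)"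
            by (rule mult_left_mono) simp
          also have "\<dots> = ((sin (pi * x))\<^sup>2 * \<bar>dirichlet_kernel M x\<bar>) / real L" by simp
          also have "\<dots> \<le> 1 / real L"
            by (intro divide_right_mono sin_squared_mult_dirichlet_kernel_le) simp
          finally have "norm (fourier f x) * (\<bar>dirichlet_kernel M x\<bar> * (1 - sincsq_sum L x)) \<le> norm (fourier f x) * (1 / real L)"
            by (rule mult_left_mono) simp
          then show ?thesis using False by simp
        qed
        finally show "norm (fourier f x * of_real (dirichlet_kernel M x) - fourier f x * of_real (sincsq_sum L x * dirichlet_kernel M x))
         \<le> indicator {x. real L / 2 \<le> \<bar>x\<bar>} x * (norm (fourier f x) * \<bar>dirichlet_kernel M x\<bar>) + norm (fourier f x) / real L" .
      qed
      show "integrable lborel (\<lambda>x. indicator {x. real L / 2 \<le> \<bar>x\<bar>} x * (norm (fourier f x) * \<bar>dirichlet_kernel M x\<bar>) + norm (fourier f x) / real L)"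
        by (intro Bochner_Integration.integrable_add tail_int_integrable[OF g]) (use g in auto)
    qed (use gi in auto)
    also have "\<dots> = tail_int (real L / 2) M (fourier f) + (LINT x|lborel. norm (fourier f x)) / real L"
      unfolding tail_int_def
      by (subst Bochner_Integration.integral_add[OF tail_int_integrable[OF g]]) (use g in auto)
    finally show ?thesis .
  qed
  show ?thesis
    unfolding eq using norm_triangle_ineq4 b1 b2 by (smt (verit))
qed

section \<open>Tails against the Dirichlet kernel\<close>

lemma nn_integral_powr_tail:
  fixes s R :: real
  assumes s: "s > 1" and R: "R > 0"
  shows "(\<integral>\<^sup>+x. ennreal (indicator {x. R \<le> \<bar>x\<bar>} x * \<bar>x\<bar> powr (- s)) \<partial>lborel) \<le> ennreal (2 * R powr (1 - s) / (s - 1))"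
proof -
  define g where "g x = ennreal (x powr (- s)) * indicator {R..} x" for x :: real
  have [measurable]: "g \<in> borel_measurable borel" unfolding g_def by measurable
  have 1: "(\<integral>\<^sup>+x. g x \<partial>lborel) = ennreal (0 - (- (R powr (1 - s) / (s - 1))))"
    unfolding g_def
  proof (rule nn_integral_FTC_atLeast)
    fix x assume "R \<le> x"
    then have "x > 0" using R by simp
    have "((\<lambda>x. - (x powr (1 - s) / (s - 1))) has_real_derivative - ((1 - s) * x powr (1 - s - 1) / (s - 1))) (at x)"
      by (intro DERIV_minus DERIV_cdivide has_real_derivative_powr \<open>x > 0\<close>)
    also have "- ((1 - s) * x powr (1 - s - 1) / (s - 1)) = x powr (- s)"
      using s by (simp add: field_simps)
    finally show "((\<lambda>x. - (x powr (1 - s) / (s - 1))) has_real_derivative x powr (- s)) (at x)" .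
  next
    have "((\<lambda>x. x powr (1 - s)) \<longlongrightarrow> 0) at_top"
      by (rule tendsto_neg_powr) (use s in \<open>auto simp: filterlim_ident\<close>)
    then have "((\<lambda>x. - (x powr (1 - s) / (s - 1))) \<longlongrightarrow> - (0 / (s - 1))) at_top"
      using s by (intro tendsto_intros) auto
    then show "((\<lambda>x. - (x powr (1 - s) / (s - 1))) \<longlongrightarrow> 0) at_top" by simp
  qed auto
  have "(\<integral>\<^sup>+x. ennreal (indicator {x. R \<le> \<bar>x\<bar>} x * \<bar>x\<bar> powr (- s)) \<partial>lborel) \<le> (\<integral>\<^sup>+x. g x + g (- x) \<partial>lborel)"
    by (rule nn_integral_mono) (auto simp: g_def abs_if split: split_indicator)
  also have "\<dots> = (\<integral>\<^sup>+x. g x \<partial>lborel) + (\<integral>\<^sup>+x. g (- x) \<partial>lborel)"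
    by (rule nn_integral_add) measurable
  also have "(\<integral>\<^sup>+x. g (- x) \<partial>lborel) = (\<integral>\<^sup>+x. g x \<partial>lborel)"
    using nn_integral_real_affine[of g "-1" 0] by simp
  also have "(\<integral>\<^sup>+x. g x \<partial>lborel) + (\<integral>\<^sup>+x. g x \<partial>lborel) = ennreal (2 * R powr (1 - s) / (s - 1))"
    unfolding 1 using s by (subst ennreal_plus[symmetric]) auto
  finally show ?thesis .
qed

text \<open>Tonelli on the strip |x - y| \<le> 1/2. It replaces a decomposition into unit cells:
  \<open>G\<close> must be dominated by its neighbours through \<open>G'\<close>, and of
  \<open>H\<close> only the mass on windows of length 1 matters. \<open>H\<close> will be a power of
  the Dirichlet kernel, later the Fejer kernel.\<close>

lemma nn_integral_window:
  fixes G G' H :: "real \<Rightarrow> ennreal"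
  assumes [measurable]: "G \<in> borel_measurable borel" "G' \<in> borel_measurable borel" "H \<in> borel_measurable borel"
    and G: "\<And>x. G x \<le> (\<integral>\<^sup>+y. G' y * indicator {x - 1/2..x + 1/2} y \<partial>lborel)"
    and H: "\<And>y. (\<integral>\<^sup>+x. H x * indicator {y - 1/2..y + 1/2} x \<partial>lborel) \<le> h"
  shows "(\<integral>\<^sup>+x. G x * H x \<partial>lborel) \<le> h * (\<integral>\<^sup>+x. G' x \<partial>lborel)"
proof -
  define W where "W x y = (indicator {p. \<bar>fst p - snd p\<bar> \<le> 1/2} (x, y) :: ennreal)" for x y :: real
  have [measurable]: "(\<lambda>(x, y). W x y) \<in> borel_measurable (borel \<Otimes>\<^sub>M borel)"
    unfolding W_def by measurable
  have W: "W x y = indicator {x - 1/2..x + 1/2} y" "W x y = indicator {y - 1/2..y + 1/2} x" for x y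
  proof -
    have "\<bar>x - y\<bar> \<le> 1/2 \<longleftrightarrow> x - 1/2 \<le> y \<and> y \<le> x + 1/2" "\<bar>x - y\<bar> \<le> 1/2 \<longleftrightarrow> y - 1/2 \<le> x \<and> x \<le> y + 1/2"
      by arith+
    then show "W x y = indicator {x - 1/2..x + 1/2} y" "W x y = indicator {y - 1/2..y + 1/2} x"
      by (simp_all only: W_def indicator_def mem_Collect_eq fst_conv snd_conv atLeastAtMost_iff)
  qed
  have "(\<integral>\<^sup>+x. G x * H x \<partial>lborel) \<le> (\<integral>\<^sup>+x. (\<integral>\<^sup>+y. G' y * W x y \<partial>lborel) * H x \<partial>lborel)"
    by (intro nn_integral_mono mult_right_mono) (use G W in auto)
  also have "\<dots> = (\<integral>\<^sup>+x. (\<integral>\<^sup>+y. G' y * (H x * W x y) \<partial>lborel) \<partial>lborel)"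
    by (subst nn_integral_multc[symmetric]) (auto simp: mult_ac)
  also have "\<dots> = (\<integral>\<^sup>+y. (\<integral>\<^sup>+x. G' y * (H x * W x y) \<partial>lborel) \<partial>lborel)"
    by (rule lborel_pair.Fubini'[symmetric]) measurable
  also have "\<dots> = (\<integral>\<^sup>+y. G' y * (\<integral>\<^sup>+x. H x * W x y \<partial>lborel) \<partial>lborel)"
    by (subst nn_integral_cmult) auto
  also have "\<dots> \<le> (\<integral>\<^sup>+y. G' y * h \<partial>lborel)"
    by (intro nn_integral_mono mult_left_mono) (use H W in auto)
  also have "\<dots> = h * (\<integral>\<^sup>+x. G' x \<partial>lborel)"
    by (subst nn_integral_multc) (auto simp: mult.commute)
  finally show ?thesis .
qed

text \<open>From t cos t \<le> sin t at the half angle follows t cos^2(t/2) \<le> sin t, and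
  cos^2(t/2) \<ge> 1/2 for t \<le> pi/2. With t = pi |x| this leaves t/2 \<ge> |x|.\<close>

lemma abs_sin_pi_ge:
  assumes "\<bar>x\<bar> \<le> 1/2" shows "\<bar>x\<bar> \<le> \<bar>sin (pi * x)\<bar>"
proof -
  have cosle: "t * cos t \<le> sin t" if t: "0 \<le> t" "t \<le> pi" for t
  proof (cases "t = 0")
    case False
    with t have "0 < t" by simp
    then obtain z where z: "z > 0" "z < t" "sin t - sin 0 = (t - 0) * cos z"
      using MVT2[of 0 t sin cos] by (auto intro: DERIV_sin)
    have "cos t \<le> cos z" by (rule cos_monotone_0_pi_le) (use z t in auto)
    then show ?thesis using z t by (simp add: mult_left_mono)
  qed simp
  define t where "t = pi * \<bar>x\<bar>"
  have t: "0 \<le> t" "t \<le> pi / 2" using assms by (auto simp: t_def)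
  have c: "cos (t / 2) \<ge> 0" "cos t \<ge> 0" by (rule cos_ge_zero; use t in auto)+
  have "t * (cos (t / 2))\<^sup>2 = 2 * (t / 2 * cos (t / 2)) * cos (t / 2)" by (simp add: power2_eq_square)
  also have "\<dots> \<le> 2 * sin (t / 2) * cos (t / 2)"
    using cosle[of "t / 2"] t c by (intro mult_right_mono mult_left_mono) auto
  also have "\<dots> = sin t" using sin_double[of "t / 2"] by simp
  finally have a: "t * (cos (t / 2))\<^sup>2 \<le> sin t" .
  have "(cos (t / 2))\<^sup>2 \<ge> 1 / 2" using cos_double_cos[of "t / 2"] c by simp
  then have "t * (1 / 2) \<le> t * (cos (t / 2))\<^sup>2" using t by (intro mult_left_mono) auto
  moreover have "\<bar>x\<bar> * 2 \<le> t" unfolding t_def using mult_right_mono[OF pi_ge_two, of "\<bar>x\<bar>"] by (simp add: mult.commute)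
  moreover have "sin t = \<bar>sin (pi * x)\<bar>"
  proof -
    have "sin t \<ge> 0" by (rule sin_ge_zero) (use t in auto)
    then show ?thesis by (auto simp: t_def abs_if split: if_splits)
  qed
  ultimately show ?thesis using a by linarith
qed

text \<open>Near 0 the kernel is below both 2n and 1/|x|, where n = N + 1. The r-th power of this
  majorant, switched at |x| = 1/n, has mass of order n^(r-1); r > 1 makes the part away from 0
  integrable, where r = 1 would produce a logarithm.\<close>

lemma dirichlet_kernel_window:
  fixes r :: real
  assumes r: "r > 1"
  shows "\<exists>C\<ge>0. \<forall>N y. (\<integral>\<^sup>+x. ennreal (\<bar>dirichlet_kernel N x\<bar> powr r) * indicator {y - 1/2..y + 1/2} x \<partial>lborel)
      \<le> ennreal (C * (real N + 1) powr (r - 1))"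
proof (intro exI conjI allI)
  define C where "C = 3 * (2 * 2 powr r + 2 / (r - 1))"
  show "C \<ge> 0" using r by (simp add: C_def)
  fix N :: nat and y :: real
  define n where "n = real N + 1"
  have n: "n \<ge> 1" by (simp add: n_def)
  define K where "K x = indicator {- (1/n)..1/n} x * (2 * n) powr r + indicator {x. 1/n \<le> \<bar>x\<bar>} x * \<bar>x\<bar> powr (- r)" for x
  have [measurable]: "K \<in> borel_measurable borel" unfolding K_def by measurable
  have Knn: "K x \<ge> 0" for x by (simp add: K_def)
  have Kint: "(\<integral>\<^sup>+x. ennreal (K x) \<partial>lborel) \<le> ennreal (C / 3 * n powr (r - 1))"
  proof -
    have "(\<integral>\<^sup>+x. ennreal (K x) \<partial>lborel) = (\<integral>\<^sup>+x. ennreal ((2 * n) powr r) * indicator {- (1/n)..1/n} x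
        + ennreal (indicator {x. 1/n \<le> \<bar>x\<bar>} x * \<bar>x\<bar> powr (- r)) \<partial>lborel)"
      by (intro nn_integral_cong) (auto simp: K_def ennreal_plus[symmetric] simp del: ennreal_plus split: split_indicator)
    also have "\<dots> = ennreal ((2 * n) powr r) * ennreal (2 / n) + (\<integral>\<^sup>+x. ennreal (indicator {x. 1/n \<le> \<bar>x\<bar>} x * \<bar>x\<bar> powr (- r)) \<partial>lborel)"
      using n by (subst nn_integral_add) (auto simp: nn_integral_cmult_indicator emeasure_lborel_Icc_eq)
    also have "\<dots> \<le> ennreal ((2 * n) powr r) * ennreal (2 / n) + ennreal (2 * (1/n) powr (1 - r) / (r - 1))"
      by (intro add_left_mono nn_integral_powr_tail r) (use n in auto)
    also have "\<dots> = ennreal ((2 * n) powr r * (2 / n) + 2 * (1/n) powr (1 - r) / (r - 1))"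
      using n r by (subst ennreal_mult[symmetric], simp, simp, subst ennreal_plus[symmetric]) auto
    also have "(2 * n) powr r * (2 / n) + 2 * (1/n) powr (1 - r) / (r - 1) = C / 3 * n powr (r - 1)"
    proof -
      have "(1/n) powr (1 - r) = n powr (r - 1)"
        using n by (simp add: powr_divide powr_diff powr_minus field_simps)
      moreover have "(2 * n) powr r * (2 / n) = 2 * 2 powr r * n powr (r - 1)"
        using n by (simp add: powr_mult powr_diff)
      ultimately show ?thesis by (simp add: C_def algebra_simps)
    qed
    finally show ?thesis .
  qed
  have near: "\<bar>dirichlet_kernel N x\<bar> powr r \<le> K x" if x: "\<bar>x\<bar> \<le> 1/2" for x
  proof (cases "\<bar>x\<bar> \<le> 1/n")
    case True
    have "\<bar>dirichlet_kernel N x\<bar> powr r \<le> (2 * n) powr r"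
      using abs_dirichlet_kernel_le[of N x] r by (intro powr_mono2) (auto simp: n_def)
    also have "\<dots> \<le> K x" using True by (auto simp: K_def abs_le_iff)
    finally show ?thesis .
  next
    case False
    then have x0: "\<bar>x\<bar> > 0" using n by auto
    have "\<bar>x\<bar> * \<bar>dirichlet_kernel N x\<bar> \<le> \<bar>sin (pi * x)\<bar> * \<bar>dirichlet_kernel N x\<bar>"
      by (intro mult_right_mono abs_sin_pi_ge x) simp
    also have "\<dots> \<le> 1" unfolding abs_mult[symmetric] sin_mult_dirichlet_kernel by simp
    finally have "\<bar>dirichlet_kernel N x\<bar> \<le> inverse \<bar>x\<bar>" using x0 by (simp add: field_simps)
    then have "\<bar>dirichlet_kernel N x\<bar> powr r \<le> inverse \<bar>x\<bar> powr r"
      using r by (intro powr_mono2) auto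
    also have "\<dots> = \<bar>x\<bar> powr (- r)" using x0 by (simp add: powr_minus powr_divide inverse_eq_divide)
    also have "\<dots> \<le> K x" using False by (simp add: K_def)
    finally show ?thesis .
  qed
  define m where "m = round y"
  \<comment> \<open>A window of length 1 around y lies within distance 1 of the nearest integer m,
    so each of its points is within 1/2 of m - 1, m or m + 1. By periodicity three translates of the
    majorant suffice, hence the factor 3 in \<open>C\<close>.\<close>
  have pw: "ennreal (\<bar>dirichlet_kernel N x\<bar> powr r) * indicator {y - 1/2..y + 1/2} x
      \<le> ennreal (K (of_int (- m) + 1 * x)) + ennreal (K (of_int (- m - 1) + 1 * x)) + ennreal (K (of_int (- m + 1) + 1 * x))" for x
  proof (cases "x \<in> {y - 1/2..y + 1/2}")
    case True
    have "\<bar>y - of_int m\<bar> \<le> 1/2" unfolding m_def using of_int_round_abs_le[of y] by (simp add: abs_minus_commute)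
    have dk: "\<bar>dirichlet_kernel N x\<bar> powr r \<le> K (x - of_int j)" if "\<bar>x - of_int j\<bar> \<le> 1/2" for j
      using near[OF that] dirichlet_kernel_plus_int[of N "x - of_int j" j] by simp
    have "\<bar>x - of_int m\<bar> \<le> 1" using True \<open>\<bar>y - of_int m\<bar> \<le> 1/2\<close>
      unfolding atLeastAtMost_iff by arith
    then have "\<bar>x - of_int m\<bar> \<le> 1/2 \<or> \<bar>x - of_int (m + 1)\<bar> \<le> 1/2 \<or> \<bar>x - of_int (m - 1)\<bar> \<le> 1/2"
      unfolding of_int_add of_int_diff of_int_1 by arith
    then consider "\<bar>x - of_int m\<bar> \<le> 1/2" | "\<bar>x - of_int (m + 1)\<bar> \<le> 1/2" | "\<bar>x - of_int (m - 1)\<bar> \<le> 1/2"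
      by blast
    then have "ennreal (\<bar>dirichlet_kernel N x\<bar> powr r) \<le> ennreal (K (of_int (- m) + 1 * x)) + ennreal (K (of_int (- m - 1) + 1 * x)) + ennreal (K (of_int (- m + 1) + 1 * x))"
    proof cases
      case 1
      from dk[OF this] have "ennreal (\<bar>dirichlet_kernel N x\<bar> powr r) \<le> ennreal (K (of_int (- m) + 1 * x))"
        by (intro ennreal_leI) simp
      then show ?thesis by (simp add: add_increasing2)
    next
      case 2
      from dk[OF this] have "ennreal (\<bar>dirichlet_kernel N x\<bar> powr r) \<le> ennreal (K (of_int (- m - 1) + 1 * x))"
        by (intro ennreal_leI) (simp add: algebra_simps)
      then show ?thesis by (simp add: add_increasing2 add_increasing)
    next
      case 3
      from dk[OF this] have "ennreal (\<bar>dirichlet_kernel N x\<bar> powr r) \<le> ennreal (K (of_int (- m + 1) + 1 * x))"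
        by (intro ennreal_leI) (simp add: algebra_simps)
      then show ?thesis by (simp add: add_increasing)
    qed
    then show ?thesis using True by simp
  qed simp
  have tr: "(\<integral>\<^sup>+x. ennreal (K (t + 1 * x)) \<partial>lborel) = (\<integral>\<^sup>+x. ennreal (K x) \<partial>lborel)" for t
    using nn_integral_real_affine[of "\<lambda>x. ennreal (K x)" 1 t] by simp
  have "(\<integral>\<^sup>+x. ennreal (\<bar>dirichlet_kernel N x\<bar> powr r) * indicator {y - 1/2..y + 1/2} x \<partial>lborel)
      \<le> (\<integral>\<^sup>+x. ennreal (K (of_int (- m) + 1 * x)) + ennreal (K (of_int (- m - 1) + 1 * x)) + ennreal (K (of_int (- m + 1) + 1 * x)) \<partial>lborel)"
    by (rule nn_integral_mono) (use pw in simp)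
  also have "\<dots> = (\<integral>\<^sup>+x. ennreal (K x) \<partial>lborel) + (\<integral>\<^sup>+x. ennreal (K x) \<partial>lborel) + (\<integral>\<^sup>+x. ennreal (K x) \<partial>lborel)"
    by (subst nn_integral_add, measurable, subst nn_integral_add, measurable) (simp only: tr)
  also have "\<dots> \<le> ennreal (C / 3 * n powr (r - 1)) + ennreal (C / 3 * n powr (r - 1)) + ennreal (C / 3 * n powr (r - 1))"
    by (intro add_mono Kint)
  also have "\<dots> = ennreal (C * n powr (r - 1))"
    using \<open>C \<ge> 0\<close> by (simp add: ennreal_plus[symmetric] del: ennreal_plus)
  finally show "(\<integral>\<^sup>+x. ennreal (\<bar>dirichlet_kernel N x\<bar> powr r) * indicator {y - 1/2..y + 1/2} x \<partial>lborel)
      \<le> ennreal (C * (real N + 1) powr (r - 1))" unfolding n_def .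
qed

lemma dirichlet_kernel_weighted_tail:
  fixes r s :: real
  assumes r: "r > 1" and s: "s > 1"
  shows "\<exists>C\<ge>0. \<forall>N R. R \<ge> 1 \<longrightarrow>
     (\<integral>\<^sup>+x. ennreal (indicator {x. R \<le> \<bar>x\<bar>} x * \<bar>x\<bar> powr (- s)) * ennreal (\<bar>dirichlet_kernel N x\<bar> powr r) \<partial>lborel)
      \<le> ennreal (C * (real N + 1) powr (r - 1) * R powr (1 - s))"
proof -
  obtain C where C: "C \<ge> 0" and w: "\<And>N y. (\<integral>\<^sup>+x. ennreal (\<bar>dirichlet_kernel N x\<bar> powr r) * indicator {y - 1/2..y + 1/2} x \<partial>lborel)
      \<le> ennreal (C * (real N + 1) powr (r - 1))"
    using dirichlet_kernel_window[OF r] by blast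
  define D where "D = C * ((3/2) powr s * (2 * (1/2) powr (1 - s) / (s - 1)))"
  show ?thesis
  proof (intro exI[of _ D] conjI allI impI)
    show "D \<ge> 0" using C s by (simp add: D_def)
    fix N :: nat and R :: real assume R: "R \<ge> 1"
    define G where "G x = ennreal (indicator {x. R \<le> \<bar>x\<bar>} x * \<bar>x\<bar> powr (- s))" for x
    \<comment> \<open>Since R \<ge> 1, a point y within 1/2 of some x with |x| \<ge> R satisfies R/2
      \<le> |y| \<le> 3/2 |x|. This explains the smaller radius and the factor (3/2)^s.\<close>
    define G' where "G' x = ennreal ((3/2) powr s) * ennreal (indicator {x. R/2 \<le> \<bar>x\<bar>} x * \<bar>x\<bar> powr (- s))" for x
    have [measurable]: "G \<in> borel_measurable borel" "G' \<in> borel_measurable borel" unfolding G_def G'_def by measurable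
    have "(\<integral>\<^sup>+x. G x * ennreal (\<bar>dirichlet_kernel N x\<bar> powr r) \<partial>lborel) \<le> ennreal (C * (real N + 1) powr (r - 1)) * (\<integral>\<^sup>+x. G' x \<partial>lborel)"
    proof (rule nn_integral_window)
      fix x
      show "G x \<le> (\<integral>\<^sup>+y. G' y * indicator {x - 1/2..x + 1/2} y \<partial>lborel)"
      proof (cases "R \<le> \<bar>x\<bar>")
        case True
        have "G x = (\<integral>\<^sup>+y. G x * indicator {x - 1/2..x + 1/2} y \<partial>lborel)"
          by (simp add: nn_integral_cmult_indicator)
        also have "\<dots> \<le> (\<integral>\<^sup>+y. G' y * indicator {x - 1/2..x + 1/2} y \<partial>lborel)"
        proof (rule nn_integral_mono)
          fix y
          show "G x * indicator {x - 1/2..x + 1/2} y \<le> G' y * indicator {x - 1/2..x + 1/2} y"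
          proof (cases "y \<in> {x - 1/2..x + 1/2}")
            case in_: True
            then have y: "R / 2 \<le> \<bar>y\<bar>" "\<bar>y\<bar> \<le> 3/2 * \<bar>x\<bar>" "\<bar>y\<bar> > 0" using True R by (auto simp: abs_if split: if_splits)
            have "((3/2) * \<bar>x\<bar>) powr (- s) \<le> \<bar>y\<bar> powr (- s)"
              using y s by (intro powr_mono2') auto
            then have "(3/2) powr s * (((3/2) * \<bar>x\<bar>) powr (- s)) \<le> (3/2) powr s * \<bar>y\<bar> powr (- s)"
              by (intro mult_left_mono) auto
            moreover have "(3/2) powr s * (((3/2) * \<bar>x\<bar>) powr (- s)) = \<bar>x\<bar> powr (- s)"
              by (subst powr_mult) (auto simp: mult.assoc[symmetric] powr_add[symmetric])
            ultimately have "\<bar>x\<bar> powr (- s) \<le> (3/2) powr s * \<bar>y\<bar> powr (- s)"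
              by argo
            then have "G x \<le> G' y"
              using True y unfolding G_def G'_def by (simp add: ennreal_mult[symmetric])
            then show ?thesis by (rule mult_right_mono) simp
          qed simp
        qed
        finally show ?thesis .
      qed (simp add: G_def)
    qed (use w in auto)
    also have "(\<integral>\<^sup>+x. G' x \<partial>lborel) \<le> ennreal ((3/2) powr s) * ennreal (2 * (R/2) powr (1 - s) / (s - 1))"
      unfolding G'_def by (subst nn_integral_cmult, measurable) (intro mult_left_mono nn_integral_powr_tail s, use R in auto)
    also have "ennreal (C * (real N + 1) powr (r - 1)) * (ennreal ((3/2) powr s) * ennreal (2 * (R/2) powr (1 - s) / (s - 1)))
      = ennreal (D * (real N + 1) powr (r - 1) * R powr (1 - s))"
    proof -
      have "(R/2) powr (1 - s) = R powr (1 - s) * (1/2) powr (1 - s)"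
        using R by (simp add: powr_mult[symmetric])
      then show ?thesis
        using C s by (simp add: ennreal_mult[symmetric] D_def mult_ac)
    qed
    finally show "(\<integral>\<^sup>+x. ennreal (indicator {x. R \<le> \<bar>x\<bar>} x * \<bar>x\<bar> powr (- s)) * ennreal (\<bar>dirichlet_kernel N x\<bar> powr r) \<partial>lborel)
      \<le> ennreal (D * (real N + 1) powr (r - 1) * R powr (1 - s))"
      unfolding G_def by (simp add: mult_left_mono)
  qed
qed

text \<open>The exponent of \<open>|x|\<close> is \<open>\<alpha> p\<close> for \<open>\<alpha> = A + 1 - 1/p\<close>.\<close>
definition weight_tail :: "real \<Rightarrow> real \<Rightarrow> (real \<Rightarrow> complex) \<Rightarrow> real \<Rightarrow> real \<Rightarrow> real" where
  "weight_tail p A g R x = indicator {x. R \<le> \<bar>x\<bar>} x * (norm (g x) powr p * \<bar>x\<bar> powr (A * p + p - 1))"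

lemma weight_tail_measurable [measurable]:
  assumes [measurable]: "g \<in> borel_measurable borel"
  shows "weight_tail p A g R \<in> borel_measurable borel"
  unfolding weight_tail_def by measurable

lemma weight_tail_nonneg: "0 \<le> weight_tail p A g R x"
  by (simp add: weight_tail_def)

lemma weight_tail_integrable:
  assumes "integrable lborel (weight_tail p A g 1)" "g \<in> borel_measurable borel" "1 \<le> R"
  shows "integrable lborel (weight_tail p A g R)"
  using assms(1)
  by (rule Bochner_Integration.integrable_bound)
     (use assms in \<open>auto intro!: AE_I2 simp: weight_tail_def split: split_indicator\<close>)

lemma weight_tail_tendsto_0:
  assumes i: "integrable lborel (weight_tail p A g 1)" and [measurable]: "g \<in> borel_measurable borel"
  shows "((\<lambda>R. LINT x|lborel. weight_tail p A g R x) \<longlongrightarrow> 0) at_top"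
proof -
  have "((\<lambda>R. LINT x|lborel. weight_tail p A g R x) \<longlongrightarrow> integral\<^sup>L lborel (\<lambda>x::real. 0)) at_top"
  proof (rule integral_dominated_convergence_at_top[where w="weight_tail p A g 1"])
    show "\<forall>\<^sub>F R in at_top. AE x in lborel. norm (weight_tail p A g R x) \<le> weight_tail p A g 1 x"
      using eventually_ge_at_top[of 1]
      by eventually_elim (auto intro!: AE_I2 simp: weight_tail_def split: split_indicator)
    have "\<forall>\<^sub>F R in at_top. weight_tail p A g R x = 0" for x
      using eventually_gt_at_top[of "\<bar>x\<bar>"] by eventually_elim (simp add: weight_tail_def)
    then show "AE x in lborel. ((\<lambda>R. weight_tail p A g R x) \<longlongrightarrow> 0) at_top"
      by (auto intro!: AE_I2 tendsto_eventually)
  qed (use i in auto)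
  then show ?thesis by simp
qed

text \<open>The dual exponent is infinite here, so the kernel enters only through its maximum 2N +
  1.\<close>

lemma tail_int_le_p_eq_1:
  assumes i: "integrable lborel (weight_tail 1 A g 1)" and gm: "g \<in> borel_measurable borel" and A: "A > 0" and R: "R \<ge> 1"
  shows "tail_int R N g \<le> (2 * real N + 1) * R powr (- A) * (LINT x|lborel. weight_tail 1 A g R x)"
proof -
  have "tail_int R N g \<le> (LINT x|lborel. (2 * real N + 1) * R powr (- A) * weight_tail 1 A g R x)"
    unfolding tail_int_def
  proof (rule integral_mono')
    fix x :: real
    show "indicator {x. R \<le> \<bar>x\<bar>} x * (norm (g x) * \<bar>dirichlet_kernel N x\<bar>) \<le> (2 * real N + 1) * R powr (- A) * weight_tail 1 A g R x"
    proof (cases "R \<le> \<bar>x\<bar>")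
      case True
      have "R powr (- A) * R powr A \<le> R powr (- A) * \<bar>x\<bar> powr A"
        using True A R by (intro mult_left_mono powr_mono2) auto
      then have 1: "1 \<le> R powr (- A) * \<bar>x\<bar> powr A" using R by (simp add: powr_add[symmetric])
      have "norm (g x) * \<bar>dirichlet_kernel N x\<bar> \<le> norm (g x) * (2 * real N + 1)"
        by (intro mult_left_mono abs_dirichlet_kernel_le) auto
      also have "\<dots> \<le> norm (g x) * (2 * real N + 1) * (R powr (- A) * \<bar>x\<bar> powr A)"
        using mult_left_mono[OF 1, of "norm (g x) * (2 * real N + 1)"] by simp
      finally show ?thesis using True by (simp add: weight_tail_def mult_ac)
    qed (simp add: weight_tail_def)
  qed (use weight_tail_integrable[OF i gm R] weight_tail_nonneg in auto)
  then show ?thesis by simp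
qed

text \<open>For \<open>p > 1\<close> the bound comes from Young's inequality, applied to
  \<open>(\<lambda> |g| |x|\<^sup>\<alpha>) (|x|\<^sup>-\<^sup>\<alpha> |D\<^sub>N| / \<lambda>)\<close> with a free parameter \<open>\<lambda>\<close>.\<close>
lemma tail_int_le_p_gt_1:
  assumes p: "p > 1" and i: "integrable lborel (weight_tail p A g 1)" and gm: "g \<in> borel_measurable borel" and A: "A > 0"
  shows "\<exists>C\<ge>0. \<forall>N R \<mu>. R \<ge> 1 \<longrightarrow> \<mu> > 0 \<longrightarrow>
    tail_int R N g \<le> \<mu> powr p * (LINT x|lborel. weight_tail p A g R x)
      + C * ((real N + 1) powr (1 / p) * R powr (- A) / \<mu>) powr (p / (p - 1))"
proof -
  note [measurable] = gm
  define r where "r = p / (p - 1)"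
  define \<alpha> where "\<alpha> = A + 1 - 1 / p"
  \<comment> \<open>With r dual to p and \<alpha> the original weight exponent, s equals \<alpha> r,
    the power of |x| left on the kernel in the dual factor. It exceeds 1 precisely because A >
    0.\<close>
  define s where "s = 1 + A * r"
  have r: "r > 1" using p by (simp add: r_def field_simps)
  have s: "s > 1" using A r by (simp add: s_def)
  have pr: "1 / p + 1 / r = 1" "r / p = r - 1" using p by (simp_all add: r_def field_simps)
  have ap: "\<alpha> * p = A * p + p - 1" using p by (simp add: \<alpha>_def field_simps)
  have ar: "\<alpha> * r = s"
  proof -
    have "\<alpha> * r = A * r + (1 - 1 / p) * r" by (simp add: \<alpha>_def algebra_simps)
    also have "(1 - 1 / p) * r = 1" using p by (simp add: r_def field_simps)
    finally show ?thesis by (simp add: s_def)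
  qed
  obtain C where C: "C \<ge> 0" and w: "\<And>N R. R \<ge> 1 \<Longrightarrow>
     (\<integral>\<^sup>+x. ennreal (indicator {x. R \<le> \<bar>x\<bar>} x * \<bar>x\<bar> powr (- s)) * ennreal (\<bar>dirichlet_kernel N x\<bar> powr r) \<partial>lborel)
      \<le> ennreal (C * (real N + 1) powr (r - 1) * R powr (1 - s))"
    using dirichlet_kernel_weighted_tail[OF r s] by blast
  show ?thesis
    unfolding r_def[symmetric]
  proof (intro exI[of _ C] conjI allI impI C)
    fix N :: nat and R \<mu> :: real assume R: "R \<ge> 1" and \<mu>: "\<mu> > 0"
    define h where "h x = indicator {x. R \<le> \<bar>x\<bar>} x * \<bar>x\<bar> powr (- s) * \<bar>dirichlet_kernel N x\<bar> powr r" for x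
    have hm [measurable]: "h \<in> borel_measurable borel" unfolding h_def by measurable
    have hnn: "h x \<ge> 0" for x by (simp add: h_def)
    have hb: "(\<integral>\<^sup>+x. ennreal (h x) \<partial>lborel) \<le> ennreal (C * (real N + 1) powr (r - 1) * R powr (1 - s))"
      using w[OF R, of N] by (simp add: h_def ennreal_mult)
    then have hi: "integrable lborel h"
      by (intro integrableI_nonneg) (auto simp: hnn intro!: le_less_trans[OF hb])
    have hb': "(LINT x|lborel. h x) \<le> C * (real N + 1) powr (r - 1) * R powr (1 - s)"
      by (rule integral_real_bounded) (use hb C in auto)
    have "tail_int R N g \<le> (LINT x|lborel. \<mu> powr p * weight_tail p A g R x + \<mu> powr (- r) * h x)"
      unfolding tail_int_def
    proof (rule integral_mono')
      fix x :: real
      show "indicator {x. R \<le> \<bar>x\<bar>} x * (norm (g x) * \<bar>dirichlet_kernel N x\<bar>) \<le> \<mu> powr p * weight_tail p A g R x + \<mu> powr (- r) * h x"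
      proof (cases "R \<le> \<bar>x\<bar>")
        case True
        then have x: "\<bar>x\<bar> > 0" using R by simp
        define a where "a = \<mu> * norm (g x) * \<bar>x\<bar> powr \<alpha>"
        define b where "b = \<bar>dirichlet_kernel N x\<bar> * \<bar>x\<bar> powr (- \<alpha>) / \<mu>"
        have ab0: "a \<ge> 0" "b \<ge> 0" using \<mu> by (auto simp: a_def b_def)
        have "norm (g x) * \<bar>dirichlet_kernel N x\<bar> = a * b"
          using x \<mu> by (simp add: a_def b_def powr_minus field_simps)
        also have "\<dots> \<le> a powr p / p + b powr r / r"
          by (rule Youngs_inequality) (use p r pr ab0 in auto)
        also have "\<dots> \<le> a powr p + b powr r"
        proof -
          have "y / z \<le> y" if "y \<ge> 0" "z > 1" for y z :: real
            using that mult_left_mono[of 1 z y] by (simp add: divide_le_eq)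
          then show ?thesis using p r by (intro add_mono) auto
        qed
        also have "a powr p = \<mu> powr p * (norm (g x) powr p * \<bar>x\<bar> powr (A * p + p - 1))"
          using \<mu> by (simp add: a_def powr_mult powr_powr ap mult_ac)
        also have "b powr r = \<mu> powr (- r) * (\<bar>x\<bar> powr (- s) * \<bar>dirichlet_kernel N x\<bar> powr r)"
          using \<mu> ar by (simp add: b_def powr_divide powr_mult powr_powr powr_minus divide_inverse mult_ac inverse_powr)
        finally show ?thesis using True by (simp add: weight_tail_def h_def)
      qed (simp add: weight_tail_def h_def)
      show "0 \<le> \<mu> powr p * weight_tail p A g R x + \<mu> powr (- r) * h x"
        by (simp add: weight_tail_nonneg hnn)
    qed (use weight_tail_integrable[OF i gm R] hi in auto)
    also have "\<dots> = \<mu> powr p * (LINT x|lborel. weight_tail p A g R x) + \<mu> powr (- r) * (LINT x|lborel. h x)"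
      using weight_tail_integrable[OF i gm R] hi by simp
    also have "\<mu> powr (- r) * (LINT x|lborel. h x) \<le> \<mu> powr (- r) * (C * (real N + 1) powr (r - 1) * R powr (1 - s))"
      by (intro mult_left_mono hb') simp
    also have "\<mu> powr (- r) * (C * (real N + 1) powr (r - 1) * R powr (1 - s)) = C * ((real N + 1) powr (1 / p) * R powr (- A) / \<mu>) powr r"
      using \<mu> R pr(2) by (simp add: powr_divide powr_mult powr_powr powr_minus s_def divide_inverse mult_ac inverse_powr)
    finally show "tail_int R N g \<le> \<mu> powr p * (LINT x|lborel. weight_tail p A g R x) + C * ((real N + 1) powr (1 / p) * R powr (- A) / \<mu>) powr r"
      by simp
  qed
qed

text \<open>With X = (N+1)^(1/p) R^(-A) \<le> 1, the choice \<open>\<mu> = sqrt X\<close> makes both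
  terms of the Young bound at most a constant times \<open>sqrt X\<close>. Half of the exponent is
  lost, which does no harm where X decays geometrically along dyadic scales.\<close>

lemma tail_int_le_sqrt:
  assumes p: "p \<ge> 1" and i: "integrable lborel (weight_tail p A g 1)" and gm: "g \<in> borel_measurable borel" and A: "A > 0"
  shows "\<exists>C\<ge>0. \<forall>N R. R \<ge> 1 \<longrightarrow> (real N + 1) powr (1 / p) * R powr (- A) \<le> 1 \<longrightarrow>
    tail_int R N g \<le> C * sqrt ((real N + 1) powr (1 / p) * R powr (- A))"
proof -
  define I where "I R = (LINT x|lborel. weight_tail p A g R x)" for R
  have I: "I R \<le> I 1" if "R \<ge> 1" for R
    unfolding I_def using that
    by (intro integral_mono i weight_tail_integrable[OF i gm]) (auto simp: weight_tail_def split: split_indicator)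
  have I0: "I R \<ge> 0" for R unfolding I_def by (rule Bochner_Integration.integral_nonneg) (simp add: weight_tail_nonneg)
  consider "p = 1" | "p > 1" using p by linarith
  then show ?thesis
  proof cases
    case 1
    show ?thesis
    proof (intro exI[of _ "2 * I 1"] conjI allI impI)
      fix N :: nat and R :: real
      assume R: "1 \<le> R" and X: "(real N + 1) powr (1 / p) * R powr (- A) \<le> 1"
      define X where "X = (real N + 1) powr (1 / p) * R powr (- A)"
      have X1: "X \<le> 1" "X \<ge> 0" using X by (auto simp: X_def)
      have "X \<le> sqrt X" using X1 by (intro real_le_rsqrt) (simp add: power2_eq_square mult_left_le)
      have "tail_int R N g \<le> (2 * real N + 1) * R powr (- A) * I R"
        using tail_int_le_p_eq_1[of A g R N] i gm A R 1 unfolding I_def by simp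
      also have "\<dots> \<le> (2 * real N + 2) * R powr (- A) * I 1"
        by (intro mult_mono I R) (auto simp: I0)
      also have "\<dots> = 2 * I 1 * X" using 1 by (simp add: X_def algebra_simps)
      also have "\<dots> \<le> 2 * I 1 * sqrt X" using \<open>X \<le> sqrt X\<close> I0[of 1] by (intro mult_left_mono) auto
      finally show "tail_int R N g \<le> 2 * I 1 * sqrt ((real N + 1) powr (1 / p) * R powr (- A))"
        by (simp add: X_def)
    qed (simp add: I0)
  next
    case 2
    obtain C where C: "C \<ge> 0" and le: "\<And>N R \<mu>. R \<ge> 1 \<Longrightarrow> \<mu> > 0 \<Longrightarrow>
      tail_int R N g \<le> \<mu> powr p * I R + C * ((real N + 1) powr (1 / p) * R powr (- A) / \<mu>) powr (p / (p - 1))"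
      using tail_int_le_p_gt_1[OF 2 i gm A] unfolding I_def by blast
    show ?thesis
    proof (intro exI[of _ "I 1 + C"] conjI allI impI)
      fix N :: nat and R :: real
      assume R: "1 \<le> R" and X: "(real N + 1) powr (1 / p) * R powr (- A) \<le> 1"
      define X where "X = (real N + 1) powr (1 / p) * R powr (- A)"
      have X1: "X \<le> 1" "X > 0" using X R by (auto simp: X_def)
      have s: "sqrt X \<le> 1" "sqrt X > 0" "X / sqrt X = sqrt X" using X1 by (auto simp: real_div_sqrt)
      have pw: "sqrt X powr a \<le> sqrt X" if "a \<ge> 1" for a
        using powr_mono'[of 1 a "sqrt X"] that s by simp
      have "tail_int R N g \<le> sqrt X powr p * I R + C * (X / sqrt X) powr (p / (p - 1))"
        unfolding X_def by (rule le[OF R]) (use s X_def in auto)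
      also have "\<dots> \<le> sqrt X * I 1 + C * sqrt X"
        unfolding s(3) using 2 C s I[OF R] I0
        by (intro add_mono mult_mono pw mult_left_mono) (auto simp: field_simps)
      finally show "tail_int R N g \<le> (I 1 + C) * sqrt ((real N + 1) powr (1 / p) * R powr (- A))"
        by (simp add: X_def algebra_simps)
    qed (use C I0 in auto)
  qed
qed

text \<open>At the critical scale X is merely bounded. A large \<mu> first makes the kernel term of
  the Young bound smaller than \<epsilon>/2; with \<mu> fixed, a large R makes the remaining
  weighted mass small. For p = 1 the second effect alone is enough.\<close>

lemma tail_int_small:
  assumes p: "p \<ge> 1" and i: "integrable lborel (weight_tail p A g 1)" and gm: "g \<in> borel_measurable borel" and A: "A > 0"
    and K: "K > 0" and \<epsilon>: "\<epsilon> > 0"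
  shows "\<exists>R0\<ge>1. \<forall>N R. R \<ge> R0 \<longrightarrow> (real N + 1) powr (1 / p) * R powr (- A) \<le> K \<longrightarrow> tail_int R N g \<le> \<epsilon>"
proof -
  define I where "I R = (LINT x|lborel. weight_tail p A g R x)" for R
  have I0: "I R \<ge> 0" for R unfolding I_def by (rule Bochner_Integration.integral_nonneg) (simp add: weight_tail_nonneg)
  have small: "\<exists>R0\<ge>1. \<forall>R\<ge>R0. I R < \<delta>" if "\<delta> > 0" for \<delta>
  proof -
    have "eventually (\<lambda>R. I R < \<delta>) at_top"
      using order_tendstoD(2)[OF weight_tail_tendsto_0[OF i gm] that] unfolding I_def .
    then obtain R1 where "\<forall>R\<ge>R1. I R < \<delta>" by (auto simp: eventually_at_top_linorder)
    then show ?thesis by (intro exI[of _ "max 1 R1"]) auto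
  qed
  consider "p = 1" | "p > 1" using p by linarith
  then show ?thesis
  proof cases
    case 1
    obtain R0 where R0: "R0 \<ge> 1" "\<And>R. R \<ge> R0 \<Longrightarrow> I R < \<epsilon> / (2 * K)" using small[of "\<epsilon> / (2 * K)"] \<epsilon> K by auto
    show ?thesis
    proof (intro exI[of _ R0] conjI allI impI)
      fix N :: nat and R :: real
      assume R: "R0 \<le> R" and X: "(real N + 1) powr (1 / p) * R powr (- A) \<le> K"
      have "tail_int R N g \<le> (2 * real N + 1) * R powr (- A) * I R"
        using tail_int_le_p_eq_1[of A g R N] i gm A R R0 1 unfolding I_def by simp
      also have "\<dots> \<le> (2 * real N + 2) * R powr (- A) * I R"
        by (intro mult_right_mono) (auto simp: I0)
      also have "\<dots> = 2 * ((real N + 1) powr (1 / p) * R powr (- A)) * I R" using 1 by (simp add: algebra_simps)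
      also have "\<dots> \<le> 2 * K * (\<epsilon> / (2 * K))"
        using X R0(2)[OF R] K I0 by (intro mult_mono) auto
      finally show "tail_int R N g \<le> \<epsilon>" using K by simp
    qed (fact R0)
  next
    case 2
    obtain C where C: "C \<ge> 0" and le: "\<And>N R \<mu>. R \<ge> 1 \<Longrightarrow> \<mu> > 0 \<Longrightarrow>
      tail_int R N g \<le> \<mu> powr p * I R + C * ((real N + 1) powr (1 / p) * R powr (- A) / \<mu>) powr (p / (p - 1))"
      using tail_int_le_p_gt_1[OF 2 i gm A] unfolding I_def by blast
    define r where "r = p / (p - 1)"
    have r: "r > 0" using 2 by (simp add: r_def)
    have "((\<lambda>\<mu>. C * (K / \<mu>) powr r) \<longlongrightarrow> 0) at_top" using r K by real_asymp
    then have "eventually (\<lambda>\<mu>. C * (K / \<mu>) powr r < \<epsilon> / 2) at_top" by (rule order_tendstoD(2)) (use \<epsilon> in simp)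
    then have "eventually (\<lambda>\<mu>. C * (K / \<mu>) powr r < \<epsilon> / 2 \<and> \<mu> > 0) at_top" using eventually_gt_at_top[of 0] by eventually_elim auto
    then obtain \<mu> where \<mu>: "C * (K / \<mu>) powr r < \<epsilon> / 2" "\<mu> > 0" using eventually_happens by fastforce
    obtain R0 where R0: "R0 \<ge> 1" "\<And>R. R \<ge> R0 \<Longrightarrow> I R < \<epsilon> / 2 / \<mu> powr p" using small[of "\<epsilon> / 2 / \<mu> powr p"] \<epsilon> \<mu> by auto
    show ?thesis
    proof (intro exI[of _ R0] conjI allI impI)
      fix N :: nat and R :: real
      assume R: "R0 \<le> R" and X: "(real N + 1) powr (1 / p) * R powr (- A) \<le> K"
      have "tail_int R N g \<le> \<mu> powr p * I R + C * ((real N + 1) powr (1 / p) * R powr (- A) / \<mu>) powr r"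
        unfolding r_def by (rule le) (use R R0 \<mu> in auto)
      also have "\<dots> \<le> \<mu> powr p * (\<epsilon> / 2 / \<mu> powr p) + C * (K / \<mu>) powr r"
        using R0(2)[OF R] X \<mu> r C by (intro add_mono mult_left_mono powr_mono2 divide_right_mono) auto
      also have "\<dots> \<le> \<epsilon>" using \<mu> by simp
      finally show "tail_int R N g \<le> \<epsilon>" .
    qed (fact R0)
  qed
qed

section \<open>Integrability from a weighted norm\<close>

lemma powr_tail_integrable:
  fixes s :: real
  assumes "s > 1"
  shows "integrable lborel (\<lambda>x. indicator {x. 1 \<le> \<bar>x\<bar>} x * \<bar>x\<bar> powr (- s))"
  by (rule integrableI_nonneg)
     (use le_less_trans[OF nn_integral_powr_tail[OF assms, of 1]] in \<open>auto\<close>)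

text \<open>Away from [-1,1] either |g| \<le> |x|^(-(1+A)), which is integrable, or |g|^(p-1)
  |x|^((1+A)(p-1)) \<ge> 1, and then |g| is at most the weighted power itself. This pointwise
  alternative stands in for Hoelder's inequality and covers p = 1 too.\<close>

lemma integrable_if_weight_tail:
  assumes p: "p \<ge> 1" and A: "A > 0" and i: "integrable lborel (weight_tail p A g 1)" and gm: "g \<in> borel_measurable borel"
    and loc: "set_integrable lborel {-1..1} g"
  shows "integrable lborel g"
proof (rule Bochner_Integration.integrable_bound)
  show "integrable lborel (\<lambda>x. norm (indicator {-1..1} x *\<^sub>R g x) + (indicator {x. 1 \<le> \<bar>x\<bar>} x * \<bar>x\<bar> powr (- (1 + A)) + weight_tail p A g 1 x))"
    using powr_tail_integrable[of "1 + A"] A i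
    by (intro Bochner_Integration.integrable_add integrable_norm[OF loc[unfolded set_integrable_def]]) auto
  show "AE x in lborel. norm (g x) \<le> norm (norm (indicator {-1..1} x *\<^sub>R g x) + (indicator {x. 1 \<le> \<bar>x\<bar>} x * \<bar>x\<bar> powr (- (1 + A)) + weight_tail p A g 1 x))"
  proof (intro AE_I2)
    fix x :: real
    have nn: "0 \<le> norm (indicator {-1..1} x *\<^sub>R g x)" "0 \<le> indicator {x. 1 \<le> \<bar>x\<bar>} x * \<bar>x\<bar> powr (- (1 + A))" "0 \<le> weight_tail p A g 1 x"
      by (auto simp: weight_tail_nonneg)
    have "norm (g x) \<le> norm (indicator {-1..1} x *\<^sub>R g x) + (indicator {x. 1 \<le> \<bar>x\<bar>} x * \<bar>x\<bar> powr (- (1 + A)) + weight_tail p A g 1 x)"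
    proof (cases "\<bar>x\<bar> \<le> 1")
      case True
      then have "x \<in> {-1..1}" by auto
      then show ?thesis using nn by simp
    next
      case False
      then have x: "\<bar>x\<bar> > 1" by simp
      show ?thesis
      proof (cases "norm (g x) \<le> \<bar>x\<bar> powr (- (1 + A))")
        case True
        moreover have "indicator {x. 1 \<le> \<bar>x\<bar>} x * \<bar>x\<bar> powr (- (1 + A)) = \<bar>x\<bar> powr (- (1 + A))" using x by simp
        ultimately show ?thesis using nn by linarith
      next
        case big: False
        have g0: "norm (g x) > 0" using big by (smt (verit) powr_ge_zero)
        have "(\<bar>x\<bar> powr (- (1 + A))) powr (p - 1) \<le> norm (g x) powr (p - 1)"
          using big p by (intro powr_mono2) auto
        then have "(\<bar>x\<bar> powr (- (1 + A))) powr (p - 1) * \<bar>x\<bar> powr ((1 + A) * (p - 1)) \<le> norm (g x) powr (p - 1) * \<bar>x\<bar> powr ((1 + A) * (p - 1))"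
          by (rule mult_right_mono) simp
        then have "1 \<le> norm (g x) powr (p - 1) * \<bar>x\<bar> powr ((1 + A) * (p - 1))"
          using x by (auto simp: powr_powr powr_add[symmetric] algebra_simps split: if_splits)
        also have "\<dots> \<le> norm (g x) powr (p - 1) * \<bar>x\<bar> powr (A * p + p - 1)"
          using x A by (intro mult_left_mono powr_mono) (auto simp: algebra_simps)
        finally have "norm (g x) * 1 \<le> norm (g x) * (norm (g x) powr (p - 1) * \<bar>x\<bar> powr (A * p + p - 1))"
          by (rule mult_left_mono) simp
        also have "norm (g x) * (norm (g x) powr (p - 1) * \<bar>x\<bar> powr (A * p + p - 1)) = weight_tail p A g 1 x"
          using x g0 by (simp add: weight_tail_def powr_diff)
        finally show ?thesis using nn by linarith
      qed
    qed
    then show "norm (g x) \<le> norm (norm (indicator {-1..1} x *\<^sub>R g x) + (indicator {x. 1 \<le> \<bar>x\<bar>} x * \<bar>x\<bar> powr (- (1 + A)) + weight_tail p A g 1 x))"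
      using nn by simp
  qed
qed (use gm in auto)

section \<open>Passage to the limit along dyadic scales\<close>

lemma tends_to_xlimit_transfer:
  assumes t: "tends_to_xlimit t l" and \<phi>: "filterlim \<phi> at_top sequentially"
    and st: "(\<lambda>n. s n - t (\<phi> n)) \<longlonglongrightarrow> 0"
  shows "tends_to_xlimit s l"
proof -
  have e: "s n = t (\<phi> n) + (s n - t (\<phi> n))" for n by simp
  have re: "(\<lambda>n. Re (s n - t (\<phi> n))) \<longlonglongrightarrow> 0" and im: "(\<lambda>n. Im (s n - t (\<phi> n))) \<longlonglongrightarrow> 0"
    using tendsto_Re[OF st] tendsto_Im[OF st] by simp_all
  have ims: "(\<lambda>n. Im (s n)) \<longlonglongrightarrow> 0" if "(\<lambda>n. Im (t n)) \<longlonglongrightarrow> 0"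
    using tendsto_add[OF filterlim_compose[OF that \<phi>] im] by simp
  show ?thesis
  proof (cases l)
    case (Finite z)
    then show ?thesis
      using t tendsto_add[OF filterlim_compose[of t, OF _ \<phi>] st] by simp
  next
    case Plus_Infinity
    then show ?thesis
      using t ims filterlim_tendsto_add_at_top[OF re filterlim_compose[of "\<lambda>n. Re (t n)", OF _ \<phi>]] by simp
  next
    case Minus_Infinity
    then have "filterlim (\<lambda>n. - Re (t n)) at_top sequentially" and i: "(\<lambda>n. Im (t n)) \<longlonglongrightarrow> 0"
      using t by (simp_all add: filterlim_uminus_at_bot)
    from filterlim_tendsto_add_at_top[OF tendsto_minus[OF re] filterlim_compose[OF this(1) \<phi>]]
    have "filterlim (\<lambda>n. - Re (s n)) at_top sequentially" by simp
    then show ?thesis using Minus_Infinity ims[OF i] by (simp add: filterlim_uminus_at_bot)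
  qed
qed

text \<open>All pairs from corresponding blocks are compared, so that either index may be prescribed
  and the other one chosen. Both ends of the M-block are included, which links consecutive blocks;
  the summand 1 keeps the ceiling of 2^(\<gamma> j) inside the L-block for every j.\<close>

definition dyadic_close :: "real \<Rightarrow> (nat \<Rightarrow> complex) \<Rightarrow> (nat \<Rightarrow> complex) \<Rightarrow> (nat \<Rightarrow> real) \<Rightarrow> bool" where
  "dyadic_close \<gamma> s t e \<longleftrightarrow> (\<forall>\<^sub>F j in sequentially. \<forall>M L. 2 ^ j \<le> M \<longrightarrow> M \<le> 2 ^ (j + 1) \<longrightarrow>
      2 powr (\<gamma> * real j) \<le> real L \<longrightarrow> real L \<le> 2 powr (\<gamma> * real (j + 1)) + 1 \<longrightarrow> norm (s M - t L) \<le> e j)"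

definition log2_floor :: "real \<Rightarrow> nat \<Rightarrow> nat" where
  "log2_floor \<gamma> M = nat \<lfloor>log 2 (real M) / \<gamma>\<rfloor>"

lemma log2_floor_bounds:
  assumes "\<gamma> > 0" "M \<ge> 1"
  shows "2 powr (\<gamma> * real (log2_floor \<gamma> M)) \<le> real M" "real M \<le> 2 powr (\<gamma> * real (log2_floor \<gamma> M + 1))"
proof -
  define y where "y = log 2 (real M) / \<gamma>"
  have "y \<ge> 0" using assms by (simp add: y_def)
  then have e: "real (nat \<lfloor>y\<rfloor>) \<le> y" "y \<le> real (nat \<lfloor>y\<rfloor> + 1)"
  proof -
    have "real (nat \<lfloor>y\<rfloor>) = of_int \<lfloor>y\<rfloor>" using \<open>y \<ge> 0\<close> by simp
    then show "real (nat \<lfloor>y\<rfloor>) \<le> y" "y \<le> real (nat \<lfloor>y\<rfloor> + 1)" unfolding of_nat_add by linarith+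
  qed
  have M: "real M = 2 powr (\<gamma> * y)" using assms by (simp add: y_def)
  show "2 powr (\<gamma> * real (log2_floor \<gamma> M)) \<le> real M" "real M \<le> 2 powr (\<gamma> * real (log2_floor \<gamma> M + 1))"
    unfolding log2_floor_def y_def[symmetric] unfolding M
    by (intro powr_mono mult_left_mono e; use assms in simp)+
qed

lemma filterlim_log2_floor:
  assumes "\<gamma> > 0" shows "filterlim (log2_floor \<gamma>) at_top sequentially"
proof -
  have "filterlim (\<lambda>M. log 2 (real M) / \<gamma>) at_top sequentially" using assms by real_asymp
  then have "filterlim (\<lambda>M. \<lfloor>log 2 (real M) / \<gamma>\<rfloor>) at_top sequentially"
    by (rule filterlim_compose[OF filterlim_floor_sequentially])
  then show ?thesis unfolding log2_floor_def
    by (rule filterlim_compose[OF filterlim_nat_sequentially])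
qed

lemma powr_of_nat_2: "2 powr (1 * real j) = real (2 ^ j)"
  by (simp add: powr_realpow)

lemma ceiling_powr_range:
  assumes "\<gamma> > 0"
  shows "2 powr (\<gamma> * real j) \<le> real (nat \<lceil>2 powr (\<gamma> * real j)\<rceil>)"
    "real (nat \<lceil>2 powr (\<gamma> * real j)\<rceil>) \<le> 2 powr (\<gamma> * real (j + 1)) + 1"
proof -
  have "2 powr (\<gamma> * real j) \<le> 2 powr (\<gamma> * real (j + 1))" using assms by (intro powr_mono) auto
  moreover have "0 \<le> 2 powr (\<gamma> * real j)" by simp
  ultimately show "2 powr (\<gamma> * real j) \<le> real (nat \<lceil>2 powr (\<gamma> * real j)\<rceil>)"
    "real (nat \<lceil>2 powr (\<gamma> * real j)\<rceil>) \<le> 2 powr (\<gamma> * real (j + 1)) + 1" by linarith+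
qed

lemma log2_floor_1_bounds:
  assumes "M \<ge> 1" shows "2 ^ log2_floor 1 M \<le> M" "M \<le> 2 ^ (log2_floor 1 M + 1)"
  using log2_floor_bounds[of 1 M] assms unfolding powr_of_nat_2 of_nat_le_iff by auto

text \<open>Each sequence is a vanishing perturbation of a reindexing of the other: M is matched
  with the ceiling of 2^(\<gamma> j) for the block j of M, and L with 2^j for the block j of L. Both
  matchings tend to infinity, so finite and infinite limits carry over in both directions.\<close>

lemma dyadic_close_xlimit_iff:
  assumes \<gamma>: "\<gamma> > 0" and close: "\<And>\<epsilon>. \<epsilon> > 0 \<Longrightarrow> dyadic_close \<gamma> s t (\<lambda>_. \<epsilon>)"
  shows "tends_to_xlimit s l \<longleftrightarrow> tends_to_xlimit t l"
proof
  define \<phi> where "\<phi> M = nat \<lceil>2 powr (\<gamma> * real (log2_floor 1 M))\<rceil>" for M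
  have lim1: "filterlim (log2_floor 1) at_top sequentially" and lim2: "filterlim (log2_floor \<gamma>) at_top sequentially"
    using filterlim_log2_floor \<gamma> by auto
  have \<phi>: "filterlim \<phi> at_top sequentially"
  proof -
    have "filterlim (\<lambda>j::nat. 2 powr (\<gamma> * real j)) at_top sequentially" using \<gamma> by real_asymp
    then have "filterlim (\<lambda>j::nat. nat \<lfloor>2 powr (\<gamma> * real j)\<rfloor>) at_top sequentially"
      by (intro filterlim_compose[OF filterlim_nat_sequentially] filterlim_compose[OF filterlim_floor_sequentially])
    then have "filterlim (\<lambda>j::nat. nat \<lceil>2 powr (\<gamma> * real j)\<rceil>) at_top sequentially"
      by (rule filterlim_at_top_mono) (intro always_eventually allI nat_mono, linarith)
    then show ?thesis unfolding \<phi>_def by (rule filterlim_compose[OF _ lim1])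
  qed
  assume t: "tends_to_xlimit t l"
  have "(\<lambda>M. s M - t (\<phi> M)) \<longlonglongrightarrow> 0"
  proof (rule tendstoI)
    fix \<epsilon> :: real assume \<epsilon>: "\<epsilon> > 0"
    then have c: "dyadic_close \<gamma> s t (\<lambda>_. \<epsilon> / 2)" by (intro close) simp
    show "\<forall>\<^sub>F M in sequentially. dist (s M - t (\<phi> M)) 0 < \<epsilon>"
      using filterlim_iff[THEN iffD1, OF lim1, rule_format, OF c[unfolded dyadic_close_def]] eventually_ge_at_top[of 1]
    proof eventually_elim
      case (elim M)
      then have "norm (s M - t (\<phi> M)) \<le> \<epsilon> / 2"
        using log2_floor_1_bounds[of M] ceiling_powr_range[OF \<gamma>, of "log2_floor 1 M"] unfolding \<phi>_def by blast
      then show ?case using \<epsilon> by simp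
    qed
  qed
  then show "tends_to_xlimit s l" by (rule tends_to_xlimit_transfer[OF t \<phi>])
next
  define \<psi> where "\<psi> L = (2::nat) ^ log2_floor \<gamma> L" for L
  have lim2: "filterlim (log2_floor \<gamma>) at_top sequentially"
    using filterlim_log2_floor \<gamma> by auto
  have "filterlim (\<lambda>j. (2::nat) ^ j) at_top sequentially"
    by (rule filterlim_subseq) (simp add: strict_mono_def)
  then have \<psi>: "filterlim \<psi> at_top sequentially" unfolding \<psi>_def by (rule filterlim_compose[OF _ lim2])
  assume s: "tends_to_xlimit s l"
  have "(\<lambda>L. t L - s (\<psi> L)) \<longlonglongrightarrow> 0"
  proof (rule tendstoI)
    fix \<epsilon> :: real assume \<epsilon>: "\<epsilon> > 0"
    then have c: "dyadic_close \<gamma> s t (\<lambda>_. \<epsilon> / 2)" by (intro close) simp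
    show "\<forall>\<^sub>F L in sequentially. dist (t L - s (\<psi> L)) 0 < \<epsilon>"
      using filterlim_iff[THEN iffD1, OF lim2, rule_format, OF c[unfolded dyadic_close_def]] eventually_ge_at_top[of 1]
    proof eventually_elim
      case (elim L)
      have "real L \<le> 2 powr (\<gamma> * real (log2_floor \<gamma> L + 1)) + 1"
        using log2_floor_bounds(2)[OF \<gamma> elim(2)] by simp
      moreover have "2 ^ log2_floor \<gamma> L \<le> \<psi> L" "\<psi> L \<le> 2 ^ (log2_floor \<gamma> L + 1)" by (auto simp: \<psi>_def)
      ultimately have "norm (s (\<psi> L) - t L) \<le> \<epsilon> / 2"
        using elim(1) log2_floor_bounds(1)[OF \<gamma> elim(2)] by blast
      then show ?case using \<epsilon> by (simp add: norm_minus_commute)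
    qed
  qed
  then show "tends_to_xlimit t l" by (rule tends_to_xlimit_transfer[OF s \<psi>])
qed

text \<open>All s(M) of one block are close to the same value of t, hence to s(2^j), and s(2^(j+1))
  is among them. So the increments of s(2^j) are summable, and t serves only as an
  intermediary.\<close>

lemma dyadic_close_convergent:
  assumes \<gamma>: "\<gamma> > 0" and close: "dyadic_close \<gamma> s t e" and e: "summable e"
  shows "convergent s"
proof -
  define L where "L j = nat \<lceil>2 powr (\<gamma> * real j)\<rceil>" for j
  have near: "\<forall>\<^sub>F j in sequentially. \<forall>M. 2 ^ j \<le> M \<longrightarrow> M \<le> 2 ^ (j + 1) \<longrightarrow> norm (s M - s (2 ^ j)) \<le> 2 * e j"
    using close[unfolded dyadic_close_def]
  proof eventually_elim
    case (elim j)
    have *: "norm (s M - t (L j)) \<le> e j" if "2 ^ j \<le> M" "M \<le> 2 ^ (j + 1)" for M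
      using elim that ceiling_powr_range[OF \<gamma>, of j] unfolding L_def by blast
    show ?case
    proof (intro allI impI)
      fix M :: nat assume M: "2 ^ j \<le> M" "M \<le> 2 ^ (j + 1)"
      have "norm (s M - s (2 ^ j)) \<le> norm (s M - t (L j)) + norm (s (2 ^ j) - t (L j))"
        by (metis norm_triangle_ineq4 diff_diff_eq2 diff_add_cancel add_diff_eq)
      also have "\<dots> \<le> e j + e j" by (intro add_mono * M) auto
      finally show "norm (s M - s (2 ^ j)) \<le> 2 * e j" by simp
    qed
  qed
  define u where "u j = s (2 ^ j)" for j
  have "summable (\<lambda>j. u (Suc j) - u j)"
  proof (rule summable_comparison_test_ev)
    show "\<forall>\<^sub>F j in sequentially. norm (u (Suc j) - u j) \<le> 2 * e j"
      using near by eventually_elim (simp add: u_def)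
    show "summable (\<lambda>j. 2 * e j)" using e by (rule summable_mult)
  qed
  then have "(\<lambda>n. \<Sum>j<n. u (Suc j) - u j) \<longlonglongrightarrow> (\<Sum>j. u (Suc j) - u j)" by (rule summable_LIMSEQ)
  then have "(\<lambda>n. u n - u 0) \<longlonglongrightarrow> (\<Sum>j. u (Suc j) - u j)" by (simp add: sum_lessThan_telescope)
  from tendsto_add[OF this tendsto_const[of "u 0"]] obtain l where l: "u \<longlonglongrightarrow> l" by auto
  have lim1: "filterlim (log2_floor 1) at_top sequentially" using filterlim_log2_floor by auto
  have d: "(\<lambda>M. s M - u (log2_floor 1 M)) \<longlonglongrightarrow> 0"
  proof (rule Lim_null_comparison)
    show "\<forall>\<^sub>F M in sequentially. norm (s M - u (log2_floor 1 M)) \<le> 2 * e (log2_floor 1 M)"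
      using filterlim_iff[THEN iffD1, OF lim1, rule_format, OF near] eventually_ge_at_top[of 1]
      by eventually_elim (use log2_floor_1_bounds in \<open>auto simp: u_def\<close>)
    have "(\<lambda>M. e (log2_floor 1 M)) \<longlonglongrightarrow> 0" by (rule filterlim_compose[OF summable_LIMSEQ_zero[OF e] lim1])
    then show "(\<lambda>M. 2 * e (log2_floor 1 M)) \<longlonglongrightarrow> 0" using tendsto_mult_left[of _ 0 _ 2] by fastforce
  qed
  have "s \<longlonglongrightarrow> l" using tendsto_add[OF filterlim_compose[OF l lim1] d] by simp
  then show ?thesis by (rule convergentI)
qed

lemma dyadic_close_mono:
  assumes "dyadic_close \<gamma> s t e" "\<forall>\<^sub>F j in sequentially. e j \<le> e' j"
  shows "dyadic_close \<gamma> s t e'"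
  using assms unfolding dyadic_close_def by eventually_elim (blast intro: order_trans)

text \<open>On a block the radii of the tails are frozen at the lower ends, by monotonicity, and the
  orders of the kernels at the upper ends. The constants are those of M + 1 \<le> 2 * 2^j + 1 and L
  + 1 \<le> 2^\<gamma> 2^(\<gamma> j) + 2, with the summands absorbed into powers that are at least
  1.\<close>

lemma dyadic_closeI:
  assumes f: "integrable lborel f" and g: "integrable lborel (fourier f)" and c: "continuous_on UNIV f" and \<gamma>: "\<gamma> > 0"
    and e: "\<forall>\<^sub>F j in sequentially. \<forall>M L. real M + 1 \<le> 3 * 2 ^ j \<longrightarrow> real L + 1 \<le> (2 powr \<gamma> + 2) * 2 powr (\<gamma> * real j) \<longrightarrow>
        tail_int (2 ^ j) L f \<le> e1 j \<and> tail_int (2 powr (\<gamma> * real j) / 2) M (fourier f) \<le> e2 j"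
  shows "dyadic_close \<gamma> (\<lambda>N. P N f) (\<lambda>N. P N (fourier f))
    (\<lambda>j. e1 j + e2 j + (LINT x|lborel. norm (fourier f x)) * 2 powr (- \<gamma> * real j))"
  unfolding dyadic_close_def
  using e
proof eventually_elim
  case (elim j)
  show ?case
  proof (intro allI impI)
    fix M L :: nat
    assume M: "2 ^ j \<le> M" "M \<le> 2 ^ (j + 1)" and L: "2 powr (\<gamma> * real j) \<le> real L" "real L \<le> 2 powr (\<gamma> * real (j + 1)) + 1"
    have g1: "1 \<le> 2 powr (\<gamma> * real j)" using \<gamma> by (intro ge_one_powr_ge_zero) auto
    then have L1: "1 \<le> L" using L by linarith
    have "2 powr (\<gamma> * real (j + 1)) = 2 powr \<gamma> * 2 powr (\<gamma> * real j)" by (simp add: powr_add[symmetric] distrib_left)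
    then have L2: "real L + 1 \<le> (2 powr \<gamma> + 2) * 2 powr (\<gamma> * real j)"
      using L(2) g1 unfolding distrib_right by linarith
    have "real M \<le> 2 * 2 ^ j" using M(2) using of_nat_mono[OF M(2), where 'a=real] by simp
    moreover have "(1::real) \<le> 2 ^ j" by simp
    ultimately have M2: "real M + 1 \<le> 3 * 2 ^ j" by linarith
    have M1: "(2::real) ^ j \<le> real M" using M(1) using of_nat_mono[OF M(1), where 'a=real] by simp
    have "norm (P M f - P L (fourier f)) \<le> tail_int (real M) L f + tail_int (real L / 2) M (fourier f)
     + (LINT x|lborel. norm (fourier f x)) / real L"
      by (rule poisson_estimate[OF f g c L1])
    also have "\<dots> \<le> tail_int (2 ^ j) L f + tail_int (2 powr (\<gamma> * real j) / 2) M (fourier f)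
       + (LINT x|lborel. norm (fourier f x)) / 2 powr (\<gamma> * real j)"
    proof (intro add_mono tail_int_antimono f g divide_left_mono M1)
      show "0 \<le> (LINT x|lborel. norm (fourier f x))" by simp
    qed (use L(1) g1 L1 in auto)
    also have "\<dots> \<le> e1 j + e2 j + (LINT x|lborel. norm (fourier f x)) * 2 powr (- \<gamma> * real j)"
    proof -
      have "tail_int (2 ^ j) L f \<le> e1 j" "tail_int (2 powr (\<gamma> * real j) / 2) M (fourier f) \<le> e2 j"
        using elim M2 L2 by blast+
      moreover have "2 powr (- \<gamma> * real j) = inverse (2 powr (\<gamma> * real j))"
        by (simp add: powr_minus)
      then have "(LINT x|lborel. norm (fourier f x)) / 2 powr (\<gamma> * real j) = (LINT x|lborel. norm (fourier f x)) * 2 powr (- \<gamma> * real j)"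
        by (simp only: divide_inverse)
      ultimately show ?thesis by linarith
    qed
    finally show "norm (P M f - P L (fourier f)) \<le> e1 j + e2 j + (LINT x|lborel. norm (fourier f x)) * 2 powr (- \<gamma> * real j)" .
  qed
qed

text \<open>The exponents \<gamma>/p - A and 1/q - \<gamma> B are what has to be nonpositive; for B
  > 0 they leave the window 1/(q B) \<le> \<gamma> \<le> A p.\<close>

lemma scale_bounds:
  assumes "p \<ge> (1::real)" "q \<ge> 1" and \<gamma>: "\<gamma> > 0"
    and M: "real M + 1 \<le> 3 * 2 ^ j" and L: "real L + 1 \<le> (2 powr \<gamma> + 2) * 2 powr (\<gamma> * real j)"
  shows "(real L + 1) powr (1 / p) * (2 ^ j) powr (- A) \<le> (2 powr \<gamma> + 2) powr (1 / p) * 2 powr ((\<gamma> / p - A) * real j)"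
    and "(real M + 1) powr (1 / q) * (2 powr (\<gamma> * real j) / 2) powr (- B) \<le> 3 powr (1 / q) * 2 powr B * 2 powr ((1 / q - \<gamma> * B) * real j)"
proof -
  have t: "(2::real) ^ j = 2 powr real j" by (simp add: powr_realpow)
  have "(real L + 1) powr (1 / p) * (2 ^ j) powr (- A) \<le> ((2 powr \<gamma> + 2) * 2 powr (\<gamma> * real j)) powr (1 / p) * (2 ^ j) powr (- A)"
    using L assms by (intro mult_right_mono powr_mono2) auto
  also have "\<dots> = (2 powr \<gamma> + 2) powr (1 / p) * (2 powr (\<gamma> * real j / p) * 2 powr (- (A * real j)))"
    unfolding t by (simp add: powr_mult powr_powr mult_ac)
  also have "2 powr (\<gamma> * real j / p) * 2 powr (- (A * real j)) = 2 powr ((\<gamma> / p - A) * real j)"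
    unfolding powr_add[symmetric] by (rule arg_cong[where f="(powr) 2"]) (simp add: algebra_simps)
  finally show "(real L + 1) powr (1 / p) * (2 ^ j) powr (- A) \<le> (2 powr \<gamma> + 2) powr (1 / p) * 2 powr ((\<gamma> / p - A) * real j)" .
  have "(real M + 1) powr (1 / q) * (2 powr (\<gamma> * real j) / 2) powr (- B) \<le> (3 * 2 ^ j) powr (1 / q) * (2 powr (\<gamma> * real j) / 2) powr (- B)"
    using M assms by (intro mult_right_mono powr_mono2) auto
  also have "\<dots> = 3 powr (1 / q) * 2 powr B * (2 powr (real j / q) * 2 powr (- (\<gamma> * real j * B)))"
  proof -
    have "(3 * 2 ^ j) powr (1 / q) = 3 powr (1 / q) * 2 powr (real j / q)"
      unfolding t by (simp add: powr_mult powr_powr)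
    moreover have "(2 powr (\<gamma> * real j) / 2) powr (- B) = 2 powr B * 2 powr (- (\<gamma> * real j * B))"
    proof -
      have "2 powr (\<gamma> * real j) / 2 = 2 powr (\<gamma> * real j - 1)" by (simp add: powr_diff)
      moreover have "(\<gamma> * real j - 1) * (- B) = B + - (\<gamma> * real j * B)" by (simp add: algebra_simps)
      ultimately show ?thesis by (simp only: powr_powr powr_add)
    qed
    ultimately show ?thesis by (simp only: mult_ac)
  qed
  also have "2 powr (real j / q) * 2 powr (- (\<gamma> * real j * B)) = 2 powr ((1 / q - \<gamma> * B) * real j)"
    unfolding powr_add[symmetric] by (rule arg_cong[where f="(powr) 2"]) (simp add: algebra_simps)
  finally show "(real M + 1) powr (1 / q) * (2 powr (\<gamma> * real j) / 2) powr (- B) \<le> 3 powr (1 / q) * 2 powr B * 2 powr ((1 / q - \<gamma> * B) * real j)" .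
qed

lemma summable_powr_geometric:
  fixes a \<delta> :: real
  assumes "a > 1" "\<delta> > 0" shows "summable (\<lambda>j::nat. a powr (- \<delta> * real j))"
proof -
  have "a powr (- \<delta> * real j) = (a powr (- \<delta>)) ^ j" for j
    using assms by (subst powr_realpow[symmetric]) (simp_all add: powr_powr)
  moreover have "norm (a powr (- \<delta>)) < 1" using assms by (simp add: powr_less_one)
  ultimately show ?thesis by (simp add: summable_geometric)
qed

lemma summable_2_powr: "\<delta> > 0 \<Longrightarrow> summable (\<lambda>j::nat. 2 powr (- \<delta> * real j))"
  by (rule summable_powr_geometric) auto

lemma summable_4_powr: "\<delta> > 0 \<Longrightarrow> summable (\<lambda>j::nat. 4 powr (- \<delta> * real j))"
  by (rule summable_powr_geometric) auto

text \<open>Covers the critical and the supercritical range alike, but without any rate: it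
  identifies limits and does not assert that they exist.\<close>

lemma poisson_critical:
  assumes f: "integrable lborel f" and g: "integrable lborel (fourier f)" and c: "continuous_on UNIV f"
    and p: "p \<ge> 1" and q: "q \<ge> 1" and A: "A > 0" and B: "B > 0" and AB: "A * B \<ge> 1 / (p * q)"
    and wf: "integrable lborel (weight_tail p A f 1)" and wg: "integrable lborel (weight_tail q B (fourier f) 1)"
  shows "tends_to_xlimit (\<lambda>N. P N f) l \<longleftrightarrow> tends_to_xlimit (\<lambda>N. P N (fourier f)) l"
proof (rule dyadic_close_xlimit_iff)
  define \<gamma> where "\<gamma> = A * p"
  show \<gamma>: "A * p > 0" using A p by simp
  have fm: "f \<in> borel_measurable borel" "fourier f \<in> borel_measurable borel" using f g by auto
  fix \<epsilon> :: real assume \<epsilon>: "\<epsilon> > 0"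
  \<comment> \<open>\<gamma> = A p is the upper end of the window: the tail of \<open>f\<close>
    stays exactly at its critical scale, and the hypothesis on A B makes the other exponent
    nonpositive.\<close>
  have g1: "\<gamma> / p - A = 0" using p by (simp add: \<gamma>_def)
  have "1 / q \<le> p * (A * B)" using mult_left_mono[OF AB, of p] p by (simp add: field_simps)
  then have g2: "1 / q - \<gamma> * B \<le> 0" by (simp add: \<gamma>_def mult_ac)
  define K1 where "K1 = (2 powr \<gamma> + 2) powr (1 / p)"
  define K2 where "K2 = 3 powr (1 / q) * 2 powr B"
  have "2 powr \<gamma> + 2 > 0" by (intro add_nonneg_pos) auto
  then have K: "K1 > 0" "K2 > 0" unfolding K1_def K2_def by simp_all
  obtain R1 where R1: "R1 \<ge> 1" "\<And>N R. R \<ge> R1 \<Longrightarrow> (real N + 1) powr (1 / p) * R powr (- A) \<le> K1 \<Longrightarrow> tail_int R N f \<le> \<epsilon> / 3"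
    using tail_int_small[OF p wf fm(1) A K(1), of "\<epsilon> / 3"] \<epsilon> by auto
  obtain R2 where R2: "R2 \<ge> 1" "\<And>N R. R \<ge> R2 \<Longrightarrow> (real N + 1) powr (1 / q) * R powr (- B) \<le> K2 \<Longrightarrow> tail_int R N (fourier f) \<le> \<epsilon> / 3"
    using tail_int_small[OF q wg fm(2) B K(2), of "\<epsilon> / 3"] \<epsilon> by auto
  have "filterlim (\<lambda>j::nat. (2::real) ^ j) at_top sequentially" by real_asymp
  then have ev1: "\<forall>\<^sub>F j in sequentially. R1 \<le> 2 ^ j" by (simp add: filterlim_at_top)
  have "filterlim (\<lambda>j::nat. 2 powr (\<gamma> * real j) / 2) at_top sequentially" using \<gamma> unfolding \<gamma>_def[symmetric] by real_asymp
  then have ev2: "\<forall>\<^sub>F j in sequentially. R2 \<le> 2 powr (\<gamma> * real j) / 2" by (simp add: filterlim_at_top)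
  define I where "I = (LINT x|lborel. norm (fourier f x))"
  have "(\<lambda>j. I * 2 powr (- \<gamma> * real j)) \<longlonglongrightarrow> I * 0"
    using summable_LIMSEQ_zero[OF summable_2_powr[of \<gamma>]] \<gamma> unfolding \<gamma>_def by (intro tendsto_mult tendsto_const) auto
  then have ev3: "\<forall>\<^sub>F j in sequentially. I * 2 powr (- \<gamma> * real j) < \<epsilon> / 3"
    by (rule order_tendstoD(2)) (use \<epsilon> in simp)
  have "dyadic_close \<gamma> (\<lambda>N. P N f) (\<lambda>N. P N (fourier f)) (\<lambda>j. \<epsilon> / 3 + \<epsilon> / 3 + I * 2 powr (- \<gamma> * real j))"
    unfolding I_def
  proof (rule dyadic_closeI[OF f g c])
    show "\<gamma> > 0" using \<gamma> by (simp add: \<gamma>_def)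
    show "\<forall>\<^sub>F j in sequentially. \<forall>M L. real M + 1 \<le> 3 * 2 ^ j \<longrightarrow> real L + 1 \<le> (2 powr \<gamma> + 2) * 2 powr (\<gamma> * real j) \<longrightarrow>
        tail_int (2 ^ j) L f \<le> \<epsilon> / 3 \<and> tail_int (2 powr (\<gamma> * real j) / 2) M (fourier f) \<le> \<epsilon> / 3"
      using ev1 ev2
    proof eventually_elim
      case (elim j)
      show ?case
      proof (intro allI impI conjI)
        fix M L :: nat
        assume M: "real M + 1 \<le> 3 * 2 ^ j" and L: "real L + 1 \<le> (2 powr \<gamma> + 2) * 2 powr (\<gamma> * real j)"
        note sb = scale_bounds[OF p q _ M L]
        have "(real L + 1) powr (1 / p) * (2 ^ j) powr (- A) \<le> K1"
          using sb(1)[of A] \<gamma> unfolding g1 K1_def \<gamma>_def[symmetric] by simp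
        then show "tail_int (2 ^ j) L f \<le> \<epsilon> / 3" by (rule R1(2)[OF elim(1)])
        have "2 powr ((1 / q - \<gamma> * B) * real j) \<le> 2 powr 0"
          using g2 by (intro powr_mono) (auto simp: mult_nonpos_nonneg)
        then have "K2 * 2 powr ((1 / q - \<gamma> * B) * real j) \<le> K2"
          using K by (simp add: mult_left_le)
        then have "(real M + 1) powr (1 / q) * (2 powr (\<gamma> * real j) / 2) powr (- B) \<le> K2"
          using sb(2)[of B] \<gamma> unfolding K2_def \<gamma>_def[symmetric] by linarith
        then show "tail_int (2 powr (\<gamma> * real j) / 2) M (fourier f) \<le> \<epsilon> / 3" by (rule R2(2)[OF elim(2)])
      qed
    qed
  qed
  then show "dyadic_close (A * p) (\<lambda>N. P N f) (\<lambda>N. P N (fourier f)) (\<lambda>_. \<epsilon>)"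
    unfolding \<gamma>_def[symmetric]
    by (rule dyadic_close_mono) (use ev3 in eventually_elim, simp)
qed

text \<open>With \<gamma> strictly inside the window both exponents are negative, so the square-root
  bounds of the tails form geometric series in j.\<close>

lemma poisson_supercritical_convergent:
  assumes f: "integrable lborel f" and g: "integrable lborel (fourier f)" and c: "continuous_on UNIV f"
    and p: "p \<ge> 1" and q: "q \<ge> 1" and A: "A > 0" and B: "B > 0" and AB: "A * B > 1 / (p * q)"
    and wf: "integrable lborel (weight_tail p A f 1)" and wg: "integrable lborel (weight_tail q B (fourier f) 1)"
  shows "convergent (\<lambda>N. P N f)"
proof -
  have fm: "f \<in> borel_measurable borel" "fourier f \<in> borel_measurable borel" using f g by auto
  have "1 / (q * B) < A * p" using AB A B p q by (simp add: field_simps)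
  then obtain \<gamma> where \<gamma>: "1 / (q * B) < \<gamma>" "\<gamma> < A * p" using dense by blast
  have \<gamma>0: "\<gamma> > 0" using \<gamma>(1) q B by (smt (verit) divide_pos_pos mult_pos_pos)
  define \<delta>1 where "\<delta>1 = A - \<gamma> / p"
  define \<delta>2 where "\<delta>2 = \<gamma> * B - 1 / q"
  have d1: "\<delta>1 > 0" using \<gamma> p by (simp add: \<delta>1_def field_simps)
  have d2: "\<delta>2 > 0" using \<gamma> q B by (simp add: \<delta>2_def field_simps)
  define K1 where "K1 = (2 powr \<gamma> + 2) powr (1 / p)"
  define K2 where "K2 = 3 powr (1 / q) * 2 powr B"
  have "2 powr \<gamma> + 2 > 0" by (intro add_nonneg_pos) auto
  then have K: "K1 > 0" "K2 > 0" unfolding K1_def K2_def by simp_all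
  obtain C1 where C1: "C1 \<ge> 0" "\<And>N R. R \<ge> 1 \<Longrightarrow> (real N + 1) powr (1 / p) * R powr (- A) \<le> 1 \<Longrightarrow>
      tail_int R N f \<le> C1 * sqrt ((real N + 1) powr (1 / p) * R powr (- A))"
    using tail_int_le_sqrt[OF p wf fm(1) A] by blast
  obtain C2 where C2: "C2 \<ge> 0" "\<And>N R. R \<ge> 1 \<Longrightarrow> (real N + 1) powr (1 / q) * R powr (- B) \<le> 1 \<Longrightarrow>
      tail_int R N (fourier f) \<le> C2 * sqrt ((real N + 1) powr (1 / q) * R powr (- B))"
    using tail_int_le_sqrt[OF q wg fm(2) B] by blast
  have half: "sqrt (2 powr (- \<delta> * real j)) = 2 powr (- (\<delta> / 2) * real j)" for \<delta> j
    by (simp add: powr_half_sqrt[symmetric] powr_powr)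
  define e1 where "e1 j = C1 * sqrt K1 * 2 powr (- (\<delta>1 / 2) * real j)" for j :: nat
  define e2 where "e2 j = C2 * sqrt K2 * 2 powr (- (\<delta>2 / 2) * real j)" for j :: nat
  define I where "I = (LINT x|lborel. norm (fourier f x))"
  have "(\<lambda>j. K1 * 2 powr (- \<delta>1 * real j)) \<longlonglongrightarrow> K1 * 0"
    by (intro tendsto_mult tendsto_const summable_LIMSEQ_zero summable_2_powr d1)
  then have ev1: "\<forall>\<^sub>F j in sequentially. K1 * 2 powr (- \<delta>1 * real j) < 1" by (rule order_tendstoD(2)) simp
  have "(\<lambda>j. K2 * 2 powr (- \<delta>2 * real j)) \<longlonglongrightarrow> K2 * 0"
    by (intro tendsto_mult tendsto_const summable_LIMSEQ_zero summable_2_powr d2)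
  then have ev2: "\<forall>\<^sub>F j in sequentially. K2 * 2 powr (- \<delta>2 * real j) < 1" by (rule order_tendstoD(2)) simp
  have "filterlim (\<lambda>j::nat. 2 powr (\<gamma> * real j) / 2) at_top sequentially" using \<gamma>0 by real_asymp
  then have ev3: "\<forall>\<^sub>F j in sequentially. 1 \<le> 2 powr (\<gamma> * real j) / 2" unfolding filterlim_at_top by blast
  have "dyadic_close \<gamma> (\<lambda>N. P N f) (\<lambda>N. P N (fourier f)) (\<lambda>j. e1 j + e2 j + I * 2 powr (- \<gamma> * real j))"
    unfolding I_def
  proof (rule dyadic_closeI[OF f g c \<gamma>0])
    show "\<forall>\<^sub>F j in sequentially. \<forall>M L. real M + 1 \<le> 3 * 2 ^ j \<longrightarrow> real L + 1 \<le> (2 powr \<gamma> + 2) * 2 powr (\<gamma> * real j) \<longrightarrow>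
        tail_int (2 ^ j) L f \<le> e1 j \<and> tail_int (2 powr (\<gamma> * real j) / 2) M (fourier f) \<le> e2 j"
      using ev1 ev2 ev3
    proof eventually_elim
      case (elim j)
      show ?case
      proof (intro allI impI conjI)
        fix M L :: nat
        assume M: "real M + 1 \<le> 3 * 2 ^ j" and L: "real L + 1 \<le> (2 powr \<gamma> + 2) * 2 powr (\<gamma> * real j)"
        note sb = scale_bounds[OF p q \<gamma>0 M L]
        have x1: "(real L + 1) powr (1 / p) * (2 ^ j) powr (- A) \<le> K1 * 2 powr (- \<delta>1 * real j)"
          using sb(1)[of A] unfolding K1_def \<delta>1_def by simp
        have "tail_int (2 ^ j) L f \<le> C1 * sqrt ((real L + 1) powr (1 / p) * (2 ^ j) powr (- A))"
          by (rule C1(2)) (use x1 elim(1) in auto)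
        also have "\<dots> \<le> C1 * sqrt (K1 * 2 powr (- \<delta>1 * real j))"
          using x1 C1 by (intro mult_left_mono real_sqrt_le_mono) auto
        also have "\<dots> = e1 j" unfolding real_sqrt_mult half e1_def by simp
        finally show "tail_int (2 ^ j) L f \<le> e1 j" .
        have x2: "(real M + 1) powr (1 / q) * (2 powr (\<gamma> * real j) / 2) powr (- B) \<le> K2 * 2 powr (- \<delta>2 * real j)"
          using sb(2)[of B] unfolding K2_def \<delta>2_def by simp
        have "tail_int (2 powr (\<gamma> * real j) / 2) M (fourier f) \<le> C2 * sqrt ((real M + 1) powr (1 / q) * (2 powr (\<gamma> * real j) / 2) powr (- B))"
          by (rule C2(2)[OF elim(3)]) (use x2 elim(2) in linarith)
        also have "\<dots> \<le> C2 * sqrt (K2 * 2 powr (- \<delta>2 * real j))"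
          using x2 C2 by (intro mult_left_mono real_sqrt_le_mono) auto
        also have "\<dots> = e2 j" unfolding real_sqrt_mult half e2_def by simp
        finally show "tail_int (2 powr (\<gamma> * real j) / 2) M (fourier f) \<le> e2 j" .
      qed
    qed
  qed
  moreover have "summable (\<lambda>j. e1 j + e2 j + I * 2 powr (- \<gamma> * real j))"
    unfolding e1_def e2_def using d1 d2 \<gamma>0
    by (intro summable_add summable_mult summable_2_powr) auto
  ultimately show ?thesis by (rule dyadic_close_convergent[OF \<gamma>0])
qed

section \<open>The critical case p = q = 1\<close>

lemma sum_powr_dyadic_le:
  assumes a: "a > (1::real)" and s: "s > 0" and y: "y \<ge> 0"
  shows "(\<Sum>j<n. (a ^ j) powr s * (if a ^ j \<le> y then 1 else 0)) \<le> a powr s / (a powr s - 1) * y powr s"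
proof (induction n)
  case 0
  have "a powr s > 1" using a s by simp
  then show ?case by simp
next
  case (Suc n)
  have b: "a powr s > 1" using a s by simp
  have pw: "(a ^ j) powr s = (a powr s) ^ j" for j
  proof -
    have "(a ^ j) powr s = a powr (real j * s)" using a by (simp only: powr_powr flip: powr_realpow)
    also have "\<dots> = (a powr s) powr real j" by (simp add: powr_powr mult.commute)
    finally show ?thesis using a by (simp add: powr_realpow)
  qed
  show ?case
  proof (cases "a ^ n \<le> y")
    case True
    have "(\<Sum>j<Suc n. (a ^ j) powr s * (if a ^ j \<le> y then 1 else 0)) \<le> (\<Sum>j<Suc n. (a powr s) ^ j)"
      by (intro sum_mono) (auto simp: pw)
    also have "\<dots> = ((a powr s) ^ Suc n - 1) / (a powr s - 1)" using b by (intro geometric_sum) auto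
    also have "\<dots> \<le> (a powr s) ^ Suc n / (a powr s - 1)" using b by (intro divide_right_mono) auto
    also have "\<dots> = a powr s / (a powr s - 1) * (a ^ n) powr s" by (simp add: pw)
    also have "\<dots> \<le> a powr s / (a powr s - 1) * y powr s"
    proof (rule mult_left_mono)
      show "(a ^ n) powr s \<le> y powr s" using True a s by (intro powr_mono2) auto
      show "0 \<le> a powr s / (a powr s - 1)" using b by (intro divide_nonneg_nonneg) linarith+
    qed
    finally show ?thesis .
  qed (use Suc in simp)
qed

text \<open>Exchange of sum and integral: a point x is counted with weight a^(j s) for each j with c
  a^j \<le> |x|. This geometric sum is comparable to its last term, so the total weight is O(|x|^s),
  which the weighted norm controls.\<close>

lemma summable_dyadic_tails:
  assumes gi: "integrable lborel g" and w: "integrable lborel (weight_tail 1 s g 1)" and a: "a > 1" and s: "s > 0" and c: "c > 0"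
  shows "summable (\<lambda>j. (a ^ j) powr s * (LINT x|lborel. indicator {x. c * a ^ j \<le> \<bar>x\<bar>} x * norm (g x)))"
proof (rule summableI_nonneg_bounded)
  have [measurable]: "g \<in> borel_measurable borel" using gi by auto
  define D where "D = a powr s / (a powr s - 1) * (1 / c) powr s"
  have "a powr s > 1" using a s by simp
  then have D: "D \<ge> 0" by (simp add: D_def)
  have ii: "integrable lborel (\<lambda>x. indicator {x. c * a ^ j \<le> \<bar>x\<bar>} x * norm (g x))" for j
    by (rule Bochner_Integration.integrable_bound[OF gi]) (auto split: split_indicator)
  show "0 \<le> (a ^ j) powr s * (LINT x|lborel. indicator {x. c * a ^ j \<le> \<bar>x\<bar>} x * norm (g x))" for j
    by (intro mult_nonneg_nonneg Bochner_Integration.integral_nonneg) auto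
  fix n
  have "(\<Sum>j<n. (a ^ j) powr s * (LINT x|lborel. indicator {x. c * a ^ j \<le> \<bar>x\<bar>} x * norm (g x)))
      = (LINT x|lborel. (\<Sum>j<n. (a ^ j) powr s * (indicator {x. c * a ^ j \<le> \<bar>x\<bar>} x * norm (g x))))"
    using ii by (subst Bochner_Integration.integral_sum) auto
  also have "\<dots> \<le> (LINT x|lborel. D * (norm (g x) + weight_tail 1 s g 1 x))"
  proof (rule integral_mono')
    fix x :: real
    have "(\<Sum>j<n. (a ^ j) powr s * (indicator {x. c * a ^ j \<le> \<bar>x\<bar>} x * norm (g x)))
        = norm (g x) * (\<Sum>j<n. (a ^ j) powr s * (if a ^ j \<le> \<bar>x\<bar> / c then 1 else 0))"
      unfolding sum_distrib_left using c
      by (intro sum.cong refl) (auto simp: field_simps split: split_indicator)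
    also have "\<dots> \<le> norm (g x) * (a powr s / (a powr s - 1) * (\<bar>x\<bar> / c) powr s)"
      by (intro mult_left_mono sum_powr_dyadic_le a s) (use c in auto)
    also have "\<dots> = D * (norm (g x) * \<bar>x\<bar> powr s)"
    proof -
      have "(\<bar>x\<bar> / c) powr s = \<bar>x\<bar> powr s * (1 / c) powr s" using c by (simp add: powr_mult[symmetric])
      then show ?thesis by (simp add: D_def mult_ac)
    qed
    also have "norm (g x) * \<bar>x\<bar> powr s \<le> norm (g x) + weight_tail 1 s g 1 x"
    proof (cases "\<bar>x\<bar> \<ge> 1")
      case False
      then have "\<bar>x\<bar> powr s \<le> 1" using s by (intro powr_le1) auto
      then have "norm (g x) * \<bar>x\<bar> powr s \<le> norm (g x)" by (intro mult_left_le) auto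
      then show ?thesis using weight_tail_nonneg[of 1 s g 1 x] by linarith
    qed (simp add: weight_tail_def)
    finally show "(\<Sum>j<n. (a ^ j) powr s * (indicator {x. c * a ^ j \<le> \<bar>x\<bar>} x * norm (g x))) \<le> D * (norm (g x) + weight_tail 1 s g 1 x)"
      using D by (simp add: mult_left_mono)
    show "0 \<le> D * (norm (g x) + weight_tail 1 s g 1 x)" using D weight_tail_nonneg[of 1 s g 1 x] by simp
  qed (use gi w in auto)
  finally show "(\<Sum>j<n. (a ^ j) powr s * (LINT x|lborel. indicator {x. c * a ^ j \<le> \<bar>x\<bar>} x * norm (g x)))
     \<le> (LINT x|lborel. D * (norm (g x) + weight_tail 1 s g 1 x))" .
qed

lemma tail_int_le_L1:
  assumes "integrable lborel g"
  shows "tail_int R N g \<le> (2 * real N + 1) * (LINT x|lborel. indicator {x. R \<le> \<bar>x\<bar>} x * norm (g x))"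
proof -
  have [measurable]: "g \<in> borel_measurable borel" using assms by auto
  have i: "integrable lborel (\<lambda>x. indicator {x. R \<le> \<bar>x\<bar>} x * norm (g x))"
    by (rule Bochner_Integration.integrable_bound[OF assms]) (auto split: split_indicator)
  have "tail_int R N g \<le> (LINT x|lborel. (2 * real N + 1) * (indicator {x. R \<le> \<bar>x\<bar>} x * norm (g x)))"
    unfolding tail_int_def
  proof (rule integral_mono')
    fix x :: real
    show "indicator {x. R \<le> \<bar>x\<bar>} x * (norm (g x) * \<bar>dirichlet_kernel N x\<bar>) \<le> (2 * real N + 1) * (indicator {x. R \<le> \<bar>x\<bar>} x * norm (g x))"
      using mult_left_mono[OF abs_dirichlet_kernel_le[of N x], of "norm (g x)"] by (auto simp: mult.commute split: split_indicator)
  qed (use i in auto)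
  then show ?thesis by simp
qed

text \<open>Only the maximum of the kernel is used, and it is of the order of the weight at the same
  scale: L is about 2^(A j) for the tail of \<open>f\<close> beyond 2^j, and M is about 2^j = 2^(A j
  B) for the tail of the transform, because A B = 1. The errors are therefore the summable dyadic
  tails, although no power is gained.\<close>

lemma poisson_L1_convergent:
  assumes f: "integrable lborel f" and g: "integrable lborel (fourier f)" and c: "continuous_on UNIV f"
    and A: "A > 0" and B: "B > 0" and AB: "A * B = 1"
    and wf: "integrable lborel (weight_tail 1 A f 1)" and wg: "integrable lborel (weight_tail 1 B (fourier f) 1)"
  shows "convergent (\<lambda>N. P N f)"
proof -
  have t: "(2::real) ^ j = 2 powr real j" for j by (simp add: powr_realpow)
  define T1 where "T1 j = (2 ^ j) powr A * (LINT x|lborel. indicator {x. 1 * 2 ^ j \<le> \<bar>x\<bar>} x * norm (f x))" for j :: nat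
  define T2 where "T2 j = ((2 powr A) ^ j) powr B * (LINT x|lborel. indicator {x. 1/2 * (2 powr A) ^ j \<le> \<bar>x\<bar>} x * norm (fourier f x))" for j :: nat
  have s1: "summable T1" unfolding T1_def by (rule summable_dyadic_tails[OF f wf _ A]) auto
  have s2: "summable T2" unfolding T2_def by (rule summable_dyadic_tails[OF g wg _ B]) (use A in auto)
  define K where "K = 2 * (2 powr A + 2)"
  define I where "I = (LINT x|lborel. norm (fourier f x))"
  have "dyadic_close A (\<lambda>N. P N f) (\<lambda>N. P N (fourier f)) (\<lambda>j. K * T1 j + 6 * T2 j + I * 2 powr (- A * real j))"
    unfolding I_def
  proof (rule dyadic_closeI[OF f g c A], intro always_eventually allI impI conjI)
    fix j M L :: nat
    assume M: "real M + 1 \<le> 3 * 2 ^ j" and L: "real L + 1 \<le> (2 powr A + 2) * 2 powr (A * real j)"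
    have "tail_int (2 ^ j) L f \<le> (2 * real L + 1) * (LINT x|lborel. indicator {x. 2 ^ j \<le> \<bar>x\<bar>} x * norm (f x))"
      by (rule tail_int_le_L1[OF f])
    also have "\<dots> \<le> (K * (2 ^ j) powr A) * (LINT x|lborel. indicator {x. 2 ^ j \<le> \<bar>x\<bar>} x * norm (f x))"
      using L by (intro mult_right_mono Bochner_Integration.integral_nonneg) (auto simp: K_def t powr_powr mult_ac algebra_simps)
    also have "\<dots> = K * T1 j" by (simp add: T1_def)
    finally show "tail_int (2 ^ j) L f \<le> K * T1 j" .
    have e: "(2 powr A) ^ j = 2 powr (A * real j)" by (subst powr_realpow[symmetric]) (simp_all add: powr_powr)
    have e': "(2 powr (A * real j)) powr B = 2 ^ j" 
    proof -
      have "A * real j * B = (A * B) * real j" by (simp add: mult_ac)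
      then show ?thesis using AB unfolding t powr_powr by (simp only: mult_1)
    qed
    have "tail_int (2 powr (A * real j) / 2) M (fourier f) \<le> (2 * real M + 1) * (LINT x|lborel. indicator {x. 2 powr (A * real j) / 2 \<le> \<bar>x\<bar>} x * norm (fourier f x))"
      by (rule tail_int_le_L1[OF g])
    also have "\<dots> \<le> (6 * 2 ^ j) * (LINT x|lborel. indicator {x. 2 powr (A * real j) / 2 \<le> \<bar>x\<bar>} x * norm (fourier f x))"
      using M by (intro mult_right_mono Bochner_Integration.integral_nonneg) auto
    also have "\<dots> = 6 * T2 j" unfolding T2_def e e' by simp
    finally show "tail_int (2 powr (A * real j) / 2) M (fourier f) \<le> 6 * T2 j" .
  qed
  moreover have "summable (\<lambda>j. K * T1 j + 6 * T2 j + I * 2 powr (- A * real j))"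
    by (intro summable_add summable_mult s1 s2 summable_2_powr A)
  ultimately show ?thesis by (rule dyadic_close_convergent[OF A])
qed

section \<open>Bumps and combs\<close>

text \<open>A polynomial profile instead of a smooth cut-off: only a prescribed finite order of
  decay of the transform is required, and the transforms for successive m are linked by a
  recurrence.\<close>

definition bump :: "nat \<Rightarrow> real \<Rightarrow> real" where
  "bump m x = (if \<bar>x\<bar> \<le> 1 then (1 - x\<^sup>2) ^ m else 0)"

lemma bump_bounds: "0 \<le> bump m x" "bump m x \<le> 1"
  by (auto simp: bump_def abs_square_le_1 intro!: power_le_one)

lemma bump_measurable [measurable]: "bump m \<in> borel_measurable borel"
  unfolding bump_def by measurable

lemma bump_eq_0: "m \<ge> 1 \<Longrightarrow> \<bar>x\<bar> \<ge> 1 \<Longrightarrow> bump m x = 0"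
  by (auto simp: bump_def abs_square_eq_1 power2_eq_1_iff zero_power)

lemma continuous_on_bump:
  assumes "m \<ge> 1" shows "continuous_on UNIV (bump m)"
proof -
  have "bump m = (\<lambda>x. max 0 (1 - x\<^sup>2) ^ m)"
  proof
    fix x
    show "bump m x = max 0 (1 - x\<^sup>2) ^ m"
    proof (cases "\<bar>x\<bar> \<le> 1")
      case True
      then have "x\<^sup>2 \<le> 1" by (simp add: abs_square_le_1)
      with True show ?thesis by (simp add: bump_def)
    next
      case False
      then have "x\<^sup>2 > 1" using abs_square_le_1[of x] by simp
      with False assms show ?thesis by (simp add: bump_def)
    qed
  qed
  then show ?thesis by (simp only:) (intro continuous_intros)
qed

lemma bump_le_indicator: "bump m x \<le> indicator {-1..1} x"
  using bump_bounds[of m x] by (auto simp: bump_def split: split_indicator)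

lemma bump_integrable: "integrable lborel (bump m)"
proof (rule Bochner_Integration.integrable_bound)
  show "integrable lborel (\<lambda>x. indicator {-1..1::real} x :: real)"
    by (intro integrable_real_indicator) (auto simp: emeasure_lborel_Icc_eq)
qed (use bump_le_indicator bump_bounds in \<open>auto intro!: AE_I2\<close>)

lemma bump_integral_le: "(LINT x|lborel. bump m x) \<le> 2"
proof -
  have "(LINT x|lborel. bump m x) \<le> (LINT x|lborel. indicator {-1..1::real} x)"
    by (rule integral_mono[OF bump_integrable])
       (auto intro!: integrable_real_indicator bump_le_indicator simp: emeasure_lborel_Icc_eq)
  then show ?thesis by simp
qed

definition bump_hat :: "nat \<Rightarrow> real \<Rightarrow> complex" where
  "bump_hat m = fourier (\<lambda>x. of_real (bump m x))"

lemma norm_bump_hat_le: "norm (bump_hat m \<xi>) \<le> 2"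
proof -
  have "norm (bump_hat m \<xi>) \<le> (LINT x|lborel. norm (complex_of_real (bump m x)))"
    unfolding bump_hat_def by (rule norm_fourier_le) (use bump_integrable in \<open>auto intro: integrable_of_real\<close>)
  also have "\<dots> = (LINT x|lborel. bump m x)" by (simp add: bump_bounds)
  finally show ?thesis using bump_integral_le[of m] by simp
qed

lemma continuous_on_bump_hat: "continuous_on UNIV (bump_hat m)"
  unfolding bump_hat_def by (rule continuous_on_fourier) (use bump_integrable in \<open>auto intro: integrable_of_real\<close>)

lemma bump_hat_measurable [measurable]: "bump_hat m \<in> borel_measurable borel"
  by (rule borel_measurable_continuous_onI[OF continuous_on_bump_hat])

lemma bump_hat_eq:
  "bump_hat m \<xi> = (LINT x|lborel. indicator {-1..1} x *\<^sub>R ((1 - (of_real x)\<^sup>2) ^ m * exp (- (2 * of_real pi * \<i> * of_real \<xi>) * of_real x)))"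
proof -
  have "bump_hat m \<xi> = (LINT x|lborel. of_real (bump m x) * cis (- (2 * pi * x * \<xi>)))"
    unfolding bump_hat_def by (rule fourier_lborel) measurable
  also have "\<dots> = (LINT x|lborel. indicator {-1..1} x *\<^sub>R ((1 - (of_real x)\<^sup>2) ^ m * exp (- (2 * of_real pi * \<i> * of_real \<xi>) * of_real x)))"
    by (intro Bochner_Integration.integral_cong refl)
       (auto simp: bump_def cis_conv_exp mult_ac split: split_indicator)
  finally show ?thesis .
qed

text \<open>Two integrations by parts; with \<open>u = 1 - x\<^sup>2\<close> the second derivative of \<open>u\<^sup>n\<^sup>+\<^sup>2\<close>
  is a combination of \<open>u\<^sup>n\<close> and \<open>u\<^sup>n\<^sup>+\<^sup>1\<close>.\<close>
lemma bump_hat_recurrence: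
  fixes n :: nat
  defines "k \<equiv> of_nat (n + 2) :: complex"
  shows "(2 * of_real pi * \<i> * of_real \<xi>)\<^sup>2 * bump_hat (n + 2) \<xi>
    = 4 * k * (k - 1) * bump_hat n \<xi> - (2 * k + 4 * k * (k - 1)) * bump_hat (n + 1) \<xi>"
proof -
  define c where "c = 2 * of_real pi * \<i> * complex_of_real \<xi>"
  define e where "e m x = (1 - (of_real x)\<^sup>2) ^ m * exp (- c * of_real x)" for m and x :: real
  have bh: "bump_hat m \<xi> = (LINT x|lborel. indicator {-1..1} x *\<^sub>R e m x)" for m
    unfolding bump_hat_eq e_def c_def by simp
  have ec: "continuous_on S (e m)" for S m unfolding e_def by (intro continuous_intros)
  have ei: "integrable lborel (\<lambda>x. indicator {-1..1} x *\<^sub>R e m x)" for m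
    using borel_integrable_atLeastAtMost'[OF ec] by (simp add: set_integrable_def)
  \<comment> \<open>With w = (1 - z^2)^(n+2) this is (w' + c w) exp(-c z), whose derivative is (w''
    - c^2 w) exp(-c z). Both w and w' vanish at 1 and -1, so no boundary terms remain.\<close>
  define F where "F z = (- 2 * k * z * (1 - z\<^sup>2) ^ (n + 1) + c * (1 - z\<^sup>2) ^ (n + 2)) * exp (- c * z)" for z :: complex
  define G where "G x = 4 * k * (k - 1) * e n x - (2 * k + 4 * k * (k - 1)) * e (n + 1) x - c\<^sup>2 * e (n + 2) x" for x
  have dF: "(F has_field_derivative (4 * k * (k - 1) * (1 - z\<^sup>2) ^ n - (2 * k + 4 * k * (k - 1)) * (1 - z\<^sup>2) ^ (n + 1) - c\<^sup>2 * (1 - z\<^sup>2) ^ (n + 2)) * exp (- c * z)) (at z)" for z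
  proof -
    define u where "u = (1 - z\<^sup>2) ^ n"
    have k1: "k = of_nat n + 2" by (simp add: k_def)
    have p: "(1 - z\<^sup>2) ^ (n + 1) = (1 - z\<^sup>2) * u" "(1 - z\<^sup>2) ^ (n + 2) = (1 - z\<^sup>2)\<^sup>2 * u" "(1 - z\<^sup>2) ^ n = u"
      by (simp_all add: u_def power_add power2_eq_square mult_ac)
    have dg: "((\<lambda>z. 1 - z\<^sup>2) has_field_derivative - 2 * z) (at z)"
      by (auto intro!: derivative_eq_intros)
    have d1: "((\<lambda>z. (1 - z\<^sup>2) ^ (n + 1)) has_field_derivative (k - 1) * u * (- 2 * z)) (at z)"
      using DERIV_power[OF dg, of "n + 1"] by (simp add: u_def k1 algebra_simps)
    have d2: "((\<lambda>z. (1 - z\<^sup>2) ^ (n + 2)) has_field_derivative k * ((1 - z\<^sup>2) * u) * (- 2 * z)) (at z)"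
      using DERIV_power[OF dg, of "n + 2"] by (simp add: u_def k1 algebra_simps)
    have "(F has_field_derivative
        ((- 2 * k) * (1 - z\<^sup>2) ^ (n + 1) + (- 2 * k * z) * ((k - 1) * u * (- 2 * z)) + c * (k * ((1 - z\<^sup>2) * u) * (- 2 * z))) * exp (- c * z)
        + (- 2 * k * z * (1 - z\<^sup>2) ^ (n + 1) + c * (1 - z\<^sup>2) ^ (n + 2)) * (exp (- c * z) * (- c))) (at z)"
      unfolding F_def by (rule derivative_eq_intros d1 d2 refl | simp)+
    also have "((- 2 * k) * (1 - z\<^sup>2) ^ (n + 1) + (- 2 * k * z) * ((k - 1) * u * (- 2 * z)) + c * (k * ((1 - z\<^sup>2) * u) * (- 2 * z))) * exp (- c * z)
        + (- 2 * k * z * (1 - z\<^sup>2) ^ (n + 1) + c * (1 - z\<^sup>2) ^ (n + 2)) * (exp (- c * z) * (- c))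
      = (4 * k * (k - 1) * (1 - z\<^sup>2) ^ n - (2 * k + 4 * k * (k - 1)) * (1 - z\<^sup>2) ^ (n + 1) - c\<^sup>2 * (1 - z\<^sup>2) ^ (n + 2)) * exp (- c * z)"
      unfolding p by (simp add: algebra_simps power2_eq_square)
    finally show ?thesis .
  qed
  have dG: "((\<lambda>x. F (of_real x)) has_vector_derivative G x) (at x within {-1..1})" for x :: real
    using has_vector_derivative_real_field[OF dF, of x "{-1..1}"] by (simp add: G_def e_def algebra_simps)
  have "(LINT x|lborel. indicator {-1..1} x *\<^sub>R G x) = F (of_real 1) - F (of_real (-1))"
  proof (rule integral_FTC_Icc)
    show "continuous_on {-1..1} G" unfolding G_def by (intro continuous_intros ec)
  qed (use dG in auto)
  also have "\<dots> = 0" by (simp add: F_def)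
  finally have "0 = (LINT x|lborel. indicator {-1..1} x *\<^sub>R G x)" ..
  also have "\<dots> = (LINT x|lborel. 4 * k * (k - 1) * (indicator {-1..1} x *\<^sub>R e n x) - (2 * k + 4 * k * (k - 1)) * (indicator {-1..1} x *\<^sub>R e (n + 1) x) - c\<^sup>2 * (indicator {-1..1} x *\<^sub>R e (n + 2) x))"
    by (intro Bochner_Integration.integral_cong refl) (simp add: G_def scaleR_conv_of_real algebra_simps)
  also have "\<dots> = 4 * k * (k - 1) * bump_hat n \<xi> - (2 * k + 4 * k * (k - 1)) * bump_hat (n + 1) \<xi> - c\<^sup>2 * bump_hat (n + 2) \<xi>"
  proof -
    have "(LINT x|lborel. a * f x - b * g x - d * h x) = a * (LINT x|lborel. f x) - b * (LINT x|lborel. g x) - d * (LINT x|lborel. h x)"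
      if "integrable lborel f" "integrable lborel g" "integrable lborel h" for a b d :: complex and f g h :: "real \<Rightarrow> complex"
      using that by simp
    from this[OF ei ei ei] show ?thesis unfolding bh .
  qed
  finally show ?thesis unfolding c_def by (simp add: algebra_simps)
qed

text \<open>Each use of the recurrence trades two powers of 1 - x^2 for one factor \<xi>^2 of decay,
  hence the condition 2 k \<le> m.\<close>

lemma bump_hat_decay:
  assumes "2 * k \<le> m"
  shows "\<exists>C\<ge>0. \<forall>\<xi>. norm (bump_hat m \<xi>) * (1 + \<xi>\<^sup>2) ^ k \<le> C"
  using assms
proof (induction k arbitrary: m)
  case 0
  show ?case by (intro exI[of _ 2]) (use norm_bump_hat_le in auto)
next
  case (Suc k)
  then obtain n where m: "m = n + 2" "2 * k \<le> n" by (metis Suc_1 add_2_eq_Suc' le_Suc_ex mult_Suc_right nat_arith.add1 add.commute le_add1 le_trans add_le_cancel_right)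
  obtain C0 where C0: "C0 \<ge> 0" "\<And>\<xi>. norm (bump_hat n \<xi>) * (1 + \<xi>\<^sup>2) ^ k \<le> C0" using Suc.IH[of n] m by auto
  obtain C1 where C1: "C1 \<ge> 0" "\<And>\<xi>. norm (bump_hat (n + 1) \<xi>) * (1 + \<xi>\<^sup>2) ^ k \<le> C1" using Suc.IH[of "n + 1"] m by auto
  obtain C2 where C2: "C2 \<ge> 0" "\<And>\<xi>. norm (bump_hat (n + 2) \<xi>) * (1 + \<xi>\<^sup>2) ^ k \<le> C2" using Suc.IH[of "n + 2"] m by auto
  define K :: complex where "K = of_nat (n + 2)"
  define D where "D = C2 + norm (4 * K * (K - 1)) * C0 + norm (2 * K + 4 * K * (K - 1)) * C1"
  show ?case
  proof (intro exI[of _ D] conjI allI)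
    show "D \<ge> 0" using C0 C1 C2 by (simp add: D_def)
    fix \<xi> :: real
    define w where "w = (1 + \<xi>\<^sup>2) ^ k"
    have w: "w \<ge> 0" by (simp add: w_def)
    have "norm ((2 * of_real pi * \<i> * complex_of_real \<xi>)\<^sup>2) = (2 * pi)\<^sup>2 * \<xi>\<^sup>2"
      by (simp add: norm_mult norm_power power_mult_distrib)
    moreover have "1 * \<xi>\<^sup>2 \<le> (2 * pi)\<^sup>2 * \<xi>\<^sup>2"
      using pi_ge_two by (intro mult_right_mono one_le_power) auto
    ultimately have "\<xi>\<^sup>2 \<le> norm ((2 * of_real pi * \<i> * complex_of_real \<xi>)\<^sup>2)" by simp
    then have "\<xi>\<^sup>2 * norm (bump_hat m \<xi>) \<le> norm ((2 * of_real pi * \<i> * complex_of_real \<xi>)\<^sup>2 * bump_hat (n + 2) \<xi>)"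
      unfolding m norm_mult by (intro mult_right_mono) auto
    also have "\<dots> \<le> norm (4 * K * (K - 1)) * norm (bump_hat n \<xi>) + norm (2 * K + 4 * K * (K - 1)) * norm (bump_hat (n + 1) \<xi>)"
      unfolding bump_hat_recurrence K_def[symmetric] by (rule order_trans[OF norm_triangle_ineq4]) (simp add: norm_mult)
    finally have "(\<xi>\<^sup>2 * norm (bump_hat m \<xi>)) * w \<le> (norm (4 * K * (K - 1)) * norm (bump_hat n \<xi>) + norm (2 * K + 4 * K * (K - 1)) * norm (bump_hat (n + 1) \<xi>)) * w"
      by (rule mult_right_mono) (fact w)
    also have "\<dots> = norm (4 * K * (K - 1)) * (norm (bump_hat n \<xi>) * w) + norm (2 * K + 4 * K * (K - 1)) * (norm (bump_hat (n + 1) \<xi>) * w)"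
      by (simp only: distrib_right mult.assoc)
    also have "\<dots> \<le> norm (4 * K * (K - 1)) * C0 + norm (2 * K + 4 * K * (K - 1)) * C1"
      using C0(2)[of \<xi>] C1(2)[of \<xi>] unfolding w_def by (intro add_mono mult_left_mono) auto
    finally have "(\<xi>\<^sup>2 * norm (bump_hat m \<xi>)) * w \<le> norm (4 * K * (K - 1)) * C0 + norm (2 * K + 4 * K * (K - 1)) * C1" .
    moreover have "norm (bump_hat m \<xi>) * w \<le> C2" using C2(2)[of \<xi>] unfolding w_def m .
    moreover have "norm (bump_hat m \<xi>) * (1 + \<xi>\<^sup>2) ^ Suc k = norm (bump_hat m \<xi>) * w + (\<xi>\<^sup>2 * norm (bump_hat m \<xi>)) * w"
      by (simp add: w_def algebra_simps)
    ultimately show "norm (bump_hat m \<xi>) * (1 + \<xi>\<^sup>2) ^ Suc k \<le> D" unfolding D_def by linarith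
  qed
qed

section \<open>Fejer kernels and combs\<close>

definition fejer :: "nat \<Rightarrow> real \<Rightarrow> real" where
  "fejer N \<xi> = (norm (\<Sum>a<N. cis (2 * pi * real a * \<xi>)) / real N)\<^sup>2"

lemma fejer_measurable [measurable]: "fejer N \<in> borel_measurable borel"
  unfolding fejer_def divide_inverse by (intro borel_measurable_continuous_onI continuous_intros)

lemma fejer_bounds: "0 \<le> fejer N \<xi>" "fejer N \<xi> \<le> 1"
proof -
  have "norm (\<Sum>a<N. cis (2 * pi * real a * \<xi>)) \<le> (\<Sum>a<N. norm (cis (2 * pi * real a * \<xi>)))"
    by (rule norm_sum)
  then have "norm (\<Sum>a<N. cis (2 * pi * real a * \<xi>)) / real N \<le> 1"
    by (cases "N = 0") (auto simp: divide_le_eq)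
  then show "fejer N \<xi> \<le> 1" unfolding fejer_def by (intro power_le_one) auto
qed (simp add: fejer_def)

text \<open>The normalisation is chosen for this: \<open>fejer N\<close> is the usual Fejer kernel
  divided by N. At the integers the transform of a comb then does not depend on N, while the mean
  over a period drops to 1/N.\<close>

lemma fejer_of_int: "N \<ge> 1 \<Longrightarrow> fejer N (of_int k) = 1"
proof -
  have "cis (2 * pi * real a * of_int k) = 1" for a
    using cis_multiple_2pi[of "of_int (int a * k)"] by (simp add: mult_ac)
  then show "N \<ge> 1 \<Longrightarrow> fejer N (of_int k) = 1" by (simp add: fejer_def)
qed

lemma fejer_eq_cnj:
  "of_real (fejer N \<xi>) = (\<Sum>a<N. \<Sum>b<N. cis (- (2 * pi * (real a - real b) * \<xi>))) / (of_nat N)\<^sup>2"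
proof -
  define S where "S = (\<Sum>a<N. cis (2 * pi * real a * \<xi>))"
  have "of_real ((norm S)\<^sup>2) = cnj S * S" unfolding complex_norm_square by (rule mult.commute)
  also have "\<dots> = (\<Sum>a<N. \<Sum>b<N. cis (- (2 * pi * (real a - real b) * \<xi>)))"
    unfolding S_def cnj_sum sum_product by (simp add: cis_cnj cis_mult algebra_simps)
  finally show ?thesis by (simp add: fejer_def S_def power_divide)
qed

lemma integral_cos_window:
  fixes k :: int
  shows "(LINT x|lborel. indicator {y - 1/2..y + 1/2} x *\<^sub>R cos (2 * pi * of_int k * x)) = (if k = 0 then 1 else 0)"
proof (cases "k = 0")
  case False
  define F where "F x = sin (2 * pi * of_int k * x) / (2 * pi * of_int k)" for x :: real
  have "(LINT x|lborel. indicator {y - 1/2..y + 1/2} x *\<^sub>R cos (2 * pi * of_int k * x)) = F (y + 1/2) - F (y - 1/2)"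
  proof (rule integral_FTC_Icc)
    fix x :: real
    have "(F has_real_derivative cos (2 * pi * of_int k * x)) (at x within {y - 1/2..y + 1/2})"
      unfolding F_def using False by (auto intro!: derivative_eq_intros)
    then show "(F has_vector_derivative cos (2 * pi * of_int k * x)) (at x within {y - 1/2..y + 1/2})"
      by (simp add: has_real_derivative_iff_has_vector_derivative)
  qed (auto intro!: continuous_intros)
  also have "F (y + 1/2) = F (y - 1/2)"
  proof -
    have "2 * pi * of_int k * (y + 1/2) = 2 * pi * of_int k * (y - 1/2) + 2 * pi * of_int k" by (simp add: algebra_simps)
    then show ?thesis unfolding F_def by (simp add: sin_add)
  qed
  finally show ?thesis using False by simp
qed simp

text \<open>A window is a full period, so only the N diagonal terms of the double sum survive,
  divided by N^2.\<close>

lemma fejer_window: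
  assumes N: "N \<ge> 1"
  shows "(\<integral>\<^sup>+x. ennreal (fejer N x) * indicator {y - 1/2..y + 1/2} x \<partial>lborel) \<le> ennreal (1 / real N)"
proof -
  have fe: "fejer N \<xi> = (\<Sum>a<N. \<Sum>b<N. cos (2 * pi * of_int (int a - int b) * \<xi>)) / (real N)\<^sup>2" for \<xi>
  proof -
    have "fejer N \<xi> = Re (of_real (fejer N \<xi>))" by simp
    also have "\<dots> = (\<Sum>a<N. \<Sum>b<N. cos (2 * pi * of_int (int a - int b) * \<xi>)) / (real N)\<^sup>2"
    proof -
      have N2: "(of_nat N :: complex)\<^sup>2 = of_real ((real N)\<^sup>2)" by simp
      show ?thesis unfolding fejer_eq_cnj N2 Re_divide_of_real by simp
    qed
    finally show ?thesis .
  qed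
  have ci: "integrable lborel (\<lambda>x. indicator {y - 1/2..y + 1/2} x *\<^sub>R cos (2 * pi * of_int k * x))" for k
  proof -
    have "continuous_on {y - 1/2..y + 1/2} (\<lambda>x. cos (2 * pi * of_int k * x))" by (intro continuous_intros)
    from borel_integrable_atLeastAtMost'[OF this] show ?thesis unfolding set_integrable_def .
  qed
  have eq: "indicator {y - 1/2..y + 1/2} x *\<^sub>R fejer N x
     = (\<Sum>a<N. \<Sum>b<N. indicator {y - 1/2..y + 1/2} x *\<^sub>R cos (2 * pi * of_int (int a - int b) * x)) / (real N)\<^sup>2" for x
    unfolding fe by (simp add: sum_distrib_left)
  have fi: "integrable lborel (\<lambda>x. indicator {y - 1/2..y + 1/2} x *\<^sub>R fejer N x)"
    unfolding eq by (intro integrable_divide Bochner_Integration.integrable_sum ci)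
  have "(LINT x|lborel. indicator {y - 1/2..y + 1/2} x *\<^sub>R fejer N x)
      = (\<Sum>a<N. \<Sum>b<N. (if int a - int b = 0 then 1 else 0)) / (real N)\<^sup>2"
    unfolding eq by (simp only: integral_divide_zero Bochner_Integration.integral_sum Bochner_Integration.integrable_sum ci integral_cos_window)
  also have "(\<Sum>a<N. \<Sum>b<N. (if int a - int b = 0 then 1 else 0)) = (real N)"
  proof -
    have "(\<Sum>b<N. (if int a - int b = 0 then 1 else 0 :: real)) = 1" if "a < N" for a
    proof -
      have "(\<Sum>b<N. (if int a - int b = 0 then 1 else 0 :: real)) = (\<Sum>b<N. (if b = a then 1 else 0))"
        by (intro sum.cong) auto
      then show ?thesis using that by simp
    qed
    then show ?thesis by simp
  qed
  finally have I: "(LINT x|lborel. indicator {y - 1/2..y + 1/2} x *\<^sub>R fejer N x) = 1 / real N"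
    using N by (simp add: power2_eq_square)
  have "(\<integral>\<^sup>+x. ennreal (fejer N x) * indicator {y - 1/2..y + 1/2} x \<partial>lborel)
      = (\<integral>\<^sup>+x. ennreal (indicator {y - 1/2..y + 1/2} x *\<^sub>R fejer N x) \<partial>lborel)"
    by (intro nn_integral_cong) (auto split: split_indicator)
  also have "\<dots> = ennreal (LINT x|lborel. indicator {y - 1/2..y + 1/2} x *\<^sub>R fejer N x)"
    by (rule nn_integral_eq_integral[OF fi]) (auto simp: fejer_bounds)
  finally show ?thesis unfolding I by simp
qed

text \<open>The double sum gives the bump at the integer \<open>n + k\<close> the weight \<open>(N - |k|)/N\<^sup>2\<close>.\<close>
definition comb :: "nat \<Rightarrow> nat \<Rightarrow> nat \<Rightarrow> real \<Rightarrow> real \<Rightarrow> real" where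
  "comb m N n W x = (\<Sum>a<N. \<Sum>b<N. bump m (W * (x - of_int (int n + int a - int b)))) / (real N)\<^sup>2"

lemma comb_nonneg: "0 \<le> comb m N n W x"
  unfolding comb_def by (intro divide_nonneg_nonneg sum_nonneg bump_bounds) auto

lemma comb_measurable [measurable]: "comb m N n W \<in> borel_measurable borel"
  unfolding comb_def
  by (intro borel_measurable_divide borel_measurable_sum measurable_compose[OF _ bump_measurable]
      borel_measurable_times borel_measurable_diff borel_measurable_const) auto

lemma continuous_on_comb: "m \<ge> 1 \<Longrightarrow> continuous_on UNIV (comb m N n W)"
  unfolding comb_def divide_inverse
  by (intro continuous_intros continuous_on_compose2[OF continuous_on_bump]) auto

lemma bump_scaled_integral:
  assumes W: "W > 0"
  shows "integrable lborel (\<lambda>x. bump m (W * (x - c)))"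
    and "(LINT x|lborel. bump m (W * (x - c))) \<le> 2 / W"
    and "fourier (\<lambda>x. of_real (bump m (W * (x - c)))) \<xi> = cis (- (2 * pi * c * \<xi>)) * bump_hat m (\<xi> / W) / of_real W"
proof -
  have e: "(\<lambda>x. bump m (W * (x - c))) = (\<lambda>x. bump m (- (W * c) + W * x))" by (simp add: algebra_simps)
  show "integrable lborel (\<lambda>x. bump m (W * (x - c)))"
    unfolding e by (rule lborel_integrable_real_affine[OF bump_integrable]) (use W in auto)
  have "(LINT x|lborel. bump m x) = W * (LINT x|lborel. bump m (W * (x - c)))"
    using lborel_integral_real_affine[of W "bump m" "- (W * c)"] W unfolding e by simp
  then have "W * (LINT x|lborel. bump m (W * (x - c))) \<le> 2" using bump_integral_le[of m] by simp
  then show "(LINT x|lborel. bump m (W * (x - c))) \<le> 2 / W" using W by (simp add: field_simps)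
  have "fourier (\<lambda>x. of_real (bump m (W * (x - c)))) \<xi> = (LINT x|lborel. of_real (bump m (W * (x - c))) * cis (- (2 * pi * x * \<xi>)))"
    by (rule fourier_lborel) measurable
  also have "\<dots> = of_real (1 / W) * (LINT y|lborel. of_real (bump m (W * ((c + 1 / W * y) - c))) * cis (- (2 * pi * (c + 1 / W * y) * \<xi>)))"
    using lborel_integral_real_affine[of "1 / W" "\<lambda>x. of_real (bump m (W * (x - c))) * cis (- (2 * pi * x * \<xi>))" c] W
    by (simp add: scaleR_conv_of_real)
  also have "(LINT y|lborel. of_real (bump m (W * ((c + 1 / W * y) - c))) * cis (- (2 * pi * (c + 1 / W * y) * \<xi>)))
      = (LINT y|lborel. cis (- (2 * pi * c * \<xi>)) * (of_real (bump m y) * cis (- (2 * pi * y * (\<xi> / W)))))"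
  proof (intro Bochner_Integration.integral_cong refl)
    fix y
    have "cis (- (2 * pi * (c + 1 / W * y) * \<xi>)) = cis (- (2 * pi * c * \<xi>)) * cis (- (2 * pi * y * (\<xi> / W)))"
      unfolding cis_mult by (rule arg_cong[where f=cis]) (use W in \<open>simp add: field_simps\<close>)
    moreover have "W * ((c + 1 / W * y) - c) = y" using W by simp
    ultimately show "of_real (bump m (W * ((c + 1 / W * y) - c))) * cis (- (2 * pi * (c + 1 / W * y) * \<xi>))
      = cis (- (2 * pi * c * \<xi>)) * (of_real (bump m y) * cis (- (2 * pi * y * (\<xi> / W))))" by (simp add: mult_ac)
  qed
  also have "\<dots> = cis (- (2 * pi * c * \<xi>)) * bump_hat m (\<xi> / W)"
    unfolding bump_hat_def by (subst fourier_lborel) simp_all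
  finally show "fourier (\<lambda>x. of_real (bump m (W * (x - c)))) \<xi> = cis (- (2 * pi * c * \<xi>)) * bump_hat m (\<xi> / W) / of_real W"
    by (simp add: mult.commute)
qed

lemma comb_integrable: "W > 0 \<Longrightarrow> integrable lborel (comb m N n W)"
  unfolding comb_def by (intro integrable_divide Bochner_Integration.integrable_sum bump_scaled_integral(1))

lemma comb_integral_le:
  assumes W: "W > 0" shows "(LINT x|lborel. comb m N n W x) \<le> 2 / W"
proof -
  have "(LINT x|lborel. comb m N n W x) = (\<Sum>a<N. \<Sum>b<N. (LINT x|lborel. bump m (W * (x - of_int (int n + int a - int b))))) / (real N)\<^sup>2"
    unfolding comb_def by (simp only: integral_divide_zero Bochner_Integration.integral_sum Bochner_Integration.integrable_sum bump_scaled_integral W)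
  also have "\<dots> \<le> (\<Sum>a<N. \<Sum>b<N. 2 / W) / (real N)\<^sup>2"
    by (intro divide_right_mono sum_mono bump_scaled_integral W) auto
  also have "\<dots> \<le> 2 / W" using W by (cases "N = 0") (auto simp: power2_eq_square)
  finally show ?thesis .
qed

text \<open>The differences a - b turn the double sum into a squared modulus. This is the purpose of
  the Fejer weights: the transform of a comb is a slowly varying envelope of width W times a kernel
  of mean 1/N.\<close>

lemma fourier_comb:
  assumes W: "W > 0"
  shows "fourier (\<lambda>x. of_real (comb m N n W x)) \<xi> = of_real (fejer N \<xi>) * cis (- (2 * pi * real n * \<xi>)) * bump_hat m (\<xi> / W) / of_real W"
proof -
  define T where "T c x = complex_of_real (bump m (W * (x - c))) * cis (- (2 * pi * x * \<xi>))" for c x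
  have Ti: "integrable lborel (T c)" for c
    unfolding T_def by (rule integrable_mult_cis) (use bump_scaled_integral(1)[OF W] in \<open>auto intro: integrable_of_real\<close>)
  have TI: "(LINT x|lborel. T c x) = cis (- (2 * pi * c * \<xi>)) * bump_hat m (\<xi> / W) / of_real W" for c
    using bump_scaled_integral(3)[OF W, of m c \<xi>] unfolding T_def by (subst (asm) fourier_lborel) auto
  have "fourier (\<lambda>x. of_real (comb m N n W x)) \<xi> = (LINT x|lborel. (\<Sum>a<N. \<Sum>b<N. T (of_int (int n + int a - int b)) x) / (of_nat N)\<^sup>2)"
    unfolding comb_def T_def
    by (subst fourier_lborel) (auto simp: sum_distrib_right)
  also have "\<dots> = (\<Sum>a<N. \<Sum>b<N. cis (- (2 * pi * of_int (int n + int a - int b) * \<xi>)) * bump_hat m (\<xi> / W) / of_real W) / (of_nat N)\<^sup>2"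
    by (simp only: integral_divide_zero Bochner_Integration.integral_sum Bochner_Integration.integrable_sum Ti TI)
  also have "\<dots> = (\<Sum>a<N. \<Sum>b<N. cis (- (2 * pi * (real a - real b) * \<xi>)) * (cis (- (2 * pi * real n * \<xi>)) * bump_hat m (\<xi> / W) / of_real W)) / (of_nat N)\<^sup>2"
  proof -
    have "cis (- (2 * pi * of_int (int n + int a - int b) * \<xi>)) = cis (- (2 * pi * (real a - real b) * \<xi>)) * cis (- (2 * pi * real n * \<xi>))" for a b
      by (simp add: cis_mult algebra_simps)
    then show ?thesis by (simp add: mult.assoc)
  qed
  also have "\<dots> = of_real (fejer N \<xi>) * cis (- (2 * pi * real n * \<xi>)) * bump_hat m (\<xi> / W) / of_real W"
    by (simp only: fejer_eq_cnj sum_distrib_right[symmetric]) (simp add: mult_ac)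
  finally show ?thesis .
qed

lemma bump_int:
  fixes k :: int
  assumes "m \<ge> 1" "W \<ge> 1" shows "bump m (W * of_int k) = (if k = 0 then 1 else 0)"
proof (cases "k = 0")
  case False
  then have "1 * 1 \<le> W * \<bar>of_int k\<bar>" using assms by (intro mult_mono) auto
  then have "1 \<le> \<bar>W * of_int k\<bar>" using assms by (simp add: abs_mult)
  then show ?thesis using False bump_eq_0[OF assms(1)] by simp
qed (simp add: bump_def)

lemma comb_of_int:
  assumes "m \<ge> 1" "W \<ge> 1"
  shows "comb m N n W (of_int k) = (\<Sum>a<N. \<Sum>b<N. if k = int n + int a - int b then 1 else 0) / (real N)\<^sup>2"
proof -
  have "bump m (W * (of_int k - of_int j)) = (if k = j then 1 else 0)" for j
    using bump_int[OF assms, of "k - j"] by simp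
  then show ?thesis by (simp only: comb_def)
qed

text \<open>The bumps sit at 2N + a - b with |a - b| \<le> N - 1 and have half-width 1/W \<le> 1/2.
  With N = 4^j the supports lie below 3 * 4^j, hence are disjoint for different j.\<close>

lemma comb_support:
  assumes m: "m \<ge> 1" and W: "W \<ge> 2" and nz: "comb m N (2 * N) W x \<noteq> 0"
  shows "real N < x" "x < 3 * real N"
proof -
  have "\<exists>a<N. \<exists>b<N. bump m (W * (x - of_int (int (2 * N) + int a - int b))) \<noteq> 0"
  proof (rule ccontr)
    assume "\<not> ?thesis"
    then have "comb m N (2 * N) W x = 0" by (simp add: comb_def)
    with nz show False by simp
  qed
  then obtain a b where a: "a < N" and b: "b < N" "bump m (W * (x - of_int (int (2 * N) + int a - int b))) \<noteq> 0"
    by blast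
  define y where "y = x - of_int (int (2 * N) + int a - int b)"
  have "\<bar>W * y\<bar> < 1" using b(2) bump_eq_0[OF m] unfolding y_def by (meson not_le)
  moreover have "2 * \<bar>y\<bar> \<le> \<bar>W * y\<bar>" using W by (simp add: abs_mult mult_right_mono)
  ultimately have "\<bar>y\<bar> < 1/2" by linarith
  moreover have "x = y + 2 * real N + real a - real b" by (simp add: y_def)
  moreover have "real a + 1 \<le> real N" "real b + 1 \<le> real N" using a b by linarith+
  moreover have "real a \<ge> 0" "real b \<ge> 0" by auto
  ultimately show "real N < x" "x < 3 * real N" by linarith+
qed

text \<open>For fixed a the bumps have distinct integer centres and half-width at most 1/2, so at
  most one b contributes at x. This leaves N terms over N^2.\<close>

lemma comb_le:
  assumes m: "m \<ge> 1" and W: "W \<ge> 2" and N: "N \<ge> 1"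
  shows "comb m N n W x \<le> 1 / real N"
proof -
  have "(\<Sum>b<N. bump m (W * (x - of_int (int n + int a - int b)))) \<le> 1" for a
  proof -
    define S where "S = {b. b < N \<and> bump m (W * (x - of_int (int n + int a - int b))) \<noteq> 0}"
    have close: "\<bar>x - of_int (int n + int a - int b)\<bar> < 1/2" if "b \<in> S" for b
    proof -
      define y where "y = x - of_int (int n + int a - int b)"
      have "bump m (W * y) \<noteq> 0" using that by (simp add: S_def y_def)
      then have "\<bar>W * y\<bar> < 1" using bump_eq_0[OF m, of "W * y"] by fastforce
      moreover have "2 * \<bar>y\<bar> \<le> \<bar>W * y\<bar>" using W by (simp add: abs_mult mult_right_mono)
      ultimately have "\<bar>y\<bar> < 1/2" by linarith
      then show ?thesis unfolding y_def .
    qed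
    have "b = b'" if "b \<in> S" "b' \<in> S" for b b'
    proof -
      have "\<bar>real b - real b'\<bar> < 1"
        using close[OF that(1)] close[OF that(2)] unfolding of_int_diff of_int_add of_int_of_nat_eq by arith
      then show ?thesis by linarith
    qed
    then have "card S \<le> 1" by (intro card_le_Suc0_iff_eq[THEN iffD2, unfolded One_nat_def[symmetric]]) (auto simp: S_def)
    have "(\<Sum>b<N. bump m (W * (x - of_int (int n + int a - int b)))) = (\<Sum>b\<in>S. bump m (W * (x - of_int (int n + int a - int b))))"
      by (rule sum.mono_neutral_right) (auto simp: S_def)
    also have "\<dots> \<le> real (card S) * 1" by (rule sum_bounded_above) (rule bump_bounds)
    finally show ?thesis using \<open>card S \<le> 1\<close> by linarith
  qed
  then have "comb m N n W x \<le> (\<Sum>a<N. 1) / (real N)\<^sup>2"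
    unfolding comb_def by (intro divide_right_mono sum_mono) auto
  then show ?thesis using N by (simp add: power2_eq_square)
qed

text \<open>Reduction to the integral of the comb itself: on the support |x| \<le> 3N, and the p-th
  power of the comb is at most N^(1-p) times the comb.\<close>

lemma comb_weighted_norm:
  assumes m: "m \<ge> 1" and W: "W \<ge> 2" and N: "N \<ge> 1" and p: "p \<ge> 1" and \<alpha>: "\<alpha> \<ge> 0"
  shows "(\<integral>\<^sup>+x. ennreal ((\<bar>comb m N (2 * N) W x\<bar> * \<bar>x\<bar> powr \<alpha>) powr p) \<partial>lborel)
    \<le> ennreal (2 * 3 powr (\<alpha> * p) * real N powr (p * (\<alpha> - 1 + 1 / p)) / W)"
proof -
  define c where "c = 3 powr (\<alpha> * p) * real N powr (p * (\<alpha> - 1 + 1 / p))"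
  have pw: "(\<bar>comb m N (2 * N) W x\<bar> * \<bar>x\<bar> powr \<alpha>) powr p \<le> c * comb m N (2 * N) W x" for x
  proof (cases "comb m N (2 * N) W x = 0")
    case False
    define h where "h = comb m N (2 * N) W x"
    have h: "h > 0" "h \<le> 1 / real N" using False comb_nonneg[of m N "2 * N" W x] comb_le[OF m W N] by (auto simp: h_def less_le)
    have x: "0 \<le> \<bar>x\<bar>" "\<bar>x\<bar> \<le> 3 * real N" using comb_support[OF m W False] by auto
    have "(\<bar>h\<bar> * \<bar>x\<bar> powr \<alpha>) powr p = h powr (p - 1) * h * \<bar>x\<bar> powr (\<alpha> * p)"
      using h by (simp add: powr_mult powr_powr powr_diff)
    also have "\<dots> \<le> (1 / real N) powr (p - 1) * h * (3 * real N) powr (\<alpha> * p)"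
      using h x p \<alpha> by (intro mult_mono powr_mono2) auto
    also have "\<dots> = (3 powr (\<alpha> * p) * (real N powr (\<alpha> * p) * real N powr (- (p - 1)))) * h"
    proof -
      have "(1 / real N) powr (p - 1) = real N powr (- (p - 1))"
        using N by (simp only: powr_minus powr_divide inverse_eq_divide powr_one_eq_one)
      then show ?thesis using N by (simp add: powr_mult mult_ac)
    qed
    also have "real N powr (\<alpha> * p) * real N powr (- (p - 1)) = real N powr (p * (\<alpha> - 1 + 1 / p))"
      unfolding powr_add[symmetric] using p by (intro arg_cong2[where f="(powr)"]) (auto simp: field_simps)
    finally show ?thesis unfolding h_def c_def .
  qed simp
  have "(\<integral>\<^sup>+x. ennreal ((\<bar>comb m N (2 * N) W x\<bar> * \<bar>x\<bar> powr \<alpha>) powr p) \<partial>lborel) \<le> (\<integral>\<^sup>+x. ennreal (c * comb m N (2 * N) W x) \<partial>lborel)"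
    by (intro nn_integral_mono ennreal_leI pw)
  also have "\<dots> = ennreal (LINT x|lborel. c * comb m N (2 * N) W x)"
    using W by (intro nn_integral_eq_integral) (auto simp: comb_integrable comb_nonneg c_def)
  also have "\<dots> \<le> ennreal (c * (2 / W))"
    using comb_integral_le[of W m N "2 * N"] W by (intro ennreal_leI) (simp add: c_def mult_left_mono del: times_divide_eq_right)
  also have "c * (2 / W) = 2 * 3 powr (\<alpha> * p) * real N powr (p * (\<alpha> - 1 + 1 / p)) / W" by (simp add: c_def)
  finally show ?thesis .
qed

text \<open>In the variable \<xi>/W the transform of the bump, weight included, is below an
  integrable envelope of mass O(W), and on unit windows the Fejer factor has mean 1/N. So the
  integral is O(W/N) times the power of W produced by scaling. In the lower bound for m, the ceiling
  of \<beta> absorbs the weight and the added 1 leaves the integrable factor 1/(1 + t^2).\<close>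

lemma fourier_comb_weighted_norm:
  assumes q: "q \<ge> 1" and \<beta>: "\<beta> \<ge> 0" and m: "2 * (nat \<lceil>\<beta>\<rceil> + 1) \<le> m"
  shows "\<exists>C\<ge>0. \<forall>N n W. N \<ge> 1 \<longrightarrow> W \<ge> 1 \<longrightarrow>
    (\<integral>\<^sup>+\<xi>. ennreal ((norm (fourier (\<lambda>x. of_real (comb m N n W x)) \<xi>) * \<bar>\<xi>\<bar> powr \<beta>) powr q) \<partial>lborel)
    \<le> ennreal (C * W powr (q * (\<beta> - 1 + 1 / q)) / real N)"
proof -
  define k where "k = nat \<lceil>\<beta>\<rceil>"
  obtain C0 where C0: "C0 \<ge> 0" "\<And>\<xi>. norm (bump_hat m \<xi>) * (1 + \<xi>\<^sup>2) ^ (k + 1) \<le> C0"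
    using bump_hat_decay[OF m] unfolding k_def by blast
  have dec: "norm (bump_hat m t) * \<bar>t\<bar> powr \<beta> \<le> C0 * inverse (1 + t\<^sup>2)" for t
  proof -
    have t1: "1 + t\<^sup>2 > 0" by (simp add: add_pos_nonneg)
    have "\<bar>t\<bar> \<le> 1 + t\<^sup>2"
    proof (cases "\<bar>t\<bar> \<le> 1")
      case False
      then have "\<bar>t\<bar> * 1 \<le> \<bar>t\<bar> * \<bar>t\<bar>" by (intro mult_left_mono) auto
      then show ?thesis by (simp add: power2_eq_square abs_mult_self_eq)
    qed (simp add: add_increasing2)
    then have "\<bar>t\<bar> powr \<beta> \<le> (1 + t\<^sup>2) powr \<beta>" using \<beta> by (intro powr_mono2) auto
    also have "\<dots> \<le> (1 + t\<^sup>2) powr real k" unfolding k_def by (intro powr_mono) (auto simp: of_nat_ceiling)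
    also have "\<dots> = (1 + t\<^sup>2) ^ k" using t1 by (simp add: powr_realpow)
    finally have "norm (bump_hat m t) * \<bar>t\<bar> powr \<beta> \<le> norm (bump_hat m t) * (1 + t\<^sup>2) ^ k" by (rule mult_left_mono) simp
    also have "\<dots> = norm (bump_hat m t) * (1 + t\<^sup>2) ^ (k + 1) * inverse (1 + t\<^sup>2)" using t1 by simp
    also have "\<dots> \<le> C0 * inverse (1 + t\<^sup>2)" using t1 by (intro mult_right_mono C0) auto
    finally show ?thesis .
  qed
  define c0 where "c0 = (LINT x|lborel. inverse (1 + x\<^sup>2 :: real))"
  have c0: "c0 \<ge> 0" unfolding c0_def by (rule Bochner_Integration.integral_nonneg) simp
  define C where "C = C0 powr q * (2 * c0)"
  show ?thesis
  proof (intro exI[of _ C] conjI allI impI)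
    show "C \<ge> 0" using c0 by (simp add: C_def)
    fix N n :: nat and W :: real assume N: "N \<ge> 1" and W: "W \<ge> 1"
    define G where "G \<xi> = inverse (1 + (\<xi> / W)\<^sup>2)" for \<xi> :: real
    have [measurable]: "G \<in> borel_measurable borel" unfolding G_def by measurable
    have Gpos: "G \<xi> > 0" "G \<xi> \<le> 1" for \<xi> unfolding G_def by (simp_all add: add_pos_nonneg inverse_le_1_iff)
    define E where "E = W powr (q * (\<beta> - 1)) * C0 powr q"
    have pw: "(norm (fourier (\<lambda>x. of_real (comb m N n W x)) \<xi>) * \<bar>\<xi>\<bar> powr \<beta>) powr q \<le> E * (G \<xi> * fejer N \<xi>)" for \<xi>
    proof -
      define t where "t = \<xi> / W"
      have \<xi>: "\<xi> = W * t" using W by (simp add: t_def)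
      have "norm (fourier (\<lambda>x. of_real (comb m N n W x)) \<xi>) * \<bar>\<xi>\<bar> powr \<beta> = fejer N \<xi> * norm (bump_hat m t) / W * (W * \<bar>t\<bar>) powr \<beta>"
        using W fejer_bounds[of N \<xi>] by (subst fourier_comb) (auto simp: norm_mult norm_divide t_def)
      also have "\<dots> = fejer N \<xi> * (W powr (\<beta> - 1) * (norm (bump_hat m t) * \<bar>t\<bar> powr \<beta>))"
        using W by (simp add: powr_mult powr_diff)
      also have "\<dots> \<le> fejer N \<xi> * (W powr (\<beta> - 1) * (C0 * G \<xi>))"
        using dec[of t] fejer_bounds[of N \<xi>] unfolding G_def t_def[symmetric] by (intro mult_left_mono) auto
      finally have "(norm (fourier (\<lambda>x. of_real (comb m N n W x)) \<xi>) * \<bar>\<xi>\<bar> powr \<beta>) powr q \<le> (fejer N \<xi> * (W powr (\<beta> - 1) * (C0 * G \<xi>))) powr q"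
        using q by (intro powr_mono2) auto
      also have "\<dots> = E * (G \<xi> powr q * fejer N \<xi> powr q)"
        using fejer_bounds[of N \<xi>] C0 Gpos[of \<xi>] W by (simp add: powr_mult powr_powr E_def mult_ac)
      \<comment> \<open>Both factors are at most 1, so their q-th powers may be replaced by first
        powers.\<close>
      also have "\<dots> \<le> E * (G \<xi> powr 1 * fejer N \<xi> powr 1)"
        using fejer_bounds[of N \<xi>] Gpos[of \<xi>] q by (intro mult_left_mono mult_mono powr_mono') (auto simp: E_def)
      also have "\<dots> = E * (G \<xi> * fejer N \<xi>)" using fejer_bounds[of N \<xi>] Gpos[of \<xi>] by simp
      finally show ?thesis .
    qed
    \<comment> \<open>As W \<ge> 1, the envelope varies by at most a factor 2 across a window, which
      is the hypothesis of \<open>nn_integral_window\<close>.\<close>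
    have G2: "G x \<le> 2 * G y" if "\<bar>x - y\<bar> \<le> 1/2" for x y
    proof -
      define u v where "u = x / W" and "v = y / W"
      have "\<bar>u - v\<bar> = \<bar>x - y\<bar> / W" using W by (simp add: u_def v_def diff_divide_distrib[symmetric])
      also have "\<dots> \<le> 1/2 / 1" using that W by (intro frac_le) auto
      finally have "(u - v)\<^sup>2 \<le> (1/2)\<^sup>2" by (simp add: abs_le_square_iff[symmetric])
      moreover have "v\<^sup>2 \<le> 2 * u\<^sup>2 + 2 * (u - v)\<^sup>2"
      proof -
        have "0 \<le> (2 * u - v)\<^sup>2" by simp
        then show ?thesis by (simp add: power2_eq_square algebra_simps)
      qed
      ultimately have "1 + v\<^sup>2 \<le> 2 * (1 + u\<^sup>2)" by (simp add: power2_eq_square)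
      then show ?thesis unfolding G_def u_def[symmetric] v_def[symmetric]
        by (simp add: field_simps add_pos_nonneg)
    qed
    have "(\<integral>\<^sup>+\<xi>. ennreal (G \<xi>) * ennreal (fejer N \<xi>) \<partial>lborel) \<le> ennreal (1 / real N) * (\<integral>\<^sup>+y. ennreal (2 * G y) \<partial>lborel)"
    proof (rule nn_integral_window)
      fix x
      have "ennreal (G x) = (\<integral>\<^sup>+y. ennreal (G x) * indicator {x - 1/2..x + 1/2} y \<partial>lborel)"
        by (simp add: nn_integral_cmult_indicator)
      also have "\<dots> \<le> (\<integral>\<^sup>+y. ennreal (2 * G y) * indicator {x - 1/2..x + 1/2} y \<partial>lborel)"
      proof (rule nn_integral_mono)
        fix y
        show "ennreal (G x) * indicator {x - 1/2..x + 1/2} y \<le> ennreal (2 * G y) * indicator {x - 1/2..x + 1/2} y"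
        proof (cases "y \<in> {x - 1/2..x + 1/2}")
          case True
          then have "\<bar>x - y\<bar> \<le> 1/2" unfolding atLeastAtMost_iff by arith
          then show ?thesis using True G2[of x y] by (simp add: ennreal_leI)
        qed simp
      qed
      finally show "ennreal (G x) \<le> (\<integral>\<^sup>+y. ennreal (2 * G y) * indicator {x - 1/2..x + 1/2} y \<partial>lborel)" .
    qed (use fejer_window[OF N] in auto)
    also have "(\<integral>\<^sup>+y. ennreal (2 * G y) \<partial>lborel) = ennreal (2 * (W * c0))"
    proof -
      have "(\<integral>\<^sup>+y. ennreal (2 * G y) \<partial>lborel) = ennreal W * (\<integral>\<^sup>+t. ennreal (2 * G (0 + W * t)) \<partial>lborel)"
        using nn_integral_real_affine[of "\<lambda>y. ennreal (2 * G y)" W 0] W by simp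
      also have "(\<integral>\<^sup>+t. ennreal (2 * G (0 + W * t)) \<partial>lborel) = (\<integral>\<^sup>+t. ennreal (2 * inverse (1 + t\<^sup>2)) \<partial>lborel)"
        using W by (simp add: G_def)
      also have "\<dots> = ennreal (LINT t|lborel. 2 * inverse (1 + t\<^sup>2))"
        by (intro nn_integral_eq_integral integrable_mult_right integrable_inverse_1_plus_square') auto
      also have "ennreal W * \<dots> = ennreal (W * (2 * c0))" using W c0 by (simp add: c0_def ennreal_mult)
      finally show ?thesis by (simp add: mult_ac)
    qed
    also have "ennreal (1 / real N) * ennreal (2 * (W * c0)) = ennreal (2 * (W * c0) / real N)"
      using W c0 by (simp add: ennreal_mult[symmetric])
    finally have main: "(\<integral>\<^sup>+\<xi>. ennreal (G \<xi>) * ennreal (fejer N \<xi>) \<partial>lborel) \<le> ennreal (2 * (W * c0) / real N)" .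
    have "(\<integral>\<^sup>+\<xi>. ennreal ((norm (fourier (\<lambda>x. of_real (comb m N n W x)) \<xi>) * \<bar>\<xi>\<bar> powr \<beta>) powr q) \<partial>lborel)
       \<le> (\<integral>\<^sup>+\<xi>. ennreal E * (ennreal (G \<xi>) * ennreal (fejer N \<xi>)) \<partial>lborel)"
    proof (rule nn_integral_mono)
      fix \<xi>
      have "ennreal E * (ennreal (G \<xi>) * ennreal (fejer N \<xi>)) = ennreal (E * (G \<xi> * fejer N \<xi>))"
        using Gpos[of \<xi>] fejer_bounds[of N \<xi>] by (simp add: ennreal_mult E_def less_imp_le)
      then show "ennreal ((norm (fourier (\<lambda>x. of_real (comb m N n W x)) \<xi>) * \<bar>\<xi>\<bar> powr \<beta>) powr q) \<le> ennreal E * (ennreal (G \<xi>) * ennreal (fejer N \<xi>))"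
        using pw[of \<xi>] by (simp add: ennreal_leI)
    qed
    also have "\<dots> = ennreal E * (\<integral>\<^sup>+\<xi>. ennreal (G \<xi>) * ennreal (fejer N \<xi>) \<partial>lborel)"
      by (rule nn_integral_cmult) measurable
    also have "\<dots> \<le> ennreal E * ennreal (2 * (W * c0) / real N)" by (rule mult_left_mono[OF main]) simp
    also have "\<dots> = ennreal (C * W powr (q * (\<beta> - 1 + 1 / q)) / real N)"
    proof -
      have "W powr (q * (\<beta> - 1 + 1 / q)) = W powr (q * (\<beta> - 1) + 1)"
        using q by (intro arg_cong2[where f="(powr)"]) (auto simp: field_simps)
      also have "\<dots> = W powr (q * (\<beta> - 1)) * W" using W by (simp add: powr_add)
      finally show ?thesis using W c0 by (simp add: ennreal_mult[symmetric] E_def C_def mult_ac)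
    qed
    finally show "(\<integral>\<^sup>+\<xi>. ennreal ((norm (fourier (\<lambda>x. of_real (comb m N n W x)) \<xi>) * \<bar>\<xi>\<bar> powr \<beta>) powr q) \<partial>lborel)
       \<le> ennreal (C * W powr (q * (\<beta> - 1 + 1 / q)) / real N)" .
  qed
qed

section \<open>Series with disjoint supports\<close>

text \<open>Bernoulli's inequality for real exponents, from Young's inequality with second factor
  1.\<close>

lemma powr_ge_tangent_at_1:
  fixes q x :: real
  assumes q: "q \<ge> 1" and x: "x \<ge> 0"
  shows "1 + q * (x - 1) \<le> x powr q"
proof (cases "q = 1")
  case False
  then have q1: "q > 1" using q by simp
  have "x * 1 \<le> x powr q / q + 1 powr (q / (q - 1)) / (q / (q - 1))"
    by (rule Youngs_inequality) (use q1 x in \<open>auto simp: field_simps\<close>)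
  then have "x \<le> x powr q / q + (q - 1) / q" by simp
  then have "q * x \<le> q * (x powr q / q + (q - 1) / q)" using q1 by (intro mult_left_mono) auto
  also have "\<dots> = x powr q + (q - 1)" using q1 by (simp add: distrib_left)
  finally show ?thesis by (simp add: algebra_simps)
qed (use x in simp)

text \<open>Hoelder's inequality with weights \<open>b\<close>, needed because the transforms of the
  pieces overlap. Proved as Jensen's inequality, by the tangent of x^q at the weighted mean.\<close>

lemma powr_sum_le:
  fixes v b :: "nat \<Rightarrow> real"
  assumes q: "q \<ge> 1" and v: "\<And>j. v j \<ge> 0" and b: "\<And>j. b j > 0"
  shows "(\<Sum>j<n. v j) powr q \<le> (\<Sum>j<n. b j) powr (q - 1) * (\<Sum>j<n. b j powr (1 - q) * v j powr q)"
proof (cases "(\<Sum>j<n. v j) = 0")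
  case False
  define S where "S = (\<Sum>j<n. v j)"
  define B where "B = (\<Sum>j<n. b j)"
  have S: "S > 0" using False sum_nonneg[of "{..<n}" v] v by (simp add: S_def less_le)
  have "n > 0" using False by (cases n) auto
  then have B: "B > 0" unfolding B_def by (intro sum_pos) (auto simp: b)
  \<comment> \<open>The mean of v j / b j with respect to the weights b j; with this choice the
    linear terms S/t - B cancel after summation.\<close>
  define t where "t = S / B"
  have t: "t > 0" using S B by (simp add: t_def)
  have one: "b j * t powr q + q * t powr q * (v j / t - b j) \<le> b j powr (1 - q) * v j powr q" for j
  proof -
    define x where "x = v j / (b j * t)"
    have x0: "x \<ge> 0" using v[of j] b[of j] t by (simp add: x_def)
    have bx: "b j * x = v j / t" using b[of j] by (simp add: x_def)
    have "b j * t powr q * (1 + q * (x - 1)) \<le> b j * t powr q * x powr q"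
      using powr_ge_tangent_at_1[OF q x0] b[of j] by (intro mult_left_mono) auto
    also have "b j * t powr q * x powr q = b j powr (1 - q) * v j powr q"
      using b[of j] t v[of j] by (simp add: x_def powr_divide powr_mult powr_diff)
    also have "b j * t powr q * (1 + q * (x - 1)) = b j * t powr q + q * t powr q * (b j * x - b j)"
      by (simp add: algebra_simps)
    finally show ?thesis unfolding bx .
  qed
  have "B * t powr q + q * t powr q * (S / t - B) = (\<Sum>j<n. b j * t powr q + q * t powr q * (v j / t - b j))"
    unfolding S_def B_def by (simp add: sum.distrib sum_distrib_right sum_distrib_left sum_subtractf sum_divide_distrib right_diff_distrib)
  also have "\<dots> \<le> (\<Sum>j<n. b j powr (1 - q) * v j powr q)" by (intro sum_mono one)
  also have "S / t - B = 0" using S B by (simp add: t_def)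
  finally have "B powr (q - 1) * (B * t powr q) \<le> B powr (q - 1) * (\<Sum>j<n. b j powr (1 - q) * v j powr q)"
    by (intro mult_left_mono) auto
  moreover have "B powr (q - 1) * (B * t powr q) = S powr q"
    using B S by (simp add: t_def powr_divide powr_diff)
  ultimately show ?thesis by (simp add: S_def B_def)
qed (simp add: sum_nonneg)

lemma powr_suminf_le:
  fixes v b :: "nat \<Rightarrow> real"
  assumes q: "q \<ge> 1" and v: "\<And>j. v j \<ge> 0" "summable v" and b: "\<And>j. b j > 0" "summable b"
  shows "ennreal ((\<Sum>j. v j) powr q) \<le> ennreal ((\<Sum>j. b j) powr (q - 1)) * (\<Sum>j. ennreal (b j powr (1 - q) * v j powr q))"
proof (rule LIMSEQ_le_const2)
  have "(\<lambda>n. \<Sum>j<n. v j) \<longlonglongrightarrow> (\<Sum>j. v j)" using v(2) by (rule summable_LIMSEQ)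
  then show "(\<lambda>n. ennreal ((\<Sum>j<n. v j) powr q)) \<longlonglongrightarrow> ennreal ((\<Sum>j. v j) powr q)"
    using q by (intro tendsto_ennrealI tendsto_powr2 tendsto_const) (auto intro!: always_eventually sum_nonneg v)
  show "\<exists>N. \<forall>n\<ge>N. ennreal ((\<Sum>j<n. v j) powr q) \<le> ennreal ((\<Sum>j. b j) powr (q - 1)) * (\<Sum>j. ennreal (b j powr (1 - q) * v j powr q))"
  proof (intro exI[of _ 0] allI impI)
    fix n
    have "(\<Sum>j<n. b j) \<le> (\<Sum>j. b j)" by (rule sum_le_suminf) (use b in \<open>auto intro: less_imp_le\<close>)
    then have "(\<Sum>j<n. b j) powr (q - 1) \<le> (\<Sum>j. b j) powr (q - 1)"
      using q b by (intro powr_mono2 sum_nonneg) (auto intro: less_imp_le)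
    then have "(\<Sum>j<n. b j) powr (q - 1) * (\<Sum>j<n. b j powr (1 - q) * v j powr q)
        \<le> (\<Sum>j. b j) powr (q - 1) * (\<Sum>j<n. b j powr (1 - q) * v j powr q)"
      by (intro mult_right_mono sum_nonneg) auto
    with powr_sum_le[where v=v and b=b and n=n, OF q v(1) b(1)]
    have "(\<Sum>j<n. v j) powr q \<le> (\<Sum>j. b j) powr (q - 1) * (\<Sum>j<n. b j powr (1 - q) * v j powr q)"
      by (rule order_trans)
    then have *: "ennreal ((\<Sum>j<n. v j) powr q) \<le> ennreal ((\<Sum>j. b j) powr (q - 1)) * ennreal (\<Sum>j<n. b j powr (1 - q) * v j powr q)"
      by (subst ennreal_mult[symmetric]) (auto intro!: ennreal_leI sum_nonneg)
    have "ennreal (\<Sum>j<n. b j powr (1 - q) * v j powr q) = (\<Sum>j<n. ennreal (b j powr (1 - q) * v j powr q))"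
      by (rule sum_ennreal[symmetric]) auto
    also have "\<dots> \<le> (\<Sum>j. ennreal (b j powr (1 - q) * v j powr q))"
      by (rule sum_le_suminf) auto
    finally show "ennreal ((\<Sum>j<n. v j) powr q) \<le> ennreal ((\<Sum>j. b j) powr (q - 1)) * (\<Sum>j. ennreal (b j powr (1 - q) * v j powr q))"
      by (rule order_trans[OF * mult_left_mono]) simp
  qed
qed

definition weighted_norm :: "real \<Rightarrow> real \<Rightarrow> (real \<Rightarrow> complex) \<Rightarrow> ennreal" where
  "weighted_norm p \<alpha> g = (\<integral>\<^sup>+x. ennreal ((norm (g x) * \<bar>x\<bar> powr \<alpha>) powr p) \<partial>lborel)"

text \<open>At each point at most one term is nonzero and near each point only finitely many matter.
  So continuity of the sum is immediate and its weighted integrals are bounded by those of the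
  terms; only on the Fourier side do the terms interact.\<close>

locale disjoint_series =
  fixes u :: "nat \<Rightarrow> real \<Rightarrow> real"
  assumes cont: "\<And>j. continuous_on UNIV (u j)"
    and supp: "\<And>j x. u j x \<noteq> 0 \<Longrightarrow> 4 ^ j < x \<and> x < 4 ^ (j + 1)"
    and int: "\<And>j. integrable lborel (u j)"
    and summ: "summable (\<lambda>j. LINT x|lborel. \<bar>u j x\<bar>)"
begin

definition F :: "real \<Rightarrow> complex" where "F x = of_real (\<Sum>j. u j x)"

lemma u_eq_0: "x \<le> 4 ^ j \<Longrightarrow> u j x = 0"
  by (metis not_le supp)

lemma finite_support: "x < 4 ^ J \<Longrightarrow> j \<notin> {..<J} \<Longrightarrow> u j x = 0"
proof -
  assume "x < 4 ^ J" "j \<notin> {..<J}"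
  then have "(4::real) ^ J \<le> 4 ^ j" by (intro power_increasing) auto
  then show "u j x = 0" using \<open>x < 4 ^ J\<close> by (intro u_eq_0) linarith
qed

lemma F_eq_sum: "x < 4 ^ J \<Longrightarrow> F x = of_real (\<Sum>j<J. u j x)"
  unfolding F_def by (subst suminf_finite[of "{..<J}"]) (use finite_support in auto)

lemma ex_bound: "\<exists>J. x < (4::real) ^ J"
  by (rule real_arch_pow) simp

lemma u_measurable [measurable]: "u j \<in> borel_measurable borel"
  by (rule borel_measurable_continuous_onI[OF cont])

lemma summable_u: "summable (\<lambda>j. norm (u j x))"
proof -
  obtain J where J: "x < 4 ^ J" using ex_bound by blast
  show ?thesis by (rule summable_finite[of "{..<J}"]) (use finite_support[OF J] in auto)
qed

lemma continuous_on_F: "continuous_on UNIV F"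
proof -
  have "isCont F x" for x
  proof -
    obtain J where J: "x < 4 ^ J" using ex_bound by blast
    have "continuous_on {..<4 ^ J} (\<lambda>x. complex_of_real (\<Sum>j<J. u j x))"
      by (intro continuous_intros continuous_on_subset[OF cont]) auto
    then have "continuous_on {..<4 ^ J} F"
      by (rule continuous_on_eq) (simp add: F_eq_sum)
    then show ?thesis using J continuous_on_eq_continuous_at[of "{..<4 ^ J}" F] by auto
  qed
  then show ?thesis by (simp add: continuous_at_imp_continuous_on)
qed

lemma F_measurable [measurable]: "F \<in> borel_measurable borel"
  by (rule borel_measurable_continuous_onI[OF continuous_on_F])

lemma F_integrable: "integrable lborel F"
proof -
  have "integrable lborel (\<lambda>x. \<Sum>j. u j x)"
    by (rule integrable_suminf) (use int summable_u summ in auto)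
  then show ?thesis unfolding F_def[abs_def] by (rule integrable_of_real)
qed

lemma single_term: "F x = 0 \<or> (\<exists>j. F x = of_real (u j x))"
proof (cases "\<forall>j. u j x = 0")
  case False
  then obtain j where j: "u j x \<noteq> 0" by blast
  have "u i x = 0" if "i \<noteq> j" for i
  proof (rule ccontr)
    assume "u i x \<noteq> 0"
    have "i < j \<or> j < i" using that by auto
    then have "(4::real) ^ (i + 1) \<le> 4 ^ j \<or> (4::real) ^ (j + 1) \<le> 4 ^ i"
      by (auto intro!: power_increasing simp del: power_Suc)
    then show False using supp[OF j] supp[OF \<open>u i x \<noteq> 0\<close>] by auto
  qed
  then have "(\<Sum>i. u i x) = (\<Sum>i\<in>{j}. u i x)" by (intro suminf_finite) auto
  then show ?thesis by (auto simp: F_def)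
qed (simp add: F_def)

lemma weighted_norm_F:
  "weighted_norm p \<alpha> F \<le> (\<Sum>j. weighted_norm p \<alpha> (\<lambda>x. of_real (u j x)))"
proof -
  have "weighted_norm p \<alpha> F \<le> (\<integral>\<^sup>+x. (\<Sum>j. ennreal ((norm (complex_of_real (u j x)) * \<bar>x\<bar> powr \<alpha>) powr p)) \<partial>lborel)"
    unfolding weighted_norm_def
  proof (rule nn_integral_mono)
    fix x
    define a where "a j = ennreal ((norm (complex_of_real (u j x)) * \<bar>x\<bar> powr \<alpha>) powr p)" for j
    have "ennreal ((norm (F x) * \<bar>x\<bar> powr \<alpha>) powr p) \<le> (\<Sum>j. a j)"
      using single_term[of x]
    proof
      assume "\<exists>j. F x = of_real (u j x)"
      then obtain j where "F x = of_real (u j x)" by blast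
      then have "ennreal ((norm (F x) * \<bar>x\<bar> powr \<alpha>) powr p) = (\<Sum>i\<in>{j}. a i)" by (simp add: a_def)
      also have "\<dots> \<le> (\<Sum>i. a i)" by (rule sum_le_suminf) auto
      finally show ?thesis .
    qed simp
    then show "ennreal ((norm (F x) * \<bar>x\<bar> powr \<alpha>) powr p) \<le> (\<Sum>j. ennreal ((norm (complex_of_real (u j x)) * \<bar>x\<bar> powr \<alpha>) powr p))"
      by (simp add: a_def)
  qed
  also have "\<dots> = (\<Sum>j. weighted_norm p \<alpha> (\<lambda>x. of_real (u j x)))"
    unfolding weighted_norm_def by (rule nn_integral_suminf) measurable
  finally show ?thesis .
qed

lemma norm_fourier_u_le: "norm (fourier (\<lambda>x. of_real (u j x)) \<xi>) \<le> (LINT x|lborel. \<bar>u j x\<bar>)"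
  using norm_fourier_le[OF integrable_of_real[OF int], of j \<xi>] by simp

lemma summable_fourier_u: "summable (\<lambda>j. norm (fourier (\<lambda>x. of_real (u j x)) \<xi>))"
  by (rule summable_comparison_test'[OF summ, of 0]) (use norm_fourier_u_le in auto)

lemma fourier_F: "fourier F \<xi> = (\<Sum>j. fourier (\<lambda>x. of_real (u j x)) \<xi>)"
proof -
  have ui: "integrable lborel (\<lambda>x. complex_of_real (u j x) * cis (- (2 * pi * x * \<xi>)))" for j
    by (rule integrable_mult_cis[OF integrable_of_real[OF int]]) measurable
  have "(\<Sum>j. fourier (\<lambda>x. of_real (u j x)) \<xi>) = (\<Sum>j. (LINT x|lborel. of_real (u j x) * cis (- (2 * pi * x * \<xi>))))"
    by (intro suminf_cong fourier_lborel) measurable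
  also have "\<dots> = (LINT x|lborel. (\<Sum>j. of_real (u j x) * cis (- (2 * pi * x * \<xi>))))"
    by (rule integral_suminf[symmetric]) (use ui summable_u summ in \<open>auto simp: norm_mult\<close>)
  also have "\<dots> = (LINT x|lborel. F x * cis (- (2 * pi * x * \<xi>)))"
  proof (intro Bochner_Integration.integral_cong refl)
    fix x
    have s: "summable (\<lambda>j. u j x)" using summable_u by (rule summable_norm_cancel)
    then have s': "summable (\<lambda>j. complex_of_real (u j x))" by (rule summable_of_real)
    show "(\<Sum>j. of_real (u j x) * cis (- (2 * pi * x * \<xi>))) = F x * cis (- (2 * pi * x * \<xi>))"
      unfolding F_def by (subst suminf_mult2[OF s', symmetric]) (simp add: suminf_of_real[OF s])
  qed
  also have "\<dots> = fourier F \<xi>" by (rule fourier_lborel[symmetric]) measurable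
  finally show ?thesis ..
qed

text \<open>In effect the triangle inequality in the weighted L^q space: the norms of the pieces are
  bounded by multiples of the summable \<open>b j\<close>, and these same numbers are the weights in
  \<open>powr_suminf_le\<close>.\<close>

lemma weighted_norm_fourier_F:
  assumes q: "q \<ge> 1" and b: "\<And>j. b j > 0" "summable b" and C: "C \<ge> 0"
    and le: "\<And>j. weighted_norm q \<beta> (fourier (\<lambda>x. of_real (u j x))) \<le> ennreal (C * b j powr q)"
  shows "weighted_norm q \<beta> (fourier F) < \<infinity>"
proof -
  define uh where "uh j = fourier (\<lambda>x. complex_of_real (u j x))" for j
  have [measurable]: "uh j \<in> borel_measurable borel" for j
    unfolding uh_def by (rule fourier_measurable[OF integrable_of_real[OF int]])
  define v where "v j \<xi> = norm (uh j \<xi>) * \<bar>\<xi>\<bar> powr \<beta>" for j \<xi>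
  have [measurable]: "v j \<in> borel_measurable borel" for j unfolding v_def by measurable
  have v0: "v j \<xi> \<ge> 0" for j \<xi> by (simp add: v_def)
  have vs: "summable (\<lambda>j. v j \<xi>)" for \<xi>
    unfolding v_def uh_def by (intro summable_mult2 summable_fourier_u)
  define K where "K = ennreal ((\<Sum>j. b j) powr (q - 1))"
  have "weighted_norm q \<beta> (fourier F) \<le> (\<integral>\<^sup>+\<xi>. K * (\<Sum>j. ennreal (b j powr (1 - q) * v j \<xi> powr q)) \<partial>lborel)"
    unfolding weighted_norm_def
  proof (rule nn_integral_mono)
    fix \<xi>
    have "norm (fourier F \<xi>) \<le> (\<Sum>j. norm (uh j \<xi>))"
      unfolding fourier_F uh_def by (rule summable_norm[OF summable_fourier_u])
    then have "norm (fourier F \<xi>) * \<bar>\<xi>\<bar> powr \<beta> \<le> (\<Sum>j. norm (uh j \<xi>)) * \<bar>\<xi>\<bar> powr \<beta>"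
      by (rule mult_right_mono) simp
    also have "\<dots> = (\<Sum>j. v j \<xi>)" unfolding v_def
      by (rule suminf_mult2) (unfold uh_def, rule summable_fourier_u)
    finally have "ennreal ((norm (fourier F \<xi>) * \<bar>\<xi>\<bar> powr \<beta>) powr q) \<le> ennreal ((\<Sum>j. v j \<xi>) powr q)"
      using q by (intro ennreal_leI powr_mono2) auto
    also have "\<dots> \<le> K * (\<Sum>j. ennreal (b j powr (1 - q) * v j \<xi> powr q))"
      unfolding K_def by (rule powr_suminf_le[OF q v0 vs b])
    finally show "ennreal ((norm (fourier F \<xi>) * \<bar>\<xi>\<bar> powr \<beta>) powr q) \<le> K * (\<Sum>j. ennreal (b j powr (1 - q) * v j \<xi> powr q))" .
  qed
  also have "\<dots> = K * (\<Sum>j. \<integral>\<^sup>+\<xi>. ennreal (b j powr (1 - q) * v j \<xi> powr q) \<partial>lborel)"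
    by (subst nn_integral_cmult, measurable) (subst nn_integral_suminf, measurable)
  also have "\<dots> \<le> K * (\<Sum>j. ennreal (C * b j))"
  proof (intro mult_left_mono suminf_le)
    fix j
    have "(\<integral>\<^sup>+\<xi>. ennreal (b j powr (1 - q) * v j \<xi> powr q) \<partial>lborel) = ennreal (b j powr (1 - q)) * weighted_norm q \<beta> (uh j)"
      unfolding weighted_norm_def v_def by (subst nn_integral_cmult[symmetric]) (auto simp: ennreal_mult)
    also have "\<dots> \<le> ennreal (b j powr (1 - q)) * ennreal (C * b j powr q)"
      unfolding uh_def by (rule mult_left_mono[OF le]) simp
    also have "\<dots> = ennreal (C * b j)"
      using C b(1)[of j] by (simp add: ennreal_mult[symmetric] powr_diff)
    finally show "(\<integral>\<^sup>+\<xi>. ennreal (b j powr (1 - q) * v j \<xi> powr q) \<partial>lborel) \<le> ennreal (C * b j)" .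
  qed auto
  also have "(\<Sum>j. ennreal (C * b j)) = ennreal (\<Sum>j. C * b j)"
    using C b by (intro suminf_ennreal2 summable_mult) (auto intro: mult_nonneg_nonneg less_imp_le)
  also have "K * \<dots> < \<infinity>" by (simp add: K_def ennreal_mult_less_top)
  finally show ?thesis .
qed

end

section \<open>Counterexamples\<close>

lemma weighted_norm_cmult:
  assumes [measurable]: "g \<in> borel_measurable borel" and p: "p \<ge> 0"
  shows "weighted_norm p \<alpha> (\<lambda>x. of_real c * g x) = ennreal (\<bar>c\<bar> powr p) * weighted_norm p \<alpha> g"
  unfolding weighted_norm_def
  by (subst nn_integral_cmult[symmetric]) (auto simp: norm_mult powr_mult ennreal_mult mult_ac intro!: nn_integral_cong)

lemma weighted_norm_diff:
  assumes [measurable]: "g \<in> borel_measurable borel" "h \<in> borel_measurable borel" and p: "p \<ge> 0"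
  shows "weighted_norm p \<alpha> (\<lambda>x. g x - h x) \<le> ennreal (2 powr p) * (weighted_norm p \<alpha> g + weighted_norm p \<alpha> h)"
proof -
  have "weighted_norm p \<alpha> (\<lambda>x. g x - h x) \<le> (\<integral>\<^sup>+x. ennreal (2 powr p) * (ennreal ((norm (g x) * \<bar>x\<bar> powr \<alpha>) powr p) + ennreal ((norm (h x) * \<bar>x\<bar> powr \<alpha>) powr p)) \<partial>lborel)"
    unfolding weighted_norm_def
  proof (rule nn_integral_mono)
    fix x :: real
    define a b where "a = norm (g x) * \<bar>x\<bar> powr \<alpha>" and "b = norm (h x) * \<bar>x\<bar> powr \<alpha>"
    have ab: "a \<ge> 0" "b \<ge> 0" by (auto simp: a_def b_def)
    have "norm (g x - h x) * \<bar>x\<bar> powr \<alpha> \<le> (norm (g x) + norm (h x)) * \<bar>x\<bar> powr \<alpha>"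
      by (intro mult_right_mono norm_triangle_ineq4) simp
    also have "\<dots> = a + b" by (simp add: a_def b_def distrib_right)
    also have "\<dots> \<le> 2 * max a b" by simp
    finally have "(norm (g x - h x) * \<bar>x\<bar> powr \<alpha>) powr p \<le> (2 * max a b) powr p" using p by (intro powr_mono2) auto
    also have "\<dots> = 2 powr p * max a b powr p" using ab by (intro powr_mult)
    also have "\<dots> \<le> 2 powr p * (a powr p + b powr p)" by (intro mult_left_mono) (auto simp: max_def)
    finally have "ennreal ((norm (g x - h x) * \<bar>x\<bar> powr \<alpha>) powr p) \<le> ennreal (2 powr p * (a powr p + b powr p))"
      by (rule ennreal_leI)
    also have "\<dots> = ennreal (2 powr p) * (ennreal (a powr p) + ennreal (b powr p))"
      by (simp add: ennreal_mult ennreal_plus)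
    finally show "ennreal ((norm (g x - h x) * \<bar>x\<bar> powr \<alpha>) powr p) \<le> ennreal (2 powr p) * (ennreal ((norm (g x) * \<bar>x\<bar> powr \<alpha>) powr p) + ennreal ((norm (h x) * \<bar>x\<bar> powr \<alpha>) powr p))"
      unfolding a_def b_def .
  qed
  also have "\<dots> = ennreal (2 powr p) * (weighted_norm p \<alpha> g + weighted_norm p \<alpha> h)"
    unfolding weighted_norm_def by (subst nn_integral_cmult, measurable) (subst nn_integral_add, measurable)
  finally show ?thesis .
qed

lemma ennreal_mult_plus:
  "a \<ge> 0 \<Longrightarrow> x \<ge> 0 \<Longrightarrow> y \<ge> 0 \<Longrightarrow> ennreal a * (ennreal x + ennreal y) = ennreal (a * (x + y))"
  by (simp add: ennreal_mult)

lemma fourier_cmult: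
  assumes [measurable]: "f \<in> borel_measurable borel"
  shows "fourier (\<lambda>x. c * f x) = (\<lambda>\<xi>. c * fourier f \<xi>)"
  by (rule ext) (simp add: fourier_lborel mult.assoc)

lemma fourier_diff:
  assumes f: "integrable lborel f" and g: "integrable lborel g"
  shows "fourier (\<lambda>x. f x - g x) = (\<lambda>\<xi>. fourier f \<xi> - fourier g \<xi>)"
proof
  fix \<xi>
  have [measurable]: "f \<in> borel_measurable borel" "g \<in> borel_measurable borel" using f g by auto
  have i: "integrable lborel (\<lambda>x. h x * cis (- (2 * pi * x * \<xi>)))" if "integrable lborel h" for h
    by (rule integrable_mult_cis[OF that]) measurable
  show "fourier (\<lambda>x. f x - g x) \<xi> = fourier f \<xi> - fourier g \<xi>"
    using Bochner_Integration.integral_diff[OF i[OF f] i[OF g]] by (simp add: fourier_lborel left_diff_distrib)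
qed

lemma suminf_ennreal_less_top:
  assumes "\<And>j. a j \<le> ennreal (c j)" "\<And>j. c j \<ge> 0" "summable c"
  shows "(\<Sum>j. a j) < \<infinity>"
proof -
  have "(\<Sum>j. a j) \<le> (\<Sum>j. ennreal (c j))" by (intro suminf_le assms) auto
  also have "\<dots> = ennreal (\<Sum>j. c j)" by (rule suminf_ennreal2) (use assms in auto)
  finally show ?thesis by (simp add: le_less_trans)
qed

lemma powr_4_nat: "(real (4 ^ j)) powr c = 4 powr (c * real j)"
proof -
  have "real (4 ^ j) = 4 powr real j" by (simp add: powr_realpow)
  then show ?thesis by (simp add: powr_powr mult.commute)
qed

lemma P_comb:
  assumes m: "m \<ge> 1" and W: "W \<ge> 1" and N: "N \<ge> 1" and M: "M \<ge> n + N"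
  shows "P_real M (comb m N n W) = 1"
proof -
  have "P_real M (comb m N n W) = (\<Sum>k\<in>{- int M..int M}. (\<Sum>a<N. \<Sum>b<N. if k = int n + int a - int b then 1 else 0) / (real N)\<^sup>2)"
    unfolding P_real_def comb_of_int[OF m W] ..
  also have "\<dots> = (\<Sum>a<N. \<Sum>b<N. \<Sum>k\<in>{- int M..int M}. if k = int n + int a - int b then 1 else 0) / (real N)\<^sup>2"
    unfolding sum_divide_distrib[symmetric]
    by (subst sum.swap, rule arg_cong[where f="\<lambda>x. x / _"], rule sum.cong[OF refl], rule sum.swap)
  also have "\<dots> = (\<Sum>a<N. \<Sum>b<N. 1) / (real N)\<^sup>2"
    using M by (intro arg_cong[where f="\<lambda>x. x / (real N)\<^sup>2"] sum.cong refl) auto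
  also have "\<dots> = 1" using N by (simp add: power2_eq_square)
  finally show ?thesis .
qed

text \<open>A bump of half-width 1/2 has the value 1 at the integer 0 and vanishes at all others, so
  its partial sums are constantly 1. \<open>poisson_critical\<close> with p = q = 1 and A = B = 2
  carries this limit to the transform; m \<ge> 4 gives the decay for which the weight \<xi>^2 is
  integrable.\<close>

lemma bump_poisson:
  assumes m: "m \<ge> 4"
  shows "(\<lambda>N. P N (\<lambda>\<xi>. bump_hat m (\<xi> / 2) / 2)) \<longlonglongrightarrow> 1"
proof -
  define v where "v x = complex_of_real (bump m (2 * (x - 0)))" for x
  have m1: "m \<ge> 1" using m by simp
  have vi: "integrable lborel v" unfolding v_def by (intro integrable_of_real bump_scaled_integral) simp
  have vh: "fourier v = (\<lambda>\<xi>. bump_hat m (\<xi> / 2) / 2)"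
    using bump_scaled_integral(3)[of 2 m 0] by (simp add: v_def[abs_def] fun_eq_iff)
  have vc: "continuous_on UNIV v"
    unfolding v_def by (intro continuous_intros continuous_on_compose2[OF continuous_on_bump[OF m1]]) auto
  have vhc: "continuous_on UNIV (fourier v)" by (rule continuous_on_fourier[OF vi])
  have wv: "integrable lborel (weight_tail 1 2 v 1)"
  proof -
    have "weight_tail 1 2 v 1 = (\<lambda>x. 0)"
      using bump_eq_0[OF m1] by (auto simp: weight_tail_def v_def fun_eq_iff split: split_indicator)
    then show ?thesis by simp
  qed
  obtain C where C: "C \<ge> 0" "\<And>\<xi>. norm (bump_hat m \<xi>) * (1 + \<xi>\<^sup>2) ^ 2 \<le> C"
    using bump_hat_decay[of 2 m] m by auto
  have wvh: "integrable lborel (weight_tail 1 2 (fourier v) 1)"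
  proof (rule Bochner_Integration.integrable_bound)
    have "integrable lborel (\<lambda>\<xi>. inverse (1 + (0 + (1/2 :: real) * \<xi>)\<^sup>2))"
      by (rule lborel_integrable_real_affine[OF integrable_inverse_1_plus_square']) simp
    then show "integrable lborel (\<lambda>\<xi>. 2 * C * inverse (1 + (\<xi> / 2)\<^sup>2))" by (intro integrable_mult_right) simp
    show "AE \<xi> in lborel. norm (weight_tail 1 2 (fourier v) 1 \<xi>) \<le> norm (2 * C * inverse (1 + (\<xi> / 2)\<^sup>2))"
    proof (intro AE_I2)
      fix \<xi> :: real
      define t where "t = \<xi> / 2"
      have t: "1 + t\<^sup>2 > 0" by (simp add: add_pos_nonneg)
      have "weight_tail 1 2 (fourier v) 1 \<xi> \<le> norm (bump_hat m t) / 2 * \<xi>\<^sup>2"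
        unfolding weight_tail_def vh t_def by (auto simp: norm_divide split: split_indicator)
      also have "\<dots> = 2 * (norm (bump_hat m t) * t\<^sup>2)" by (simp add: t_def power2_eq_square)
      also have "\<dots> \<le> 2 * (norm (bump_hat m t) * (1 + t\<^sup>2))" by (intro mult_left_mono) auto
      also have "\<dots> = 2 * (norm (bump_hat m t) * (1 + t\<^sup>2) ^ 2) * inverse (1 + t\<^sup>2)" using t by (simp add: power2_eq_square)
      also have "\<dots> \<le> 2 * C * inverse (1 + t\<^sup>2)" using C(2)[of t] t by (intro mult_right_mono mult_left_mono) auto
      finally show "norm (weight_tail 1 2 (fourier v) 1 \<xi>) \<le> norm (2 * C * inverse (1 + (\<xi> / 2)\<^sup>2))"
        using weight_tail_nonneg[of 1 2 "fourier v" 1 \<xi>] by (simp add: t_def)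
    qed
  qed (use borel_measurable_continuous_onI[OF vhc] in auto)
  have vhi: "integrable lborel (fourier v)"
    by (rule integrable_if_weight_tail[of 1 2])
       (use wvh borel_measurable_continuous_onI[OF vhc] borel_integrable_atLeastAtMost'[OF continuous_on_subset[OF vhc]] in auto)
  have "P N v = 1" for N
  proof -
    have "v (of_int k) = (if k = 0 then 1 else 0)" for k
      using bump_int[OF m1, of 2 k] by (simp add: v_def)
    then show ?thesis by (simp add: P_def)
  qed
  then have "tends_to_xlimit (\<lambda>N. P N v) (Finite 1)" by simp
  then have "tends_to_xlimit (\<lambda>N. P N (fourier v)) (Finite 1)"
    using poisson_critical[OF vi vhi vc, of 1 1 2 2 "Finite 1"] wv wvh by simp
  then show ?thesis by (simp add: vh)
qed

text \<open>The terms of the series telescope at the integers, on the Fourier side to a single bump.\<close>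
lemma subcritical_example:
  assumes p: "p \<ge> 1" and q: "q \<ge> 1" and \<alpha>: "\<alpha> - 1 + 1 / p > 0" and \<beta>: "\<beta> - 1 + 1 / q > 0"
    and AB: "(\<alpha> - 1 + 1 / p) * (\<beta> - 1 + 1 / q) < 1 / (p * q)"
  shows "\<exists>F. continuous_on UNIV F \<and> integrable lborel F \<and> weighted_norm p \<alpha> F < \<infinity> \<and> weighted_norm q \<beta> (fourier F) < \<infinity>
     \<and> (\<lambda>N. P N F) \<longlonglongrightarrow> 0 \<and> (\<lambda>N. P N (fourier F)) \<longlonglongrightarrow> 1"
proof -
  define A B where "A = \<alpha> - 1 + 1 / p" and "B = \<beta> - 1 + 1 / q"
  have pos: "A > 0" "B > 0" using \<alpha> \<beta> by (auto simp: A_def B_def)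
  have ip: "1 / p \<le> 1" "1 / q \<le> 1" using p q by auto
  have ab0: "\<alpha> \<ge> 0" "\<beta> \<ge> 0" using ip \<alpha> \<beta> by linarith+
  \<comment> \<open>The window for \<gamma> is reversed: with N = 4^j and W of order N^\<gamma>, the
    p-th power of the norm of a comb, N^(A p) / W, and the q-th power for its transform, W^(q B) /
    N, both decay geometrically.\<close>
  have "A * p < 1 / (q * B)" using AB pos p q unfolding A_def[symmetric] B_def[symmetric] by (simp add: field_simps)
  then obtain \<gamma> where \<gamma>: "A * p < \<gamma>" "\<gamma> < 1 / (q * B)" using dense by blast
  have \<gamma>0: "\<gamma> > 0" using \<gamma>(1) pos p by (smt (verit) mult_pos_pos)
  have \<gamma>1: "\<gamma> * q * B < 1" using \<gamma>(2) pos q by (simp add: field_simps)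
  \<comment> \<open>Large enough for a decay of the transform that dominates the weight, and at
    least 4 as \<open>bump_poisson\<close> demands.\<close>
  define m where "m = 2 * (nat \<lceil>\<beta>\<rceil> + 2)"
  have m1: "m \<ge> 1" "m \<ge> 4" "2 * (nat \<lceil>\<beta>\<rceil> + 1) \<le> m" by (auto simp: m_def)
  define W where "W j = 2 * 4 powr (\<gamma> * real j)" for j :: nat
  have Winv: "2 / W j = 4 powr (- \<gamma> * real j)" for j
  proof -
    have "4 powr (- \<gamma> * real j) = inverse (4 powr (\<gamma> * real j))" by (simp add: powr_minus)
    then show ?thesis by (simp add: W_def inverse_eq_divide)
  qed
  have W2: "W j \<ge> 2" for j using \<gamma>0 by (simp add: W_def ge_one_powr_ge_zero)
  have W0: "W j > 0" "W j \<ge> 1" for j using W2[of j] by linarith+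
  have Wmono: "W j \<le> W (Suc j)" for j using \<gamma>0 by (simp add: W_def)
  have WS: "W (Suc j) = 4 powr \<gamma> * W j" for j by (simp add: W_def powr_add[symmetric] distrib_left)
  define h where "h i j = comb m (4 ^ j) (2 * 4 ^ j) (W i)" for i j
  have hi: "integrable lborel (h i j)" for i j unfolding h_def by (rule comb_integrable[OF W0(1)])
  have [measurable]: "h i j \<in> borel_measurable borel" for i j using hi by auto
  \<comment> \<open>The two combs differ only in the width of their bumps, so they agree at all
    integers and \<open>u j\<close> vanishes there. The widths of consecutive j are chained, for the
    telescoping on the Fourier side.\<close>
  define u where "u j x = h j j x - h (Suc j) j x" for j x
  have hL1: "(LINT x|lborel. \<bar>h i j x\<bar>) \<le> 2 / W i" for i j
    using comb_integral_le[OF W0(1), of m "4 ^ j" "2 * 4 ^ j" i] by (simp add: h_def comb_nonneg)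
  have "disjoint_series u"
  proof
    show "continuous_on UNIV (u j)" for j
      unfolding u_def h_def by (intro continuous_intros continuous_on_comb m1)
    show "4 ^ j < x \<and> x < 4 ^ (j + 1)" if "u j x \<noteq> 0" for j x
    proof -
      have "h j j x \<noteq> 0 \<or> h (Suc j) j x \<noteq> 0" using that by (auto simp: u_def)
      then have "real (4 ^ j) < x \<and> x < 3 * real (4 ^ j)"
        unfolding h_def using comb_support[OF m1(1) W2, of "4 ^ j" _ x] by blast
      moreover have "3 * real (4 ^ j) < 4 ^ (j + 1)" by simp
      ultimately show ?thesis by simp
    qed
    show "integrable lborel (u j)" for j unfolding u_def by (intro Bochner_Integration.integrable_diff hi)
    show "summable (\<lambda>j. LINT x|lborel. \<bar>u j x\<bar>)"
    proof (rule summable_comparison_test'[where N=0])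
      show "summable (\<lambda>j. 2 * 4 powr (- \<gamma> * real j))" by (intro summable_mult summable_4_powr \<gamma>0)
      fix j
      have "(LINT x|lborel. \<bar>u j x\<bar>) \<le> (LINT x|lborel. \<bar>h j j x\<bar> + \<bar>h (Suc j) j x\<bar>)"
        using hi by (intro integral_mono) (auto simp: u_def intro!: Bochner_Integration.integrable_diff)
      also have "\<dots> = (LINT x|lborel. \<bar>h j j x\<bar>) + (LINT x|lborel. \<bar>h (Suc j) j x\<bar>)"
        using hi by (intro Bochner_Integration.integral_add) auto
      also have "\<dots> \<le> 2 / W j + 2 / W (Suc j)" by (intro add_mono hL1)
      also have "\<dots> \<le> 2 / W j + 2 / W j" using W0(1)[of j] Wmono[of j] by (intro add_mono frac_le) auto
      also have "\<dots> = 2 * 4 powr (- \<gamma> * real j)" unfolding Winv by simp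
      finally show "norm (LINT x|lborel. \<bar>u j x\<bar>) \<le> 2 * 4 powr (- \<gamma> * real j)" by simp
    qed
  qed
  then interpret disjoint_series u .
  have hc: "complex_of_real (u j x) = of_real (h j j x) - of_real (h (Suc j) j x)" for j x by (simp add: u_def)
  have wF: "weighted_norm p \<alpha> F < \<infinity>"
  proof (rule le_less_trans[OF weighted_norm_F suminf_ennreal_less_top])
    define C where "C = 2 powr p * (2 * 3 powr (\<alpha> * p))"
    \<comment> \<open>The terms are of size N^(A p) / W, that is 4^((A p - \<gamma>) j) up to
      constants.\<close>
    define \<delta> where "\<delta> = \<gamma> - A * p"
    show "summable (\<lambda>j. C * 4 powr (- \<delta> * real j))" using \<gamma> by (intro summable_mult summable_4_powr) (simp add: \<delta>_def)
    show "0 \<le> C * 4 powr (- \<delta> * real j)" for j by (simp add: C_def)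
    fix j
    define c where "c = 2 * 3 powr (\<alpha> * p) * 4 powr (p * A * real j)"
    have one: "weighted_norm p \<alpha> (\<lambda>x. of_real (h i j x)) \<le> ennreal (c / W i)" for i
      using comb_weighted_norm[OF m1(1) W2 _ p ab0(1), of "4 ^ j" i]
      unfolding weighted_norm_def h_def c_def A_def powr_4_nat by simp
    have "weighted_norm p \<alpha> (\<lambda>x. of_real (u j x)) \<le> ennreal (2 powr p) * (weighted_norm p \<alpha> (\<lambda>x. of_real (h j j x)) + weighted_norm p \<alpha> (\<lambda>x. of_real (h (Suc j) j x)))"
      unfolding hc by (rule weighted_norm_diff) (use p in auto)
    also have "\<dots> \<le> ennreal (2 powr p) * (ennreal (c / W j) + ennreal (c / W j))"
    proof (intro mult_left_mono add_mono one order_trans[OF one] ennreal_leI)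
      show "c / W (Suc j) \<le> c / W j" using W0(1)[of j] Wmono[of j] by (intro divide_left_mono) (auto simp: c_def W0)
    qed simp
    also have "\<dots> = ennreal (2 powr p * (c / W j + c / W j))"
      using W0(1)[of j] by (intro ennreal_mult_plus) (auto simp: c_def)
    also have "2 powr p * (c / W j + c / W j) = C * 4 powr (- \<delta> * real j)"
    proof -
      have xw: "4 powr (p * A * real j) / W j = 4 powr (- \<delta> * real j) / 2"
      proof -
        have "4 powr (- \<delta> * real j) = 4 powr (p * A * real j) / 4 powr (\<gamma> * real j)"
          unfolding \<delta>_def powr_diff[symmetric] by (rule arg_cong[where f="(powr) 4"]) (simp add: algebra_simps)
        then show ?thesis by (simp add: W_def)
      qed
      have cw: "c / W j = 2 * 3 powr (\<alpha> * p) * (4 powr (p * A * real j) / W j)" by (simp add: c_def)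
      have "c / W j = 3 powr (\<alpha> * p) * 4 powr (- \<delta> * real j)" unfolding cw xw by simp
      then show ?thesis by (simp add: C_def)
    qed
    finally show "weighted_norm p \<alpha> (\<lambda>x. of_real (u j x)) \<le> ennreal (C * 4 powr (- \<delta> * real j))" .
  qed
  obtain C where C: "C \<ge> 0" and Ch: "\<And>N n W. N \<ge> 1 \<Longrightarrow> W \<ge> 1 \<Longrightarrow>
    (\<integral>\<^sup>+\<xi>. ennreal ((norm (fourier (\<lambda>x. of_real (comb m N n W x)) \<xi>) * \<bar>\<xi>\<bar> powr \<beta>) powr q) \<partial>lborel)
    \<le> ennreal (C * W powr (q * (\<beta> - 1 + 1 / q)) / real N)"
    using fourier_comb_weighted_norm[OF q ab0(2) m1(3)] by blast
  have wFh: "weighted_norm q \<beta> (fourier F) < \<infinity>"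
  proof (rule weighted_norm_fourier_F[OF q])
    \<comment> \<open>Here the q-th powers of the norms are of size W^(q B) / N, that is
      4^((\<gamma> q B - 1) j); \<open>b\<close> is the q-th root.\<close>
    define \<delta> where "\<delta> = (1 - \<gamma> * q * B) / q"
    define b where "b j = 4 powr (- \<delta> * real j)" for j :: nat
    show "b j > 0" for j by (simp add: b_def)
    show "summable b" unfolding b_def using \<gamma>1 q by (intro summable_4_powr) (simp add: \<delta>_def)
    define D where "D = 2 powr q * (2 * (C * (2 * 4 powr \<gamma>) powr (q * B)))"
    show "D \<ge> 0" using C by (simp add: D_def)
    fix j
    define c where "c = C * (W (Suc j)) powr (q * B) / 4 ^ j"
    have one: "weighted_norm q \<beta> (fourier (\<lambda>x. of_real (h i j x))) \<le> ennreal c" if "i \<le> Suc j" "i \<ge> j" for i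
    proof -
      have "W i \<le> W (Suc j)" using that Wmono[of j] by (cases "i = j") (auto simp: le_Suc_eq)
      then have "W i powr (q * B) \<le> W (Suc j) powr (q * B)" using q pos W0(1)[of i] by (intro powr_mono2) auto
      then have "C * W i powr (q * B) / 4 ^ j \<le> c" unfolding c_def using C by (intro divide_right_mono mult_left_mono) auto
      moreover have "weighted_norm q \<beta> (fourier (\<lambda>x. of_real (h i j x))) \<le> ennreal (C * W i powr (q * B) / 4 ^ j)"
        using Ch[of "4 ^ j" "W i" "2 * 4 ^ j"] W0(2)[of i] unfolding weighted_norm_def h_def B_def by simp
      ultimately show ?thesis by (meson ennreal_leI order_trans)
    qed
    have hci: "integrable lborel (\<lambda>x. complex_of_real (h i j x))" for i by (intro integrable_of_real hi)
    have "weighted_norm q \<beta> (fourier (\<lambda>x. of_real (u j x))) \<le> ennreal (2 powr q) * (weighted_norm q \<beta> (fourier (\<lambda>x. of_real (h j j x))) + weighted_norm q \<beta> (fourier (\<lambda>x. of_real (h (Suc j) j x))))"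
      unfolding hc fourier_diff[OF hci hci]
      by (rule weighted_norm_diff) (use q fourier_measurable[OF hci] in auto)
    also have "\<dots> \<le> ennreal (2 powr q) * (ennreal c + ennreal c)"
      by (intro mult_left_mono add_mono one) auto
    also have "\<dots> = ennreal (2 powr q * (c + c))"
      using C by (intro ennreal_mult_plus) (auto simp: c_def)
    also have "2 powr q * (c + c) = D * b j powr q"
    proof -
      have 1: "W (Suc j) = (2 * 4 powr \<gamma>) * 4 powr (\<gamma> * real j)" unfolding WS by (simp add: W_def)
      have 2: "W (Suc j) powr (q * B) = (2 * 4 powr \<gamma>) powr (q * B) * 4 powr (\<gamma> * q * B * real j)"
        unfolding 1 by (subst powr_mult) (auto simp: powr_powr mult_ac)
      have 3: "b j powr q = 4 powr (\<gamma> * q * B * real j) / 4 ^ j"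
      proof -
        have "b j powr q = 4 powr (\<gamma> * q * B * real j - real j)"
          unfolding b_def powr_powr \<delta>_def using q by (intro arg_cong2[where f="(powr)"]) (auto simp: field_simps)
        then show ?thesis by (simp add: powr_diff powr_realpow)
      qed
      show ?thesis unfolding c_def D_def 2 3 by simp
    qed
    finally show "weighted_norm q \<beta> (fourier (\<lambda>x. of_real (u j x))) \<le> ennreal (D * b j powr q)" .
  qed
  have "F (of_int k) = 0" for k
  proof -
    have "u j (of_int k) = 0" for j
      unfolding u_def h_def comb_of_int[OF m1(1) W0(2)] by simp
    then show ?thesis by (simp add: F_def)
  qed
  then have PF: "P N F = 0" for N by (simp add: P_def)
  have Fh: "fourier F (of_int k) = bump_hat m (of_int k / 2) / 2" for k
  proof -
    \<comment> \<open>At an integer both the Fejer factor and the phase are 1, so the transform of a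
      comb depends only on its width. The series of differences then telescopes to the widest bump,
      the one with W = 2.\<close>
    define z where "z j = bump_hat m (of_int k / W j) / of_real (W j)" for j
    have cis1: "cis (- (2 * pi * real (2 * 4 ^ j) * of_int k)) = 1" for j
    proof -
      have "- (2 * pi * real (2 * 4 ^ j) * of_int k) = 2 * pi * of_int (- (2 * 4 ^ j * k))" by simp
      then show ?thesis by (simp only:) (rule cis_multiple_2pi, simp)
    qed
    have "fourier (\<lambda>x. of_real (h i j x)) (of_int k) = z i" for i j
      unfolding h_def fourier_comb[OF W0(1)] cis1 z_def by (subst fejer_of_int) auto
    then have uz: "fourier (\<lambda>x. of_real (u j x)) (of_int k) = z j - z (Suc j)" for j
      unfolding hc by (subst fourier_diff) (auto intro: integrable_of_real hi)
    have "z \<longlonglongrightarrow> 0"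
    proof (rule Lim_null_comparison)
      show "\<forall>\<^sub>F j in sequentially. norm (z j) \<le> 4 powr (- \<gamma> * real j)"
      proof (intro always_eventually allI)
        fix j
        have "norm (z j) \<le> 2 / W j"
          unfolding z_def norm_divide using W0(1)[of j] by (intro frac_le norm_bump_hat_le) auto
        also note Winv
        finally show "norm (z j) \<le> 4 powr (- \<gamma> * real j)" .
      qed
      show "(\<lambda>j. 4 powr (- \<gamma> * real j)) \<longlonglongrightarrow> 0" by (intro summable_LIMSEQ_zero summable_4_powr \<gamma>0)
    qed
    then have "(\<lambda>j. z j - z (Suc j)) sums (z 0 - 0)" by (rule telescope_sums')
    then have "fourier F (of_int k) = z 0" unfolding fourier_F uz by (simp add: sums_iff)
    then show ?thesis by (simp add: z_def W_def)
  qed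
  have "P N (fourier F) = P N (\<lambda>\<xi>. bump_hat m (\<xi> / 2) / 2)" for N
    unfolding P_def by (simp add: Fh)
  then have "(\<lambda>N. P N (fourier F)) \<longlonglongrightarrow> 1" using bump_poisson[OF m1(2)] by simp
  then show ?thesis using wF wFh PF continuous_on_F F_integrable by (intro exI[of _ F]) simp
qed

section \<open>A slowly oscillating sequence and the critical case\<close>

lemma abs_sin_diff_le: "\<bar>sin a - sin b\<bar> \<le> \<bar>a - b\<bar>" for a b :: real
proof -
  have "\<bar>sin a - sin b\<bar> = 2 * \<bar>sin ((a - b) / 2)\<bar> * \<bar>cos ((a + b) / 2)\<bar>"
    by (simp add: sin_diff_sin abs_mult)
  also have "\<dots> \<le> 2 * \<bar>(a - b) / 2\<bar> * 1"
    by (intro mult_mono mult_left_mono abs_sin_x_le_abs_x) auto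
  finally show ?thesis by simp
qed

text \<open>Every sin \<theta> with \<theta> \<ge> 0 is a limit point: the integer just above exp(2
  pi n + \<theta>) has a logarithm within exp(-(2 pi n + \<theta>)) of 2 pi n + \<theta>. The angles
  0 and pi/2 already contradict each other.\<close>

lemma sin_ln_divergent: "\<not> (\<lambda>j. sin (ln (real (j + 2)))) \<longlonglongrightarrow> L"
proof
  assume L: "(\<lambda>j. sin (ln (real (j + 2)))) \<longlonglongrightarrow> L"
  have "L = sin \<theta>" if \<theta>: "0 \<le> \<theta>" for \<theta>
  proof -
    define y where "y n = 2 * pi * real n + \<theta>" for n
    define c where "c n = nat \<lceil>exp (y n)\<rceil>" for n
    have ylim: "filterlim y at_top sequentially" unfolding y_def using pi_gt_zero by real_asymp
    have elim: "filterlim (\<lambda>n. exp (y n)) at_top sequentially" by (rule filterlim_compose[OF exp_at_top ylim])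
    have cb: "exp (y n) \<le> real (c n)" "real (c n) \<le> exp (y n) + 1" for n
    proof -
      have "exp (y n) > 0" by simp
      then show "exp (y n) \<le> real (c n)" "real (c n) \<le> exp (y n) + 1" unfolding c_def by linarith+
    qed
    have clim: "filterlim c at_top sequentially"
    proof -
      have "filterlim (\<lambda>n. nat \<lfloor>exp (y n)\<rfloor>) at_top sequentially"
        by (rule filterlim_compose[OF filterlim_nat_sequentially filterlim_compose[OF filterlim_floor_sequentially elim]])
      then show ?thesis by (rule filterlim_at_top_mono) (intro always_eventually allI, unfold c_def, intro nat_mono, linarith)
    qed
    have lnc: "\<bar>ln (real (c n)) - y n\<bar> \<le> exp (- y n)" for n
    proof -
      have cp: "real (c n) > 0" using cb(1)[of n] exp_gt_zero[of "y n"] by linarith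
      have "y n = ln (exp (y n))" by simp
      also have "\<dots> \<le> ln (real (c n))" using cb(1)[of n] cp by (subst ln_le_cancel_iff) auto
      finally have 1: "y n \<le> ln (real (c n))" .
      have "real (c n) \<le> exp (y n) * (1 + exp (- y n))" using cb(2)[of n] by (simp add: distrib_left exp_add[symmetric])
      then have "ln (real (c n)) \<le> ln (exp (y n) * (1 + exp (- y n)))"
        using cp by (subst ln_le_cancel_iff) (auto intro!: mult_pos_pos add_pos_pos)
      also have "\<dots> = y n + ln (1 + exp (- y n))" by (subst ln_mult_pos) (auto intro!: add_pos_pos)
      also have "ln (1 + exp (- y n)) \<le> exp (- y n)" by (rule ln_add_one_self_le_self) simp
      finally show ?thesis using 1 by simp
    qed
    have "(\<lambda>n. exp (- y n)) \<longlonglongrightarrow> 0"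
      using filterlim_compose[OF exp_at_bot filterlim_compose[OF filterlim_uminus_at_bot_at_top ylim]] .
    have "(\<lambda>n. sin (ln (real (c n))) - sin \<theta>) \<longlonglongrightarrow> 0"
    proof (rule Lim_null_comparison[OF _ \<open>(\<lambda>n. exp (- y n)) \<longlonglongrightarrow> 0\<close>], intro always_eventually allI)
      fix n
      have "sin (y n) = sin \<theta>"
        unfolding y_def using sin_int_2pin[of "int n"] cos_int_2pin[of "int n"] by (simp add: sin_add)
      then show "norm (sin (ln (real (c n))) - sin \<theta>) \<le> exp (- y n)"
        using abs_sin_diff_le[of "ln (real (c n))" "y n"] lnc[of n] by simp
    qed
    then have s1: "(\<lambda>n. sin (ln (real (c n)))) \<longlonglongrightarrow> sin \<theta>" by (simp add: LIM_zero_iff)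
    have L': "(\<lambda>j. sin (ln (real j))) \<longlonglongrightarrow> L" using L by (rule LIMSEQ_offset[where k=2])
    have "(\<lambda>n. sin (ln (real (c n)))) \<longlonglongrightarrow> L" by (rule filterlim_compose[OF L' clim])
    then show ?thesis using s1 LIMSEQ_unique by blast
  qed
  from this[of 0] this[of "pi / 2"] show False by simp
qed

lemma not_has_xlimit_if_subseq:
  assumes s: "\<And>j. s (r j) = of_real (sin (ln (real (j + 2))))" and r: "strict_mono r"
  shows "\<not> has_xlimit s"
proof
  assume "has_xlimit s"
  then obtain l where l: "tends_to_xlimit s l" by (auto simp: has_xlimit_def)
  have rl: "filterlim r at_top sequentially" by (rule filterlim_subseq[OF r])
  have re: "Re (s (r j)) = sin (ln (real (j + 2)))" for j by (simp add: s)
  show False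
  proof (cases l)
    case (Finite z)
    then have "s \<longlonglongrightarrow> z" using l by simp
    from tendsto_Re[OF filterlim_compose[OF this rl]] show False
      unfolding re using sin_ln_divergent by blast
  next
    case Plus_Infinity
    then have "filterlim (\<lambda>n. Re (s n)) at_top sequentially" using l by simp
    from filterlim_compose[OF this rl] have "\<forall>\<^sub>F j in sequentially. Re (s (r j)) \<ge> 2" by (simp add: filterlim_at_top)
    then obtain j where "Re (s (r j)) \<ge> 2" using eventually_happens by fastforce
    then show False unfolding re using sin_le_one[of "ln (real (j + 2))"] by linarith
  next
    case Minus_Infinity
    then have "filterlim (\<lambda>n. Re (s n)) at_bot sequentially" using l by simp
    from filterlim_compose[OF this rl] have "\<forall>\<^sub>F j in sequentially. Re (s (r j)) \<le> -2" by (simp add: filterlim_at_bot)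
    then obtain j where "Re (s (r j)) \<le> -2" using eventually_happens by fastforce
    then show False unfolding re using sin_ge_minus_one[of "ln (real (j + 2))"] by linarith
  qed
qed

text \<open>Slowly oscillating partial sums \<open>sin (ln j)\<close>; a small power of \<open>j\<close> in the width balances the
  norms, which is possible because \<open>p > 1\<close>.\<close>
lemma critical_example:
  assumes p: "p > 1" and q: "q \<ge> 1" and \<alpha>: "\<alpha> - 1 + 1 / p > 0" and \<beta>: "\<beta> - 1 + 1 / q > 0"
    and AB: "(\<alpha> - 1 + 1 / p) * (\<beta> - 1 + 1 / q) = 1 / (p * q)"
  shows "\<exists>F. continuous_on UNIV F \<and> integrable lborel F \<and> weighted_norm p \<alpha> F < \<infinity> \<and> weighted_norm q \<beta> (fourier F) < \<infinity>
     \<and> \<not> has_xlimit (\<lambda>N. P N F)"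
proof -
  define A B where "A = \<alpha> - 1 + 1 / p" and "B = \<beta> - 1 + 1 / q"
  have pos: "A > 0" "B > 0" using \<alpha> \<beta> by (auto simp: A_def B_def)
  have ip: "1 / p \<le> 1" "1 / q \<le> 1" using p q by auto
  have ab0: "\<alpha> \<ge> 0" "\<beta> \<ge> 0" using ip \<alpha> \<beta> by linarith+
  have AB1: "A * p * (q * B) = 1" using AB p q unfolding A_def[symmetric] B_def[symmetric] by (simp add: field_simps)
  define m where "m = 2 * (nat \<lceil>\<beta>\<rceil> + 2)"
  have m1: "m \<ge> 1" "2 * (nat \<lceil>\<beta>\<rceil> + 1) \<le> m" by (auto simp: m_def)
  define a where "a = A * p"
  have a: "a > 0" using pos p by (simp add: a_def)
  \<comment> \<open>Any value strictly between 0 and p - 1 would do. The coefficients are O(1/j), so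
    the terms for \<open>F\<close> are of size j^(s-p), summable for s < p - 1, while the norms on
    the Fourier side are of size j^(-1 - s B), summable for s > 0.\<close>
  define s where "s = (p - 1) / 2"
  have s: "s > 0" using p by (simp add: s_def)
  have "(\<lambda>j::nat. (real j + 1) powr s * 4 powr (- (a / 2) * real j)) \<longlonglongrightarrow> 0" using s a by real_asymp
  then have "Bseq (\<lambda>j::nat. (real j + 1) powr s * 4 powr (- (a / 2) * real j))" by (intro convergent_imp_Bseq convergentI)
  then obtain K where K: "K > 0" "\<And>j. norm ((real j + 1) powr s * 4 powr (- (a / 2) * real j)) \<le> K"
    unfolding Bseq_def by blast
  \<comment> \<open>An exponential absorbs the power of j, so with \<open>K\<close> as a factor in
    the width, \<open>W j\<close> is at least 2 and still grows exponentially in spite of the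
    damping j^(-s).\<close>
  have Kb: "(real j + 1) powr s \<le> K * 4 powr (a / 2 * real j)" for j
  proof -
    have "(real j + 1) powr s * 4 powr (- (a / 2) * real j) * 4 powr (a / 2 * real j) \<le> K * 4 powr (a / 2 * real j)"
      using K(2)[of j] by (intro mult_right_mono) auto
    moreover have "4 powr (- (a / 2) * real j) * 4 powr (a / 2 * real j) = 1"
      unfolding powr_add[symmetric] by simp
    ultimately show ?thesis by (simp only: mult.assoc mult_1_right)
  qed
  define W where "W j = 2 * K * 4 powr (a * real j) * (real j + 1) powr (- s)" for j :: nat
  have Wge: "2 * 4 powr (a / 2 * real j) \<le> W j" for j
  proof -
    have e: "4 powr (a * real j) = 4 powr (a / 2 * real j) * 4 powr (a / 2 * real j)"
      unfolding powr_add[symmetric] by simp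
    have i: "(real j + 1) powr s * (real j + 1) powr (- s) = 1" unfolding powr_add[symmetric] by simp
    have "(real j + 1) powr s * (2 * 4 powr (a / 2 * real j) * (real j + 1) powr (- s)) \<le> K * 4 powr (a / 2 * real j) * (2 * 4 powr (a / 2 * real j) * (real j + 1) powr (- s))"
      by (intro mult_right_mono Kb) auto
    also have "(real j + 1) powr s * (2 * 4 powr (a / 2 * real j) * (real j + 1) powr (- s)) = 2 * 4 powr (a / 2 * real j) * ((real j + 1) powr s * (real j + 1) powr (- s))"
      by (simp only: mult_ac)
    also have "K * 4 powr (a / 2 * real j) * (2 * 4 powr (a / 2 * real j) * (real j + 1) powr (- s)) = W j"
      unfolding W_def e by (simp only: mult_ac)
    finally show ?thesis unfolding i by simp
  qed
  have W2: "W j \<ge> 2" for j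
  proof -
    have "1 \<le> 4 powr (a / 2 * real j)" using a by (simp add: ge_one_powr_ge_zero)
    then show ?thesis using Wge[of j] by linarith
  qed
  have W0: "W j > 0" "W j \<ge> 1" for j using W2[of j] by linarith+
  have Winv: "1 / W j \<le> 4 powr (- (a / 2) * real j)" for j
  proof -
    have "1 / W j \<le> 1 / (4 powr (a / 2 * real j))"
      using Wge[of j] by (intro divide_left_mono mult_pos_pos W0) (auto intro: order_trans[OF _ Wge])
    also have "\<dots> = 4 powr (- (a / 2) * real j)"
      unfolding mult_minus_left powr_minus by (simp add: inverse_eq_divide)
    finally show ?thesis .
  qed
  \<comment> \<open>Increments of sin (ln (j + 1)), so that partial sums of the coefficients
    telescope to a bounded divergent sequence while the coefficients themselves are O(1/j).\<close>
  define \<epsilon> where "\<epsilon> j = sin (ln (real (j + 2))) - sin (ln (real (j + 1)))" for j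
  have \<epsilon>: "\<bar>\<epsilon> j\<bar> \<le> 1 / (real j + 1)" for j
  proof -
    have "\<bar>\<epsilon> j\<bar> \<le> \<bar>ln (real (j + 2)) - ln (real (j + 1))\<bar>" unfolding \<epsilon>_def by (rule abs_sin_diff_le)
    also have "\<dots> = ln (real (j + 2)) - ln (real (j + 1))" by simp
    also have "\<dots> = ln (real (j + 2) / real (j + 1))" by (simp add: ln_div)
    also have "real (j + 2) / real (j + 1) = 1 + 1 / (real j + 1)" by (simp add: field_simps)
    also have "ln (1 + 1 / (real j + 1)) \<le> 1 / (real j + 1)" by (rule ln_add_one_self_le_self) simp
    finally show ?thesis .
  qed
  have \<epsilon>1: "\<bar>\<epsilon> j\<bar> \<le> 1" for j using \<epsilon>[of j] by (rule order_trans) simp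
  define h where "h j = comb m (4 ^ j) (2 * 4 ^ j) (W j)" for j
  have hi: "integrable lborel (h j)" for j unfolding h_def by (rule comb_integrable[OF W0(1)])
  have hm [measurable]: "h j \<in> borel_measurable borel" for j using hi by auto
  define u where "u j x = \<epsilon> j * h j x" for j x
  have usupp: "4 ^ j < x \<and> x < 3 * 4 ^ j" if "u j x \<noteq> 0" for j x
  proof -
    have "h j x \<noteq> 0" using that by (auto simp: u_def)
    then show ?thesis unfolding h_def using comb_support[OF m1(1) W2, of "4 ^ j" _ x] by simp
  qed
  have "disjoint_series u"
  proof
    show "continuous_on UNIV (u j)" for j
      unfolding u_def h_def by (intro continuous_intros continuous_on_comb m1)
    show "4 ^ j < x \<and> x < 4 ^ (j + 1)" if "u j x \<noteq> 0" for j x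
      using usupp[OF that] by (simp add: order.strict_trans2)
    show "integrable lborel (u j)" for j unfolding u_def by (intro integrable_mult_right hi)
    show "summable (\<lambda>j. LINT x|lborel. \<bar>u j x\<bar>)"
    proof (rule summable_comparison_test'[where N=0])
      show "summable (\<lambda>j. 2 * 4 powr (- (a / 2) * real j))" using a by (intro summable_mult summable_4_powr) simp
      fix j
      have "(LINT x|lborel. \<bar>u j x\<bar>) = \<bar>\<epsilon> j\<bar> * (LINT x|lborel. h j x)"
        unfolding u_def abs_mult by (simp add: h_def comb_nonneg)
      also have "\<dots> \<le> 1 * (2 / W j)"
        unfolding h_def by (intro mult_mono \<epsilon>1 comb_integral_le W0) (auto intro: Bochner_Integration.integral_nonneg comb_nonneg)
      also have "\<dots> = 2 * (1 / W j)" by simp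
      also have "\<dots> \<le> 2 * 4 powr (- (a / 2) * real j)" by (intro mult_left_mono Winv) simp
      finally show "norm (LINT x|lborel. \<bar>u j x\<bar>) \<le> 2 * 4 powr (- (a / 2) * real j)" by simp
    qed
  qed
  then interpret disjoint_series u .
  have hc: "(\<lambda>x. complex_of_real (u j x)) = (\<lambda>x. of_real (\<epsilon> j) * of_real (h j x))" for j by (simp add: u_def)
  have wF: "weighted_norm p \<alpha> F < \<infinity>"
  proof (rule le_less_trans[OF weighted_norm_F suminf_ennreal_less_top])
    define C where "C = 3 powr (\<alpha> * p) / K"
    have C: "C \<ge> 0" using K by (simp add: C_def)
    have "summable (\<lambda>j. real (Suc j) powr (s - p))"
      using p by (subst summable_Suc_iff) (simp add: summable_real_powr_iff s_def field_simps)
    then show "summable (\<lambda>j. C * (real j + 1) powr (s - p))" by (intro summable_mult) (simp add: add.commute)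
    show "0 \<le> C * (real j + 1) powr (s - p)" for j using C by simp
    fix j
    have "weighted_norm p \<alpha> (\<lambda>x. of_real (u j x)) = ennreal (\<bar>\<epsilon> j\<bar> powr p) * weighted_norm p \<alpha> (\<lambda>x. of_real (h j x))"
      unfolding hc by (rule weighted_norm_cmult) (use p in auto)
    also have "\<dots> \<le> ennreal (\<bar>\<epsilon> j\<bar> powr p) * ennreal (2 * 3 powr (\<alpha> * p) * 4 powr (p * A * real j) / W j)"
      using comb_weighted_norm[OF m1(1) W2 _ less_imp_le[OF p] ab0(1), of "4 ^ j" j]
      unfolding weighted_norm_def h_def A_def powr_4_nat by (intro mult_left_mono) auto
    also have "\<dots> = ennreal (\<bar>\<epsilon> j\<bar> powr p * (2 * 3 powr (\<alpha> * p) * 4 powr (p * A * real j) / W j))"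
      using W0(1)[of j] by (intro ennreal_mult[symmetric]) auto
    also have "\<dots> \<le> ennreal (C * (real j + 1) powr (s - p))"
    proof (rule ennreal_leI)
      have "2 * 3 powr (\<alpha> * p) * 4 powr (p * A * real j) / W j = C * (real j + 1) powr s"
      proof -
        define Y S where "Y = 4 powr (a * real j)" and "S = (real j + 1) powr s"
        have YS: "Y > 0" "S > 0" by (auto simp: Y_def S_def)
        have Y: "4 powr (p * A * real j) = Y" by (simp add: Y_def a_def mult_ac)
        have W: "W j = 2 * K * Y * inverse S" by (simp add: W_def Y_def S_def powr_minus)
        show ?thesis unfolding W Y C_def S_def[symmetric] using K YS by (simp add: field_simps)
      qed
      moreover have "\<bar>\<epsilon> j\<bar> powr p \<le> (real j + 1) powr (- p)"
      proof -
        have "\<bar>\<epsilon> j\<bar> powr p \<le> (1 / (real j + 1)) powr p" using p \<epsilon>[of j] by (intro powr_mono2) auto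
        then show ?thesis by (simp add: powr_divide powr_minus_divide)
      qed
      ultimately have "\<bar>\<epsilon> j\<bar> powr p * (2 * 3 powr (\<alpha> * p) * 4 powr (p * A * real j) / W j) \<le> (real j + 1) powr (- p) * (C * (real j + 1) powr s)"
        using C by (simp add: mult_right_mono)
      also have "\<dots> = C * ((real j + 1) powr (- p) * (real j + 1) powr s)" by simp
      also have "(real j + 1) powr (- p) * (real j + 1) powr s = (real j + 1) powr (s - p)"
        unfolding powr_add[symmetric] by simp
      finally show "\<bar>\<epsilon> j\<bar> powr p * (2 * 3 powr (\<alpha> * p) * 4 powr (p * A * real j) / W j) \<le> C * (real j + 1) powr (s - p)" .
    qed
    finally show "weighted_norm p \<alpha> (\<lambda>x. of_real (u j x)) \<le> ennreal (C * (real j + 1) powr (s - p))" .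
  qed
  obtain C where C: "C \<ge> 0" and Ch: "\<And>N n W. N \<ge> 1 \<Longrightarrow> W \<ge> 1 \<Longrightarrow>
    (\<integral>\<^sup>+\<xi>. ennreal ((norm (fourier (\<lambda>x. of_real (comb m N n W x)) \<xi>) * \<bar>\<xi>\<bar> powr \<beta>) powr q) \<partial>lborel)
    \<le> ennreal (C * W powr (q * (\<beta> - 1 + 1 / q)) / real N)"
    using fourier_comb_weighted_norm[OF q ab0(2) m1(2)] by blast
  have wFh: "weighted_norm q \<beta> (fourier F) < \<infinity>"
  proof (rule weighted_norm_fourier_F[OF q])
    define b where "b j = (real j + 1) powr (- 1 - s * B)" for j :: nat
    show "b j > 0" for j by (simp add: b_def)
    have "summable (\<lambda>j. real (Suc j) powr (- 1 - s * B))"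
      using s pos by (subst summable_Suc_iff) (simp add: summable_real_powr_iff)
    then show "summable b" unfolding b_def by (simp add: add.commute)
    define D where "D = C * (2 * K) powr (q * B)"
    show "D \<ge> 0" using C by (simp add: D_def)
    fix j
    have hci: "integrable lborel (\<lambda>x. complex_of_real (h j x))" by (intro integrable_of_real hi)
    have "weighted_norm q \<beta> (fourier (\<lambda>x. of_real (u j x))) = ennreal (\<bar>\<epsilon> j\<bar> powr q) * weighted_norm q \<beta> (fourier (\<lambda>x. of_real (h j x)))"
      unfolding hc by (subst fourier_cmult, measurable, rule weighted_norm_cmult) (use q fourier_measurable[OF hci] in auto)
    also have "\<dots> \<le> ennreal (\<bar>\<epsilon> j\<bar> powr q) * ennreal (C * W j powr (q * B) / 4 ^ j)"
      using Ch[of "4 ^ j" "W j" "2 * 4 ^ j"] W0(2)[of j] unfolding weighted_norm_def h_def B_def by (intro mult_left_mono) auto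
    also have "\<dots> = ennreal (\<bar>\<epsilon> j\<bar> powr q * (C * W j powr (q * B) / 4 ^ j))"
      using C by (intro ennreal_mult[symmetric]) auto
    also have "\<dots> \<le> ennreal (D * b j powr q)"
    proof (rule ennreal_leI)
      have "W j powr (q * B) = (2 * K) powr (q * B) * 4 powr (a * (q * B) * real j) * (real j + 1) powr (- s * (q * B))"
        unfolding W_def using K by (simp add: powr_mult powr_powr mult_ac)
      also have "4 powr (a * (q * B) * real j) = 4 ^ j"
        unfolding a_def AB1 by (simp add: powr_realpow)
      finally have Wp: "C * W j powr (q * B) / 4 ^ j = D * (real j + 1) powr (- s * (q * B))" by (simp add: D_def)
      have "\<bar>\<epsilon> j\<bar> powr q \<le> (1 / (real j + 1)) powr q" using q \<epsilon>[of j] by (intro powr_mono2) auto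
      also have "\<dots> = (real j + 1) powr (- q)" by (simp add: powr_divide powr_minus_divide)
      finally have "\<bar>\<epsilon> j\<bar> powr q * (C * W j powr (q * B) / 4 ^ j) \<le> (real j + 1) powr (- q) * (D * (real j + 1) powr (- s * (q * B)))"
        unfolding Wp using \<open>D \<ge> 0\<close> by (intro mult_right_mono) auto
      also have "\<dots> = D * ((real j + 1) powr (- q) * (real j + 1) powr (- s * (q * B)))" by simp
      also have "(real j + 1) powr (- q) * (real j + 1) powr (- s * (q * B)) = b j powr q"
        unfolding powr_add[symmetric] b_def powr_powr by (rule arg_cong[where f="(powr) (real j + 1)"]) (simp add: algebra_simps)
      finally show "\<bar>\<epsilon> j\<bar> powr q * (C * W j powr (q * B) / 4 ^ j) \<le> D * b j powr q" .
    qed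
    finally show "weighted_norm q \<beta> (fourier (\<lambda>x. of_real (u j x))) \<le> ennreal (D * b j powr q)" .
  qed
  \<comment> \<open>At 3 * 4^j the combs up to index j are complete, each with total 1 over the
    integers, and the next one starts only beyond 4^(j+1).\<close>
  have PF: "P (3 * 4 ^ j) F = of_real (sin (ln (real (j + 2))))" for j
  proof -
    define M :: nat where "M = 3 * 4 ^ j"
    have Mlt: "M < 4 ^ Suc j" by (simp add: M_def)
    have "P M F = (\<Sum>k\<in>{- int M..int M}. of_real (\<Sum>i<Suc j. u i (of_int k)))"
      unfolding P_def
    proof (intro sum.cong refl F_eq_sum)
      fix k assume "k \<in> {- int M..int M}"
      then have "real_of_int k \<le> real M" by auto
      also have "\<dots> < real (4 ^ Suc j)" using Mlt by (simp only: of_nat_less_iff)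
      finally show "real_of_int k < 4 ^ Suc j" by simp
    qed
    also have "\<dots> = of_real (\<Sum>i<Suc j. \<epsilon> i * P_real M (h i))"
      unfolding of_real_sum[symmetric] P_real_def u_def sum_distrib_left by (subst sum.swap) simp
    also have "(\<Sum>i<Suc j. \<epsilon> i * P_real M (h i)) = (\<Sum>i<Suc j. \<epsilon> i)"
    proof (intro sum.cong refl)
      fix i assume "i \<in> {..<Suc j}"
      then have "(4::nat) ^ i \<le> 4 ^ j" by (intro power_increasing) auto
      then have "P_real M (h i) = 1" unfolding h_def by (intro P_comb m1 W0) (auto simp: M_def)
      then show "\<epsilon> i * P_real M (h i) = \<epsilon> i" by simp
    qed
    also have "\<dots> = sin (ln (real (j + 2)))"
    proof -
      have "(\<Sum>i<n. \<epsilon> i) = sin (ln (real (n + 1)))" for n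
        by (induction n) (simp_all add: \<epsilon>_def add_ac)
      from this[of "Suc j"] show ?thesis by simp
    qed
    finally show ?thesis unfolding M_def .
  qed
  have "strict_mono (\<lambda>j::nat. 3 * 4 ^ j :: nat)" by (simp add: strict_mono_Suc_iff)
  with PF have "\<not> has_xlimit (\<lambda>N. P N F)" by (rule not_has_xlimit_if_subseq)
  then show ?thesis using wF wFh continuous_on_F F_integrable by blast
qed

section \<open>The weighted condition\<close>

lemma cont_rep_eqI:
  assumes "continuous_on UNIV g" "AE x in lborel. f x = g x"
  shows "cont_rep f = g"
  unfolding cont_rep_def
proof (rule the_equality)
  have "AE x in lborel. g x = f x" using assms(2) by eventually_elim simp
  then show "continuous_on UNIV g \<and> (AE x in lebesgue. g x = f x)"
    using assms(1) by (auto intro: AE_completion)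
  fix h assume h: "continuous_on UNIV h \<and> (AE x in lebesgue. h x = f x)"
  then have "AE x in lborel. h x = f x" by (simp add: AE_completion_iff)
  then have "AE x in lborel. h x = g x" using assms(2) by eventually_elim simp
  then show "h = g" using h assms(1) continuous_AE_eq by blast
qed

lemma Lp_norm_weight_iff:
  assumes "p \<noteq> \<infinity>"
  shows "Lp_norm p (\<lambda>x. f x * of_real (\<bar>x\<bar> powr \<alpha>)) < \<infinity> \<longleftrightarrow> weighted_norm (enn2real p) \<alpha> f < \<infinity>"
proof -
  have e: "(\<integral>\<^sup>+x. ennreal (norm (f x * of_real (\<bar>x\<bar> powr \<alpha>)) powr enn2real p) \<partial>lebesgue) = weighted_norm (enn2real p) \<alpha> f"
    unfolding weighted_norm_def by (simp add: nn_integral_completion norm_mult)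
  show ?thesis
    using assms by (simp only: Lp_norm_def if_False Let_def e) (simp add: less_top)
qed

lemma weighted_conditionI:
  assumes c: "continuous_on UNIV F" and pq: "p \<noteq> \<infinity>" "q \<noteq> \<infinity>"
    and w: "weighted_norm (enn2real p) \<alpha> F < \<infinity>" "weighted_norm (enn2real q) \<beta> (fourier F) < \<infinity>"
  shows "weighted_condition p q \<alpha> \<beta> F"
  unfolding weighted_condition_def
proof
  show "locally_integrable F"
    unfolding locally_integrable_def set_integrable_def
  proof (intro allI impI)
    fix K :: "real set" assume K: "compact K"
    have "integrable lborel (\<lambda>x. indicator K x *\<^sub>R F x)"
      by (rule borel_integrable_compact[OF K continuous_on_subset[OF c]]) auto
    then show "integrable lebesgue (\<lambda>x. indicat_real K x *\<^sub>R F x)"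
      by (subst integrable_completion) auto
  qed
  show "Lp_norm p (\<lambda>x. F x * of_real (\<bar>x\<bar> powr \<alpha>)) + Lp_norm q (\<lambda>\<xi>. fourier F \<xi> * of_real (\<bar>\<xi>\<bar> powr \<beta>)) < \<infinity>"
    using w Lp_norm_weight_iff[OF pq(1)] Lp_norm_weight_iff[OF pq(2)] by simp
qed

lemma weight_tail_if_weighted_norm:
  assumes [measurable]: "g \<in> borel_measurable borel" and p: "p \<ge> 1" and w: "weighted_norm p \<alpha> g < \<infinity>"
  shows "integrable lborel (weight_tail p (\<alpha> - 1 + 1 / p) g 1)"
proof (rule integrableI_nonneg)
  have "(\<integral>\<^sup>+x. ennreal (weight_tail p (\<alpha> - 1 + 1 / p) g 1 x) \<partial>lborel) \<le> weighted_norm p \<alpha> g"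
    unfolding weighted_norm_def
  proof (intro nn_integral_mono ennreal_leI)
    fix x :: real
    have "(\<alpha> - 1 + 1 / p) * p + p - 1 = \<alpha> * p" using p by (simp add: field_simps)
    then show "weight_tail p (\<alpha> - 1 + 1 / p) g 1 x \<le> (norm (g x) * \<bar>x\<bar> powr \<alpha>) powr p"
      by (simp add: weight_tail_def powr_mult powr_powr split: split_indicator)
  qed
  then show "(\<integral>\<^sup>+x. ennreal (weight_tail p (\<alpha> - 1 + 1 / p) g 1 x) \<partial>lborel) < \<infinity>" using w by (rule le_less_trans)
qed (auto simp: weight_tail_nonneg)

text \<open>A sup bound yields finite exponents at the price of a strict loss in the weight: the gap
  \<alpha> - 1 - A > 0 leaves a power of |x| below -1, integrable at infinity.\<close>

lemma weight_tail_if_bounded: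
  assumes [measurable]: "g \<in> borel_measurable borel" and p: "p \<ge> 1" and A: "A < \<alpha> - 1"
    and b: "AE x in lborel. norm (g x) * \<bar>x\<bar> powr \<alpha> \<le> K"
  shows "integrable lborel (weight_tail p A g 1)"
proof (rule Bochner_Integration.integrable_bound)
  define s where "s = 1 + (\<alpha> - 1 - A) * p"
  have "s > 1" using A p by (simp add: s_def)
  then show "integrable lborel (\<lambda>x. K powr p * (indicator {x. 1 \<le> \<bar>x\<bar>} x * \<bar>x\<bar> powr (- s)))"
    by (intro integrable_mult_right powr_tail_integrable)
  show "AE x in lborel. norm (weight_tail p A g 1 x) \<le> norm (K powr p * (indicator {x. 1 \<le> \<bar>x\<bar>} x * \<bar>x\<bar> powr (- s)))"
    using b
  proof eventually_elim
    case (elim x)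
    show ?case
    proof (cases "1 \<le> \<bar>x\<bar>")
      case True
      have "(norm (g x) * \<bar>x\<bar> powr \<alpha>) powr p \<le> K powr p" using elim p by (intro powr_mono2) auto
      then have "(norm (g x) * \<bar>x\<bar> powr \<alpha>) powr p * \<bar>x\<bar> powr (- s) \<le> K powr p * \<bar>x\<bar> powr (- s)"
        by (rule mult_right_mono) simp
      moreover have "(norm (g x) * \<bar>x\<bar> powr \<alpha>) powr p * \<bar>x\<bar> powr (- s) = weight_tail p A g 1 x"
      proof -
        have "(norm (g x) * \<bar>x\<bar> powr \<alpha>) powr p * \<bar>x\<bar> powr (- s) = norm (g x) powr p * (\<bar>x\<bar> powr (\<alpha> * p) * \<bar>x\<bar> powr (- s))"
          by (simp add: powr_mult powr_powr)
        also have "\<bar>x\<bar> powr (\<alpha> * p) * \<bar>x\<bar> powr (- s) = \<bar>x\<bar> powr (A * p + p - 1)"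
          unfolding powr_add[symmetric] by (rule arg_cong[where f="(powr) \<bar>x\<bar>"]) (simp add: s_def algebra_simps)
        finally show ?thesis using True by (simp add: weight_tail_def)
      qed
      ultimately show ?thesis using True weight_tail_nonneg[of p A g 1 x] by simp
    qed (simp add: weight_tail_def)
  qed
qed measurable

text \<open>For \<open>p = \<infinity>\<close> the condition is traded for all finite exponents with a slightly smaller weight.\<close>
definition tail_ok :: "ennreal \<Rightarrow> real \<Rightarrow> (real \<Rightarrow> complex) \<Rightarrow> bool" where
  "tail_ok p \<alpha> g \<longleftrightarrow>
    (if p = \<infinity> then \<forall>r\<ge>1. \<forall>A<\<alpha> - 1. integrable lborel (weight_tail r A g 1)
     else integrable lborel (weight_tail (enn2real p) (\<alpha> - 1 + 1 / enn2real p) g 1))"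

lemma enn2real_ge_1: "1 \<le> p \<Longrightarrow> p \<noteq> \<infinity> \<Longrightarrow> 1 \<le> enn2real p"
  by (cases p) (auto simp: ennreal_ge_1)

lemma enn2real_inverse: "1 \<le> p \<Longrightarrow> p \<noteq> \<infinity> \<Longrightarrow> enn2real (1 / p) = 1 / enn2real p"
proof -
  assume p: "1 \<le> p" "p \<noteq> \<infinity>"
  then obtain r where r: "p = ennreal r" "r \<ge> 0" by (cases p) auto
  then have "r \<ge> 1" using p by (simp add: ennreal_ge_1)
  then have "1 / p = ennreal (1 / r)" using r divide_ennreal[of 1 r] by simp
  then show ?thesis using r \<open>r \<ge> 1\<close> by simp
qed

lemma tail_okI:
  assumes p: "1 \<le> p" and gm [measurable]: "g \<in> borel_measurable borel" and ae: "AE x in lborel. f x = g x"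
    and w: "Lp_norm p (\<lambda>x. f x * of_real (\<bar>x\<bar> powr \<alpha>)) < \<infinity>"
  shows "tail_ok p \<alpha> g"
proof (cases "p = \<infinity>")
  case True
  define E where "E = esssup lebesgue (\<lambda>x. ennreal (norm (f x * of_real (\<bar>x\<bar> powr \<alpha>))))"
  have "E < \<infinity>" using w True by (simp add: Lp_norm_def E_def)
  then obtain K where K: "E = ennreal K" "K \<ge> 0" by (cases E) auto
  have "AE x in lebesgue. ennreal (norm (f x * of_real (\<bar>x\<bar> powr \<alpha>))) \<le> E"
    unfolding E_def by (rule esssup_AE)
  then have "AE x in lborel. ennreal (norm (f x * of_real (\<bar>x\<bar> powr \<alpha>))) \<le> E" by (simp add: AE_completion_iff)
  then have "AE x in lborel. norm (g x) * \<bar>x\<bar> powr \<alpha> \<le> K"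
    using ae by eventually_elim (simp add: K norm_mult)
  then show ?thesis using True weight_tail_if_bounded[OF gm] by (auto simp: tail_ok_def)
next
  case False
  have "weighted_norm (enn2real p) \<alpha> g = weighted_norm (enn2real p) \<alpha> f"
    unfolding weighted_norm_def by (rule nn_integral_cong_AE) (use ae in eventually_elim, simp)
  then show ?thesis
    using False w Lp_norm_weight_iff[OF False] weight_tail_if_weighted_norm[OF gm enn2real_ge_1[OF p False]]
    by (simp add: tail_ok_def)
qed

lemma integrable_if_tail_ok:
  assumes p: "1 \<le> p" and A: "\<alpha> - 1 + enn2real (1 / p) > 0" and t: "tail_ok p \<alpha> g"
    and gm: "g \<in> borel_measurable borel" and loc: "set_integrable lborel {-1..1} g"
  shows "integrable lborel g"
proof (cases "p = \<infinity>")
  case True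
  then have "\<alpha> - 1 > 0" using A by simp
  then have "integrable lborel (weight_tail 1 ((\<alpha> - 1) / 2) g 1)" using t True by (simp add: tail_ok_def)
  then show ?thesis using \<open>\<alpha> - 1 > 0\<close> by (intro integrable_if_weight_tail[OF _ _ _ gm loc]) auto
next
  case False
  then show ?thesis
    using t A enn2real_ge_1[OF p False] enn2real_inverse[OF p False]
    by (intro integrable_if_weight_tail[OF _ _ _ gm loc]) (auto simp: tail_ok_def)
qed

lemma lebesgue_borel_representative:
  fixes f :: "real \<Rightarrow> complex"
  assumes "f \<in> borel_measurable lebesgue"
  shows "\<exists>g\<in>borel_measurable borel. AE x in lborel. f x = g x"
proof -
  have "(\<lambda>x. Re (f x)) \<in> borel_measurable lebesgue" "(\<lambda>x. Im (f x)) \<in> borel_measurable lebesgue"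
    using assms by measurable
  note re_im = this
  obtain a where a [measurable]: "a \<in> borel_measurable borel" and aeq: "AE x in lborel. Re (f x) = a x"
    using completion_ex_borel_measurable_real[OF re_im(1)] by auto
  obtain b where b [measurable]: "b \<in> borel_measurable borel" and beq: "AE x in lborel. Im (f x) = b x"
    using completion_ex_borel_measurable_real[OF re_im(2)] by auto
  have "(\<lambda>x. Complex (a x) (b x)) \<in> borel_measurable borel"
    unfolding Complex_eq by measurable
  moreover have "AE x in lborel. f x = Complex (a x) (b x)"
    using aeq beq by eventually_elim (simp add: complex_eq_iff)
  ultimately show ?thesis by (intro bexI[of _ "\<lambda>x. Complex (a x) (b x)"])
qed

lemma locally_integrable_measurable:
  assumes "locally_integrable f" shows "f \<in> borel_measurable lebesgue"
proof (rule borel_measurable_LIMSEQ_metric)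
  show "(\<lambda>x. indicator {- real n..real n} x *\<^sub>R f x) \<in> borel_measurable lebesgue" for n
  proof -
    have "set_integrable lebesgue {- real n..real n} f" using assms by (simp add: locally_integrable_def)
    then show ?thesis by (auto simp: set_integrable_def)
  qed
  fix x :: real
  have "\<forall>\<^sub>F n::nat in sequentially. indicator {- real n..real n} x *\<^sub>R f x = f x"
  proof (rule eventually_sequentiallyI[of "nat \<lceil>\<bar>x\<bar>\<rceil>"])
    fix n assume "nat \<lceil>\<bar>x\<bar>\<rceil> \<le> n" then have "- real n \<le> x" "x \<le> real n" by linarith+
    then show "indicator {- real n..real n} x *\<^sub>R f x = f x" by simp
  qed
  then show "(\<lambda>n::nat. indicator {- real n..real n} x *\<^sub>R f x) \<longlonglongrightarrow> f x" by (rule tendsto_eventually)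
qed

text \<open>The order of the steps is forced. A Borel version of \<open>f\<close> is integrable by
  the first weight, so its transform is continuous, hence locally integrable; the second weight
  makes the transform integrable, and only then does inversion produce the continuous
  representative. Changes on null sets affect neither \<open>fourier\<close> nor the norms.\<close>

lemma weighted_condition_representative:
  assumes p: "1 \<le> p" and q: "1 \<le> q" and A: "\<alpha> - 1 + enn2real (1 / p) > 0" and B: "\<beta> - 1 + enn2real (1 / q) > 0"
    and w: "weighted_condition p q \<alpha> \<beta> f"
  shows "\<exists>g. cont_rep f = g \<and> fourier f = fourier g \<and> continuous_on UNIV g \<and> integrable lborel g \<and> integrable lborel (fourier g)
     \<and> tail_ok p \<alpha> g \<and> tail_ok q \<beta> (fourier g)"
proof -
  have li: "locally_integrable f" and wf: "Lp_norm p (\<lambda>x. f x * of_real (\<bar>x\<bar> powr \<alpha>)) < \<infinity>"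
    and wh: "Lp_norm q (\<lambda>\<xi>. fourier f \<xi> * of_real (\<bar>\<xi>\<bar> powr \<beta>)) < \<infinity>"
    using w by (auto simp: weighted_condition_def)
  have fm: "f \<in> borel_measurable lebesgue" by (rule locally_integrable_measurable[OF li])
  then obtain f0 where f0 [measurable]: "f0 \<in> borel_measurable borel" and ae: "AE x in lborel. f x = f0 x"
    using lebesgue_borel_representative by blast
  have f0l: "h \<in> borel_measurable lebesgue" if "h \<in> borel_measurable borel" for h :: "real \<Rightarrow> complex"
    using that by (intro measurable_completion) simp
  have ff0: "fourier f = fourier f0"
    by (rule fourier_cong_AE[OF AE_completion[OF ae] fm f0l[OF f0]])
  have loc: "set_integrable lborel {-1..1} f0"
  proof -
    have "integrable lebesgue (\<lambda>x. indicator {-1..1} x *\<^sub>R f x)"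
    proof -
      have "set_integrable lebesgue {-1..1} f" using li by (simp add: locally_integrable_def)
      then show ?thesis by (simp add: set_integrable_def)
    qed
    then have "integrable lebesgue (\<lambda>x. indicator {-1..1} x *\<^sub>R f0 x)"
    proof (rule integrable_cong_AE_imp)
      show "AE x in lebesgue. indicator {-1..1} x *\<^sub>R f x = indicator {-1..1} x *\<^sub>R f0 x"
        by (rule AE_completion) (use ae in eventually_elim, simp)
      show "(\<lambda>x. indicator {-1..1} x *\<^sub>R f0 x) \<in> borel_measurable lebesgue" by (rule f0l) measurable
    qed
    then show ?thesis unfolding set_integrable_def by (subst (asm) integrable_completion) auto
  qed
  have i0: "integrable lborel f0"
    by (rule integrable_if_tail_ok[OF p A tail_okI[OF p f0 ae wf] f0 loc])
  have hc: "continuous_on UNIV (fourier f0)" by (rule continuous_on_fourier[OF i0])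
  have hm: "fourier f0 \<in> borel_measurable borel" by (rule fourier_measurable[OF i0])
  have hok: "tail_ok q \<beta> (fourier f0)"
    by (rule tail_okI[OF q hm _ wh]) (simp add: ff0)
  have hi: "integrable lborel (fourier f0)"
    by (rule integrable_if_tail_ok[OF q B hok hm])
       (use borel_integrable_atLeastAtMost'[OF continuous_on_subset[OF hc]] in auto)
  define g where "g x = fourier (fourier f0) (- x)" for x
  have gc: "continuous_on UNIV g"
    unfolding g_def by (intro continuous_on_compose2[OF continuous_on_fourier[OF hi]] continuous_intros) auto
  have gm: "g \<in> borel_measurable borel" by (rule borel_measurable_continuous_onI[OF gc])
  have ae0: "AE x in lborel. f0 x = g x" unfolding g_def by (rule fourier_inversion_AE[OF i0 hi])
  have aeg: "AE x in lborel. f x = g x" using ae ae0 by eventually_elim simp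
  have fg: "fourier f = fourier g"
    by (rule fourier_cong_AE[OF AE_completion[OF aeg] fm f0l[OF gm]])
  have gi: "integrable lborel g" by (rule integrable_cong_AE_imp[OF i0]) (use gm ae0 in auto)
  have "cont_rep f = g" by (rule cont_rep_eqI[OF gc aeg])
  moreover have "tail_ok p \<alpha> g" by (rule tail_okI[OF p gm aeg wf])
  ultimately show ?thesis using fg gc gi hi hok ff0 by auto
qed

text \<open>The strict inequality is an open condition. An infinite exponent is replaced by n + 1
  and its weight parameter lowered by 1/(n + 1); both sides converge to the original ones, so some n
  still satisfies the inequality with finite exponents.\<close>

lemma tail_ok_supercritical:
  assumes p: "1 \<le> p" and q: "1 \<le> q" and A: "\<alpha> - 1 + enn2real (1 / p) > 0" and B: "\<beta> - 1 + enn2real (1 / q) > 0"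
    and AB: "(\<alpha> - 1 + enn2real (1 / p)) * (\<beta> - 1 + enn2real (1 / q)) > enn2real (1 / p) * enn2real (1 / q)"
    and g: "tail_ok p \<alpha> g" "tail_ok q \<beta> h"
  shows "\<exists>r s a b. 1 \<le> r \<and> 1 \<le> s \<and> 0 < a \<and> 0 < b \<and> a * b > 1 / (r * s)
     \<and> integrable lborel (weight_tail r a g 1) \<and> integrable lborel (weight_tail s b h 1)"
proof -
  have seq: "\<exists>r a. (\<forall>n::nat. 1 \<le> r n \<and> integrable lborel (weight_tail (r n) (a n) k 1))
      \<and> a \<longlonglongrightarrow> \<gamma> - 1 + enn2real (1 / t) \<and> (\<lambda>n. 1 / r n) \<longlonglongrightarrow> enn2real (1 / t)"
    if t: "1 \<le> t" and ok: "tail_ok t \<gamma> k" for t \<gamma> k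
  proof (cases "t = \<infinity>")
    case True
    have "(\<lambda>n. \<gamma> - 1 - 1 / (real n + 1)) \<longlonglongrightarrow> \<gamma> - 1" "(\<lambda>n. 1 / (real n + 1)) \<longlonglongrightarrow> 0" by real_asymp+
    then show ?thesis
      using True ok by (intro exI[of _ "\<lambda>n. real n + 1"] exI[of _ "\<lambda>n. \<gamma> - 1 - 1 / (real n + 1)"]) (auto simp: tail_ok_def)
  next
    case False
    then show ?thesis
      using ok enn2real_ge_1[OF t False] enn2real_inverse[OF t False]
      by (intro exI[of _ "\<lambda>_. enn2real t"] exI[of _ "\<lambda>_. \<gamma> - 1 + 1 / enn2real t"]) (auto simp: tail_ok_def)
  qed
  obtain r a where ra: "\<And>n::nat. 1 \<le> r n" "\<And>n. integrable lborel (weight_tail (r n) (a n) g 1)"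
      "a \<longlonglongrightarrow> \<alpha> - 1 + enn2real (1 / p)" "(\<lambda>n. 1 / r n) \<longlonglongrightarrow> enn2real (1 / p)"
    using seq[OF p g(1)] by blast
  obtain s b where sb: "\<And>n::nat. 1 \<le> s n" "\<And>n. integrable lborel (weight_tail (s n) (b n) h 1)"
      "b \<longlonglongrightarrow> \<beta> - 1 + enn2real (1 / q)" "(\<lambda>n. 1 / s n) \<longlonglongrightarrow> enn2real (1 / q)"
    using seq[OF q g(2)] by blast
  have "(\<lambda>n. a n * b n - 1 / r n * (1 / s n)) \<longlonglongrightarrow>
      (\<alpha> - 1 + enn2real (1 / p)) * (\<beta> - 1 + enn2real (1 / q)) - enn2real (1 / p) * enn2real (1 / q)"
    by (intro tendsto_intros ra sb)
  then have "\<forall>\<^sub>F n in sequentially. a n * b n - 1 / r n * (1 / s n) > 0"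
    by (rule order_tendstoD(1)) (use AB in simp)
  moreover have "\<forall>\<^sub>F n in sequentially. a n > 0" by (rule order_tendstoD(1)[OF ra(3) A])
  moreover have "\<forall>\<^sub>F n in sequentially. b n > 0" by (rule order_tendstoD(1)[OF sb(3) B])
  ultimately have "\<forall>\<^sub>F n in sequentially. a n * b n > 1 / (r n * s n) \<and> a n > 0 \<and> b n > 0"
    by eventually_elim simp
  then obtain n where "a n * b n > 1 / (r n * s n) \<and> a n > 0 \<and> b n > 0" using eventually_happens by fastforce
  then show ?thesis using ra sb by blast
qed

section \<open>Extended exponents and the four cases\<close>

lemma conjugate_exponent:
  fixes p p' :: ennreal
  assumes "1 / p + 1 / p' = 1"
  shows "enn2real (1 / p') = 1 - enn2real (1 / p)"
proof -
  have "1 / p < top" "1 / p' < top"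
    using assms by (metis ennreal_add_eq_top ennreal_one_neq_top less_top)+
  then have "enn2real (1 / p + 1 / p') = enn2real (1 / p) + enn2real (1 / p')" by (rule enn2real_plus)
  then show ?thesis by (simp add: assms)
qed

lemma enn2real_inverse_mult:
  assumes "1 \<le> p" "1 \<le> q"
  shows "enn2real (1 / (p * q)) = enn2real (1 / p) * enn2real (1 / q)"
proof (cases "p = \<infinity> \<or> q = \<infinity>")
  case True
  moreover have "p \<noteq> 0" "q \<noteq> 0" using assms by auto
  ultimately have "p * q = \<infinity>" by (auto simp: ennreal_mult_eq_top_iff)
  with True show ?thesis by auto
next
  case False
  have "1 \<le> p * q" using mult_mono[OF assms] by simp
  moreover have "p * q \<noteq> \<infinity>" using False by (auto simp: ennreal_mult_eq_top_iff)
  ultimately show ?thesis using False assms by (simp add: enn2real_inverse enn2real_mult)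
qed

lemma weighted_norm_uminus: "g \<in> borel_measurable borel \<Longrightarrow> weighted_norm p \<alpha> (\<lambda>x. g (- x)) = weighted_norm p \<alpha> g"
  unfolding weighted_norm_def
  using nn_integral_real_affine[of "\<lambda>x. ennreal ((norm (g x) * \<bar>x\<bar> powr \<alpha>) powr p)" "-1" 0] by simp

text \<open>\<open>critical_example\<close> requires its first exponent to exceed 1. If p = 1 then q
  > 1, and the construction is made with the roles exchanged; the transform of that function is the
  example, since a second transform only reflects the argument. Divergence of one of the two
  sequences is enough, as the transfer of limits yields the other.\<close>

lemma critical_example':
  assumes p: "p \<ge> 1" and q: "q \<ge> 1" and pq: "(p, q) \<noteq> (1, 1)" and \<alpha>: "\<alpha> - 1 + 1 / p > 0" and \<beta>: "\<beta> - 1 + 1 / q > 0"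
    and AB: "(\<alpha> - 1 + 1 / p) * (\<beta> - 1 + 1 / q) = 1 / (p * q)"
  shows "\<exists>F. continuous_on UNIV F \<and> weighted_norm p \<alpha> F < \<infinity> \<and> weighted_norm q \<beta> (fourier F) < \<infinity>
     \<and> (\<not> has_xlimit (\<lambda>N. P N F) \<or> \<not> has_xlimit (\<lambda>N. P N (fourier F)))"
proof (cases "p = 1")
  case False
  then show ?thesis using critical_example[of p q \<alpha> \<beta>] assms by auto
next
  case True
  then have "q > 1" using q pq by auto
  moreover have "(\<beta> - 1 + 1 / q) * (\<alpha> - 1 + 1 / p) = 1 / (q * p)" using AB by (simp add: mult.commute)
  ultimately obtain F where F: "continuous_on UNIV F" "integrable lborel F" "weighted_norm q \<beta> F < \<infinity>"
      "weighted_norm p \<alpha> (fourier F) < \<infinity>" "\<not> has_xlimit (\<lambda>N. P N F)"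
    using critical_example[OF _ p \<beta> \<alpha>] by blast
  have hc: "continuous_on UNIV (fourier F)" by (rule continuous_on_fourier[OF F(2)])
  have hm: "fourier F \<in> borel_measurable borel" by (rule fourier_measurable[OF F(2)])
  have hi: "integrable lborel (fourier F)"
    by (rule integrable_if_weight_tail[OF p \<alpha> weight_tail_if_weighted_norm[OF hm p F(4)] hm])
       (use borel_integrable_atLeastAtMost'[OF continuous_on_subset[OF hc]] in auto)
  have inv: "F x = fourier (fourier F) (- x)" for x
    using fun_cong[OF fourier_inversion[OF F(2) hi F(1)], of x] .
  then have ff: "fourier (fourier F) = (\<lambda>x. F (- x))" by (simp add: fun_eq_iff)
  have "weighted_norm q \<beta> (fourier (fourier F)) < \<infinity>"
    unfolding ff using F(2,3) by (subst weighted_norm_uminus) auto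
  moreover have "\<not> has_xlimit (\<lambda>N. P N (fourier (fourier F)))" unfolding ff P_uminus by (rule F(5))
  ultimately show ?thesis using hc F(4) by blast
qed

theorem theorem2p1:
  fixes p q p' q' :: ennreal and \<alpha> \<beta> :: real
  assumes "1 \<le> p" and "1 \<le> q"
    and "1 / p + 1 / p' = 1" and "1 / q + 1 / q' = 1"
    and "\<alpha> - enn2real (1 / p') > 0" and "\<beta> - enn2real (1 / q') > 0"
  shows
    "((\<alpha> - enn2real (1 / p')) * (\<beta> - enn2real (1 / q')) > enn2real (1 / (p * q)) \<longrightarrow>
        (\<forall>f. weighted_condition p q \<alpha> \<beta> f \<longrightarrow>
          (\<exists>L. (\<lambda>N. P N (cont_rep f)) \<longlonglongrightarrow> L \<and> (\<lambda>N. P N (fourier f)) \<longlonglongrightarrow> L)))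
     \<and>
     ((\<alpha> - enn2real (1 / p')) * (\<beta> - enn2real (1 / q')) = enn2real (1 / (p * q)) \<and>
        (p, q) = (1, 1) \<longrightarrow>
        (\<forall>f. weighted_condition p q \<alpha> \<beta> f \<longrightarrow>
          (\<exists>L. (\<lambda>N. P N (cont_rep f)) \<longlonglongrightarrow> L \<and> (\<lambda>N. P N (fourier f)) \<longlonglongrightarrow> L)))
     \<and>
     ((\<alpha> - enn2real (1 / p')) * (\<beta> - enn2real (1 / q')) = enn2real (1 / (p * q)) \<and>
        (p, q) \<noteq> (1, 1) \<longrightarrow>
        (\<exists>f. weighted_condition p q \<alpha> \<beta> f \<and>
          \<not> has_xlimit (\<lambda>N. P N (cont_rep f)) \<and> \<not> has_xlimit (\<lambda>N. P N (fourier f)))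
        \<and>
        (\<forall>f. weighted_condition p q \<alpha> \<beta> f \<longrightarrow>
          has_xlimit (\<lambda>N. P N (cont_rep f)) \<or> has_xlimit (\<lambda>N. P N (fourier f)) \<longrightarrow>
          (\<exists>L. tends_to_xlimit (\<lambda>N. P N (cont_rep f)) L \<and>
               tends_to_xlimit (\<lambda>N. P N (fourier f)) L)))
     \<and>
     ((\<alpha> - enn2real (1 / p')) * (\<beta> - enn2real (1 / q')) < enn2real (1 / (p * q)) \<longrightarrow>
        (\<exists>f. weighted_condition p q \<alpha> \<beta> f \<and>
          (\<exists>L M. (\<lambda>N. P N (cont_rep f)) \<longlonglongrightarrow> L \<and> (\<lambda>N. P N (fourier f)) \<longlonglongrightarrow> M \<and> L \<noteq> M)))"
proof -
  note p = assms(1) and q = assms(2)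
  define A B where "A = \<alpha> - 1 + enn2real (1 / p)" and "B = \<beta> - 1 + enn2real (1 / q)"
  have AB: "\<alpha> - enn2real (1 / p') = A" "\<beta> - enn2real (1 / q') = B"
    unfolding A_def B_def conjugate_exponent[OF assms(3)] conjugate_exponent[OF assms(4)] by simp_all
  have pos: "A > 0" "B > 0" using assms(5,6) unfolding AB .
  note rep = weighted_condition_representative[OF p q pos[unfolded A_def B_def]]
  \<comment> \<open>If p or q is infinite, the right-hand side is 0 while A B > 0, so infinite
    exponents are always supercritical.\<close>
  have finite_exponents: "p \<noteq> \<infinity>" "q \<noteq> \<infinity>" if "A * B \<le> enn2real (1 / p) * enn2real (1 / q)"
    using that mult_pos_pos[OF pos] by auto
  have fin: "1 \<le> enn2real p" "1 \<le> enn2real q" "enn2real (1 / p) = 1 / enn2real p" "enn2real (1 / q) = 1 / enn2real q"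
      "A = \<alpha> - 1 + 1 / enn2real p" "B = \<beta> - 1 + 1 / enn2real q"
    if "p \<noteq> \<infinity>" "q \<noteq> \<infinity>"
    using that p q by (auto simp: enn2real_ge_1 enn2real_inverse A_def B_def)
  have crep: "cont_rep f = f" if "continuous_on UNIV f" for f by (rule cont_rep_eqI[OF that]) simp
  have transfer: "tends_to_xlimit (\<lambda>N. P N (cont_rep f)) L \<longleftrightarrow> tends_to_xlimit (\<lambda>N. P N (fourier f)) L"
    if w: "weighted_condition p q \<alpha> \<beta> f" and eq: "A * B = enn2real (1 / p) * enn2real (1 / q)" for f L
  proof -
    note pq = finite_exponents[OF eq_refl[OF eq]]
    obtain g where g: "cont_rep f = g" "fourier f = fourier g" "continuous_on UNIV g" "integrable lborel g"
        "integrable lborel (fourier g)" "tail_ok p \<alpha> g" "tail_ok q \<beta> (fourier g)"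
      using rep[OF w] by blast
    show ?thesis
      unfolding g(1,2)
      by (rule poisson_critical[OF g(4,5,3) fin(1,2)[OF pq] pos])
         (use eq g(6,7) pq fin[OF pq] in \<open>auto simp: tail_ok_def\<close>)
  qed
  have transfer_limit: "\<exists>L. (\<lambda>N. P N (cont_rep f)) \<longlonglongrightarrow> L \<and> (\<lambda>N. P N (fourier f)) \<longlonglongrightarrow> L"
    if conv: "convergent (\<lambda>N. P N g)" and "cont_rep f = g" "fourier f = fourier g"
      "\<And>l. tends_to_xlimit (\<lambda>N. P N g) l \<longleftrightarrow> tends_to_xlimit (\<lambda>N. P N (fourier g)) l" for f g
  proof -
    obtain L where "(\<lambda>N. P N g) \<longlonglongrightarrow> L" using conv unfolding convergent_def by blast
    then show ?thesis using that(2,3) that(4)[of "Finite L"] by auto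
  qed
  have item1: "\<exists>L. (\<lambda>N. P N (cont_rep f)) \<longlonglongrightarrow> L \<and> (\<lambda>N. P N (fourier f)) \<longlonglongrightarrow> L"
    if w: "weighted_condition p q \<alpha> \<beta> f" and gt: "A * B > enn2real (1 / p) * enn2real (1 / q)" for f
  proof -
    obtain g where g: "cont_rep f = g" "fourier f = fourier g" "continuous_on UNIV g" "integrable lborel g"
        "integrable lborel (fourier g)" "tail_ok p \<alpha> g" "tail_ok q \<beta> (fourier g)"
      using rep[OF w] by blast
    obtain r s a b where rs: "1 \<le> r" "1 \<le> s" "0 < a" "0 < b" "a * b > 1 / (r * s)"
        "integrable lborel (weight_tail r a g 1)" "integrable lborel (weight_tail s b (fourier g) 1)"
      using tail_ok_supercritical[OF p q pos[unfolded A_def B_def] gt[unfolded A_def B_def] g(6,7)] by blast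
    show ?thesis
      by (rule transfer_limit[OF poisson_supercritical_convergent[OF g(4,5,3) rs] g(1,2)])
         (rule poisson_critical[OF g(4,5,3) rs(1-4) less_imp_le[OF rs(5)] rs(6,7)])
  qed
  have item2: "\<exists>L. (\<lambda>N. P N (cont_rep f)) \<longlonglongrightarrow> L \<and> (\<lambda>N. P N (fourier f)) \<longlonglongrightarrow> L"
    if w: "weighted_condition p q \<alpha> \<beta> f" and eq: "A * B = enn2real (1 / p) * enn2real (1 / q)" and pq: "p = 1" "q = 1" for f
  proof -
    obtain g where g: "cont_rep f = g" "fourier f = fourier g" "continuous_on UNIV g" "integrable lborel g"
        "integrable lborel (fourier g)" "tail_ok p \<alpha> g" "tail_ok q \<beta> (fourier g)"
      using rep[OF w] by blast
    have t: "integrable lborel (weight_tail 1 A g 1)" "integrable lborel (weight_tail 1 B (fourier g) 1)" "A * B = 1"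
      using g(6,7) eq pq by (auto simp: tail_ok_def A_def B_def)
    show ?thesis
      by (rule transfer_limit[OF poisson_L1_convergent[OF g(4,5,3) pos t(3,1,2)] g(1,2)])
         (use transfer[OF w eq] g(1,2) in simp)
  qed
  have item3: "\<exists>f. weighted_condition p q \<alpha> \<beta> f \<and> \<not> has_xlimit (\<lambda>N. P N (cont_rep f)) \<and> \<not> has_xlimit (\<lambda>N. P N (fourier f))"
    if eq: "A * B = enn2real (1 / p) * enn2real (1 / q)" and pq1: "(p, q) \<noteq> (1, 1)"
  proof -
    note pq = finite_exponents[OF eq_refl[OF eq]]
    have "(enn2real p, enn2real q) \<noteq> (1, 1)"
      using pq pq1 by (cases p; cases q) auto
    then obtain F where F: "continuous_on UNIV F" "weighted_norm (enn2real p) \<alpha> F < \<infinity>" "weighted_norm (enn2real q) \<beta> (fourier F) < \<infinity>"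
        "\<not> has_xlimit (\<lambda>N. P N F) \<or> \<not> has_xlimit (\<lambda>N. P N (fourier F))"
      using critical_example'[OF fin(1,2)[OF pq], of \<alpha> \<beta>] pos eq fin[OF pq] by auto
    have w: "weighted_condition p q \<alpha> \<beta> F" by (rule weighted_conditionI[OF F(1) pq F(2,3)])
    \<comment> \<open>The example controls only one of the two sequences; the positive half of the
      critical case makes the other one diverge as well.\<close>
    have "has_xlimit (\<lambda>N. P N (cont_rep F)) \<longleftrightarrow> has_xlimit (\<lambda>N. P N (fourier F))"
      unfolding has_xlimit_def using transfer[OF w eq] by blast
    then have "\<not> has_xlimit (\<lambda>N. P N (cont_rep F)) \<and> \<not> has_xlimit (\<lambda>N. P N (fourier F))"
      using F(4) unfolding crep[OF F(1)] by blast
    then show ?thesis using w by blast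
  qed
  have item4: "\<exists>f. weighted_condition p q \<alpha> \<beta> f \<and>
      (\<exists>L M. (\<lambda>N. P N (cont_rep f)) \<longlonglongrightarrow> L \<and> (\<lambda>N. P N (fourier f)) \<longlonglongrightarrow> M \<and> L \<noteq> M)"
    if lt: "A * B < enn2real (1 / p) * enn2real (1 / q)"
  proof -
    note pq = finite_exponents[OF less_imp_le[OF lt]]
    obtain F where F: "continuous_on UNIV F" "weighted_norm (enn2real p) \<alpha> F < \<infinity>" "weighted_norm (enn2real q) \<beta> (fourier F) < \<infinity>"
        "(\<lambda>N. P N F) \<longlonglongrightarrow> 0" "(\<lambda>N. P N (fourier F)) \<longlonglongrightarrow> 1"
      using subcritical_example[OF fin(1,2)[OF pq], of \<alpha> \<beta>] pos lt fin[OF pq] by auto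
    have "weighted_condition p q \<alpha> \<beta> F" by (rule weighted_conditionI[OF F(1) pq F(2,3)])
    then show ?thesis
      using F(4,5) crep[OF F(1)] by (intro exI[of _ F] conjI exI[of _ 0] exI[of _ 1]) auto
  qed
  show ?thesis
    unfolding AB enn2real_inverse_mult[OF p q]
    using item1 item2 item3 item4 transfer unfolding has_xlimit_def by (intro conjI allI impI; blast)
qed

end
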